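(* Suppose that $G$ is a uniform unitary reflection group in $V$, i.e. $e_H=e$ is independent of $H\in\mathcal A$. For $\zeta\in\mu_e$ define $F_\zeta:=\{v\in V: Q_0(v)=\zeta\}$. Then: (1) $F=\coprod_{\zeta\in\mu_e}F_\zeta$. (2) The group $\Gamma$ permutes the $F_\zeta$ ($\zeta\in\mu_e$) transitively, and, writing $F_0$ for $F_1$ (i.e. $\zeta=1$), the stabiliser of $F_0$ in $\Gamma$ is $\Gamma_0:=\ker(\varepsilon\otimes\gamma_d)$, where $\varepsilon$ is the character of $G$ defined by $\varepsilon(g)=\det_V(g)^{-1}\in\mu_e$. (3) Let $\Phi=\sum_{i=0}^{e-1}\varepsilon^i\otimes\gamma_{di}\in R_+(\Gamma)$. Then for each $j$, as elements of $R_+(\Gamma)$, $$H^j(F,\mathbb C)=\mathrm{Ind}_{\Gamma_0}^\Gamma\big(H^j(F_0,\mathbb C)\big)=\Phi\cdot H^j_0(F_0,\mathbb C),$$ where $H^j_0(F_0,\mathbb C)$ is any element of $R_+(\Gamma)$ which restricts to $H^j(F_0,\mathbb C)\in R_+(\Gamma_0)$. (4) We have $$P^\Gamma(F,t)=\mathrm{Ind}_{\Gamma_0}^\Gamma\big(P^{\Gamma_0}(F_0,t)\big)=\Phi\cdot P_0^\Gamma(F_0,t),$$ where $P_0^\Gamma(F_0,t)$ is any element of $R_+(\Gamma)[t]$ which restricts to $P^{\Gamma_0}(F_0,t)\in R_+(\Gamma_0)[t]$.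
   Context: $V=\mathbb C^\ell$; $G\subset GL(V)$ is an irreducible finite complex (unitary) reflection group with set of reflecting hyperplanes $\mathcal A$; for $H\in\mathcal A$, $e_H$ is the order of the pointwise stabiliser $G_H$ and $\ell_H\in V^*$ has kernel $H$. $Q_0=\prod_H\ell_H$, $d=\deg Q_0=|\mathcal A|$, $Q=\prod_H\ell_H^{e_H}=Q_0^e$, $m=\deg Q=de$, $F=\{v\in V: Q(v)=1\}$. $\mu_n$ is the group of complex $n$-th roots of unity and $\gamma_j$ denotes the character $\xi\mapsto\xi^j$ of $\mu_m$. $\Gamma=G\times\mu_m$ acts on $F$ by $(g,\xi)v=\xi^{-1}gv$, and on cohomology by the inverse of pullback. $\rho\otimes\gamma_j$ denotes the representation $(g,\xi)\mapsto\gamma_j(\xi)\rho(g)$. For a finite group $K$, $R_+(K)$ is the set of classes of actual complex representations in the Grothendieck ring $R(K)$, and for a $K$-variety $X$, $P^K(X,t)=\sum_{i\ge 0}H^i(X,\mathbb C)t^i\in R_+(K)[t]$. *)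

theory Defs
  imports
    "HOL-Analysis.Analysis"
    "HOL-Homology.Homology"
    "HOL-Algebra.Algebra"
    "Jordan_Normal_Form.Matrix"
begin

text \<open>The names \<open>mat\<close> and \<open>vec\<close> also belong to Jordan-Normal-Form matrices, which
  are used below for representations of variable degree; the reflection group consists of
  matrices of type \<open>complex ^ 'n ^ 'n\<close>.\<close>

section \<open>Reflection groups\<close>

definition GL_group :: "(complex ^ 'n ^ 'n) monoid" where
  "GL_group = \<lparr>carrier = {A. invertible A}, mult = (**), one = Finite_Cartesian_Product.mat 1\<rparr>"

definition fix_space :: "complex ^ 'n ^ 'n \<Rightarrow> (complex ^ 'n) set" where
  "fix_space g = {v. g *v v = v}"

text \<open>Finite order is not required of a reflection here: it is automatic inside the finite
  groups considered below.\<close>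

definition reflection :: "complex ^ 'n ^ 'n \<Rightarrow> bool" where
  "reflection s \<longleftrightarrow> invertible s \<and> Suc (vec.dim (fix_space s)) = CARD('n)"

definition finite_reflection_group :: "(complex ^ 'n ^ 'n) set \<Rightarrow> bool" where
  "finite_reflection_group G \<longleftrightarrow>
     finite G \<and> subgroup G GL_group \<and> generate GL_group {s \<in> G. reflection s} = G"

definition irreducible_group :: "(complex ^ 'n ^ 'n) set \<Rightarrow> bool" where
  "irreducible_group G \<longleftrightarrow>
     (\<forall>W. vec.subspace W \<and> (\<forall>g\<in>G. \<forall>w\<in>W. g *v w \<in> W) \<longrightarrow> W = {0} \<or> W = UNIV)"

definition hyperplanes :: "(complex ^ 'n ^ 'n) set \<Rightarrow> (complex ^ 'n) set set" where
  "hyperplanes G = fix_space ` {s \<in> G. reflection s}"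

definition e_of :: "(complex ^ 'n ^ 'n) set \<Rightarrow> (complex ^ 'n) set \<Rightarrow> nat" where
  "e_of G H = card {g \<in> G. \<forall>v\<in>H. g *v v = v}"

definition linear_form_with_kernel :: "(complex ^ 'n \<Rightarrow> complex) \<Rightarrow> (complex ^ 'n) set \<Rightarrow> bool" where
  "linear_form_with_kernel f H \<longleftrightarrow> Vector_Spaces.linear (*s) (*) f \<and> {v. f v = 0} = H"

text \<open>The linear forms \<open>l H\<close> are a choice, determined only up to non-zero scalars.  The degrees
  of the products of linear forms \<open>Q0\<close> and \<open>Q\<close> are \<open>deg_Q0\<close> and \<open>deg_Q\<close>.\<close>

definition Q0 ::
  "(complex ^ 'n ^ 'n) set \<Rightarrow> ((complex ^ 'n) set \<Rightarrow> complex ^ 'n \<Rightarrow> complex) \<Rightarrow> complex ^ 'n \<Rightarrow> complex"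
  where "Q0 G l v = (\<Prod>H\<in>hyperplanes G. l H v)"

definition Q ::
  "(complex ^ 'n ^ 'n) set \<Rightarrow> ((complex ^ 'n) set \<Rightarrow> complex ^ 'n \<Rightarrow> complex) \<Rightarrow> complex ^ 'n \<Rightarrow> complex"
  where "Q G l v = (\<Prod>H\<in>hyperplanes G. l H v ^ e_of G H)"

definition deg_Q0 :: "(complex ^ 'n ^ 'n) set \<Rightarrow> nat" where
  "deg_Q0 G = card (hyperplanes G)"

definition deg_Q :: "(complex ^ 'n ^ 'n) set \<Rightarrow> nat" where
  "deg_Q G = (\<Sum>H\<in>hyperplanes G. e_of G H)"

definition milnor_fibre ::
  "(complex ^ 'n ^ 'n) set \<Rightarrow> ((complex ^ 'n) set \<Rightarrow> complex ^ 'n \<Rightarrow> complex) \<Rightarrow> (complex ^ 'n) set"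
  where "milnor_fibre G l = {v. Q G l v = 1}"

definition reduced_fibre ::
  "(complex ^ 'n ^ 'n) set \<Rightarrow> ((complex ^ 'n) set \<Rightarrow> complex ^ 'n \<Rightarrow> complex) \<Rightarrow> complex \<Rightarrow> (complex ^ 'n) set"
  where "reduced_fibre G l \<zeta> = {v. Q0 G l v = \<zeta>}"

definition mu :: "nat \<Rightarrow> complex monoid" where
  "mu n = \<lparr>carrier = {z. z ^ n = 1}, mult = (*), one = 1\<rparr>"

definition Gamma_group :: "(complex ^ 'n ^ 'n) set \<Rightarrow> ((complex ^ 'n ^ 'n) \<times> complex) monoid" where
  "Gamma_group G = (GL_group\<lparr>carrier := G\<rparr>) \<times>\<times> mu (deg_Q G)"

definition Gamma_act :: "(complex ^ 'n ^ 'n) \<times> complex \<Rightarrow> complex ^ 'n \<Rightarrow> complex ^ 'n" where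
  "Gamma_act \<gamma> v = inverse (snd \<gamma>) *s (fst \<gamma> *v v)"

definition eps :: "complex ^ 'n ^ 'n \<Rightarrow> complex" where
  "eps g = inverse (Determinants.det g)"

text \<open>The linear character \<open>\<theta> \<otimes> \<gamma>\<^sub>j\<close> of \<open>G \<times> \<mu>\<^sub>m\<close>, for a linear character \<open>\<theta>\<close> of \<open>G\<close>.\<close>

definition otimes_gamma :: "('g \<Rightarrow> complex) \<Rightarrow> nat \<Rightarrow> 'g \<times> complex \<Rightarrow> complex" where
  "otimes_gamma \<theta> j = (\<lambda>(g, \<xi>). \<xi> ^ j * \<theta> g)"

definition Gamma0 :: "(complex ^ 'n ^ 'n) set \<Rightarrow> nat \<Rightarrow> ((complex ^ 'n ^ 'n) \<times> complex) monoid" where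
  "Gamma0 G e =
     (Gamma_group G)\<lparr>carrier := kernel (Gamma_group G) (mu e) (otimes_gamma eps (deg_Q0 G))\<rparr>"


section \<open>Complex representations with explicit carriers\<close>

text \<open>A representation is a complex vector space, given as an HOL-Algebra module record,
  together with the action of the group elements.  The ring fields \<open>mult\<close> and \<open>one\<close> of a module
  record are irrelevant.\<close>

type_synonym ('k, 'v) rep = "(complex, 'v) module \<times> ('k \<Rightarrow> 'v \<Rightarrow> 'v)"

definition rep_iso :: "('k, 'm) monoid_scheme \<Rightarrow> ('k, 'v) rep \<Rightarrow> ('k, 'w) rep \<Rightarrow> bool" where
  "rep_iso K V W \<longleftrightarrow> (\<exists>T.
     bij_betw T (carrier (fst V)) (carrier (fst W)) \<and>
     (\<forall>x\<in>carrier (fst V). \<forall>y\<in>carrier (fst V). T (x \<oplus>\<^bsub>fst V\<^esub> y) = T x \<oplus>\<^bsub>fst W\<^esub> T y) \<and>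
     (\<forall>c. \<forall>x\<in>carrier (fst V). T (c \<odot>\<^bsub>fst V\<^esub> x) = c \<odot>\<^bsub>fst W\<^esub> T x) \<and>
     (\<forall>k\<in>carrier K. \<forall>x\<in>carrier (fst V). T (snd V k x) = snd W k (T x)))"

text \<open>The induced representation from a subgroup \<open>H\<close> of a finite group \<open>K\<close>, in its model as the
  space of functions \<open>f : K \<rightarrow> V\<close> with \<open>f (h k) = h (f k)\<close>, on which \<open>K\<close> acts by right
  translation.\<close>

definition ind_rep :: "('k, 'm) monoid_scheme \<Rightarrow> 'k set \<Rightarrow> ('k, 'v) rep \<Rightarrow> ('k, 'k \<Rightarrow> 'v) rep" where
  "ind_rep K H V =
     (\<lparr>carrier = {f \<in> carrier K \<rightarrow>\<^sub>E carrier (fst V).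
                    \<forall>h\<in>H. \<forall>k\<in>carrier K. f (h \<otimes>\<^bsub>K\<^esub> k) = snd V h (f k)},
       mult = undefined, one = undefined,
       zero = (\<lambda>k\<in>carrier K. \<zero>\<^bsub>fst V\<^esub>),
       add = (\<lambda>f g. \<lambda>k\<in>carrier K. f k \<oplus>\<^bsub>fst V\<^esub> g k),
       smult = (\<lambda>c f. \<lambda>k\<in>carrier K. c \<odot>\<^bsub>fst V\<^esub> f k)\<rparr>,
      (\<lambda>x f. \<lambda>k\<in>carrier K. f (k \<otimes>\<^bsub>K\<^esub> x)))"


section \<open>The Grothendieck ring of a finite group\<close>

text \<open>Finite-dimensional representations are represented, up to isomorphism, by matrix
  representations: a degree together with a homomorphism to matrices of that degree.\<close>

type_synonym 'k mrep = "nat \<times> ('k \<Rightarrow> complex mat)"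

definition matrix_reps :: "('k, 'm) monoid_scheme \<Rightarrow> 'k mrep set" where
  "matrix_reps K = {(n, A).
     (\<forall>k\<in>carrier K. A k \<in> carrier_mat n n) \<and> A \<one>\<^bsub>K\<^esub> = 1\<^sub>m n \<and>
     (\<forall>k\<in>carrier K. \<forall>k'\<in>carrier K. A (k \<otimes>\<^bsub>K\<^esub> k') = A k * A k')}"

definition rep_of_mrep :: "'k mrep \<Rightarrow> ('k, complex Matrix.vec) rep" where
  "rep_of_mrep A = (module_vec TYPE(complex) (fst A), \<lambda>k v. snd A k *\<^sub>v v)"

definition mrep_sum :: "'k mrep \<Rightarrow> 'k mrep \<Rightarrow> 'k mrep" where
  "mrep_sum A B = (fst A + fst B,
     \<lambda>k. four_block_mat (snd A k) (0\<^sub>m (fst A) (fst B)) (0\<^sub>m (fst B) (fst A)) (snd B k))"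

text \<open>The tensor product, with matrices given by the Kronecker product.\<close>

definition mrep_tensor :: "'k mrep \<Rightarrow> 'k mrep \<Rightarrow> 'k mrep" where
  "mrep_tensor A B = (fst A * fst B,
     \<lambda>k. Matrix.mat (fst A * fst B) (fst A * fst B)
       (\<lambda>(i, j). snd A k $$ (i div fst B, j div fst B) * snd B k $$ (i mod fst B, j mod fst B)))"

definition mrep_char :: "('k \<Rightarrow> complex) \<Rightarrow> 'k mrep" where
  "mrep_char \<theta> = (1, \<lambda>k. Matrix.mat 1 1 (\<lambda>_. \<theta> k))"

definition mrep_zero :: "'k mrep" where
  "mrep_zero = (0, \<lambda>_. 1\<^sub>m 0)"

text \<open>A pair \<open>(A, B)\<close> stands for the virtual representation \<open>A - B\<close>.  Since complex representations
  of a finite group are semisimple, relations from direct sums and from short exact sequences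
  define the same Grothendieck group.\<close>

definition virtual_rel :: "('k, 'm) monoid_scheme \<Rightarrow> (('k mrep \<times> 'k mrep) \<times> ('k mrep \<times> 'k mrep)) set" where
  "virtual_rel K = {((A, B), (A', B')).
     A \<in> matrix_reps K \<and> B \<in> matrix_reps K \<and> A' \<in> matrix_reps K \<and> B' \<in> matrix_reps K \<and>
     (\<exists>C\<in>matrix_reps K.
        rep_iso K (rep_of_mrep (mrep_sum (mrep_sum A B') C))
                  (rep_of_mrep (mrep_sum (mrep_sum A' B) C)))}"

type_synonym 'k virtual = "('k mrep \<times> 'k mrep) set"

definition virtual_class :: "('k, 'm) monoid_scheme \<Rightarrow> 'k mrep \<Rightarrow> 'k mrep \<Rightarrow> 'k virtual" where
  "virtual_class K A B = virtual_rel K `` {(A, B)}"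

definition Rep_ring :: "('k, 'm) monoid_scheme \<Rightarrow> 'k virtual ring" where
  "Rep_ring K = \<lparr>
     carrier = (matrix_reps K \<times> matrix_reps K) // virtual_rel K,
     mult = (\<lambda>x y. \<Union>(A, B)\<in>x. \<Union>(C, D)\<in>y.
               virtual_class K (mrep_sum (mrep_tensor A C) (mrep_tensor B D))
                               (mrep_sum (mrep_tensor A D) (mrep_tensor B C))),
     one = virtual_class K (mrep_char (\<lambda>_. 1)) mrep_zero,
     zero = virtual_class K mrep_zero mrep_zero,
     add = (\<lambda>x y. \<Union>(A, B)\<in>x. \<Union>(C, D)\<in>y. virtual_class K (mrep_sum A C) (mrep_sum B D))\<rparr>"

definition Rep_plus :: "('k, 'm) monoid_scheme \<Rightarrow> 'k virtual set" where
  "Rep_plus K = (\<lambda>A. virtual_class K A mrep_zero) ` matrix_reps K"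

text \<open>The class in the Grothendieck ring of a finite-dimensional representation on an arbitrary
  vector space; the value for an infinite-dimensional one is the empty set, which is not an element
  of the Grothendieck ring.\<close>

definition rep_class :: "('k, 'm) monoid_scheme \<Rightarrow> ('k, 'v) rep \<Rightarrow> 'k virtual" where
  "rep_class K V =
     (\<Union>A\<in>{A \<in> matrix_reps K. rep_iso K V (rep_of_mrep A)}. virtual_class K A mrep_zero)"

text \<open>In the following lifts from pairs to classes, the united sets are all equal.\<close>

definition Res :: "('k, 'm) monoid_scheme \<Rightarrow> 'k set \<Rightarrow> 'k virtual \<Rightarrow> 'k virtual" where
  "Res K H x = (\<Union>(A, B)\<in>x. virtual_class (K\<lparr>carrier := H\<rparr>) A B)"

definition Ind :: "('k, 'm) monoid_scheme \<Rightarrow> 'k set \<Rightarrow> 'k virtual \<Rightarrow> 'k virtual" where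
  "Ind K H x = (\<Union>(A, B)\<in>x.
     \<Union>A'\<in>{A' \<in> matrix_reps K. rep_iso K (ind_rep K H (rep_of_mrep A)) (rep_of_mrep A')}.
     \<Union>B'\<in>{B' \<in> matrix_reps K. rep_iso K (ind_rep K H (rep_of_mrep B)) (rep_of_mrep B')}.
       virtual_class K A' B')"

text \<open>Polynomials over the Grothendieck ring are those of HOL-Algebra, i.e. coefficient functions
  of finite support.\<close>

definition Rep_plus_poly :: "('k, 'm) monoid_scheme \<Rightarrow> (nat \<Rightarrow> 'k virtual) set" where
  "Rep_plus_poly K = {p \<in> carrier (UP (Rep_ring K)). \<forall>i. p i \<in> Rep_plus K}"


section \<open>Singular cohomology with complex coefficients\<close>

type_synonym 'a cochain = "((nat \<Rightarrow> real) \<Rightarrow> 'a) \<Rightarrow> complex"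

text \<open>A cochain on \<open>Y\<close> is a function on singular simplices of \<open>Y\<close>, extended by zero.\<close>

definition cochains :: "nat \<Rightarrow> 'a topology \<Rightarrow> 'a cochain set" where
  "cochains p Y = {\<phi>. \<forall>\<sigma>. \<not> singular_simplex p Y \<sigma> \<longrightarrow> \<phi> \<sigma> = 0}"

definition coboundary :: "nat \<Rightarrow> 'a topology \<Rightarrow> 'a cochain \<Rightarrow> 'a cochain" where
  "coboundary p Y \<phi> = (\<lambda>\<sigma>. if singular_simplex (Suc p) Y \<sigma>
     then (\<Sum>k\<le>Suc p. (- 1) ^ k * \<phi> (singular_face (Suc p) k \<sigma>)) else 0)"

definition cocycles :: "nat \<Rightarrow> 'a topology \<Rightarrow> 'a cochain set" where
  "cocycles p Y = {\<phi> \<in> cochains p Y. coboundary p Y \<phi> = (\<lambda>_. 0)}"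

definition coboundaries :: "nat \<Rightarrow> 'a topology \<Rightarrow> 'a cochain set" where
  "coboundaries p Y =
     (case p of 0 \<Rightarrow> {\<lambda>_. 0} | Suc q \<Rightarrow> coboundary q Y ` cochains q Y)"

definition cocycle_module :: "nat \<Rightarrow> 'a topology \<Rightarrow> (complex, 'a cochain) module" where
  "cocycle_module p Y = \<lparr>carrier = cocycles p Y, mult = undefined, one = undefined,
     zero = (\<lambda>_. 0), add = (\<lambda>\<phi> \<psi> \<sigma>. \<phi> \<sigma> + \<psi> \<sigma>), smult = (\<lambda>c \<phi> \<sigma>. c * \<phi> \<sigma>)\<rparr>"

definition quotient_module :: "('a, 'b) module \<Rightarrow> 'b set \<Rightarrow> ('a, 'b set) module" where
  "quotient_module M N = \<lparr>carrier = a_rcosets\<^bsub>M\<^esub> N, mult = undefined, one = undefined,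
     zero = N, add = (\<lambda>U V. U <+>\<^bsub>M\<^esub> V), smult = (\<lambda>c U. \<Union>u\<in>U. N +>\<^bsub>M\<^esub> (c \<odot>\<^bsub>M\<^esub> u))\<rparr>"

definition cohomology :: "nat \<Rightarrow> 'a topology \<Rightarrow> (complex, 'a cochain set) module" where
  "cohomology p Y = quotient_module (cocycle_module p Y) (coboundaries p Y)"

definition pullback_cochain :: "nat \<Rightarrow> 'a topology \<Rightarrow> ('a \<Rightarrow> 'b) \<Rightarrow> 'b cochain \<Rightarrow> 'a cochain" where
  "pullback_cochain p Y f \<phi> =
     (\<lambda>\<sigma>. if singular_simplex p Y \<sigma> then \<phi> (simplex_map p f \<sigma>) else 0)"

text \<open>For \<open>f : Y \<rightarrow> Z\<close>, the union below is a single coset: the class of the pullback of any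
  representative.\<close>

definition pullback :: "nat \<Rightarrow> 'a topology \<Rightarrow> ('a \<Rightarrow> 'b) \<Rightarrow> 'b cochain set \<Rightarrow> 'a cochain set" where
  "pullback p Y f U =
     (\<Union>\<phi>\<in>U. coboundaries p Y +>\<^bsub>cocycle_module p Y\<^esub> pullback_cochain p Y f \<phi>)"

text \<open>The inverse of the pullback along the action of \<open>k\<close> is the pullback along that of the
  inverse of \<open>k\<close>; this is a left action.\<close>

definition cohomology_rep ::
  "('k, 'm) monoid_scheme \<Rightarrow> ('k \<Rightarrow> 'a \<Rightarrow> 'a) \<Rightarrow> 'a topology \<Rightarrow> nat \<Rightarrow> ('k, 'a cochain set) rep" where
  "cohomology_rep K act Y p = (cohomology p Y, \<lambda>k. pullback p Y (act (inv\<^bsub>K\<^esub> k)))"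

text \<open>The class of the \<open>K\<close>-module \<open>H\<^sup>p(Y, \<complex>)\<close>, for a subset \<open>Y\<close> of \<open>V\<close> with its classical
  topology.\<close>

definition H_class ::
  "('k, 'm) monoid_scheme \<Rightarrow> ('k \<Rightarrow> 'a \<Rightarrow> 'a) \<Rightarrow> 'a::topological_space set \<Rightarrow> nat \<Rightarrow> 'k virtual" where
  "H_class K act Y p = rep_class K (cohomology_rep K act (top_of_set Y) p)"

text \<open>The coefficient function of the polynomial whose coefficient of \<open>t\<^sup>i\<close> is \<open>H\<^sup>i(Y, \<complex>)\<close>.\<close>

definition poincare_poly ::
  "('k, 'm) monoid_scheme \<Rightarrow> ('k \<Rightarrow> 'a \<Rightarrow> 'a) \<Rightarrow> 'a::topological_space set \<Rightarrow> nat \<Rightarrow> 'k virtual" where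
  "poincare_poly K act Y = (\<lambda>i. H_class K act Y i)"

definition Phi :: "(complex ^ 'n ^ 'n) set \<Rightarrow> nat \<Rightarrow> ((complex ^ 'n ^ 'n) \<times> complex) virtual" where
  "Phi G e = (\<Oplus>\<^bsub>Rep_ring (Gamma_group G)\<^esub> i\<in>{..<e}.
     virtual_class (Gamma_group G)
       (mrep_char (otimes_gamma (\<lambda>g. eps g ^ i) (deg_Q0 G * i))) mrep_zero)"

text \<open>HOL-Algebra group actions require extensional functions on the set acted upon.\<close>

definition fibre_act ::
  "(complex ^ 'n) set set \<Rightarrow> (complex ^ 'n ^ 'n) \<times> complex \<Rightarrow> (complex ^ 'n) set \<Rightarrow> (complex ^ 'n) set" where
  "fibre_act E \<gamma> = (\<lambda>Y\<in>E. Gamma_act \<gamma> ` Y)"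

end

theory Submission
  imports Defs
begin

text \<open>Write \<open>\<theta> = \<epsilon> \<otimes> \<gamma>\<^sub>d\<close>.  Comparing \<open>Q\<^sub>0 \<circ> s\<close> with \<open>Q\<^sub>0\<close> at a generic point of the reflecting
  hyperplane of \<open>s\<close> gives \<open>Q\<^sub>0 (s v) = det s * Q\<^sub>0 v\<close>, hence \<open>Q\<^sub>0 (\<gamma> v) = \<theta> \<gamma>\<^sup>-\<^sup>1 * Q\<^sub>0 v\<close> for \<open>\<gamma> \<in> \<Gamma>\<close>.
  So \<open>F\<close> is the disjoint union of the translates of the open subset \<open>F\<^sub>0\<close>, whose stabiliser is the kernel
  of \<open>\<theta>\<close>.  Every singular simplex of \<open>F\<close> lies in one translate, and restricting the translates of a
  cohomology class of \<open>F\<close> to \<open>F\<^sub>0\<close> identifies \<open>H\<^sup>j(F)\<close> with the induced representation of \<open>H\<^sup>j(F\<^sub>0)\<close>.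
  The projection formula for the cyclic quotient \<open>\<Gamma> / \<Gamma>\<^sub>0\<close>, whose characters are the powers of \<open>\<theta>\<close>,
  turns \<open>Ind (Res x)\<close> into \<open>\<Phi> * x\<close>.

  No finiteness of cohomology is needed: the class of an infinite-dimensional representation
  is the empty set, and the representation induced from \<open>W\<close> is finite-dimensional only if \<open>W\<close> is.\<close>

section \<open>Linear representations and matrix representations\<close>

text \<open>The scalar in the transformation rule of \<open>Q0\<close> under a reflection s splits.
  The form of its own hyperplane contributes det s. The product of the other forms contributes a
  constant, which is 1 because at a generic point of the hyperplane s is the identity and this
  product does not vanish. The relation m = d e makes \<theta> surjective onto \<mu>_e already on
  the factor \<mu>_m: a d-th root of an e-th root of unity lies in \<mu>_m. So the kernel of
  \<theta> has exactly e cosets, numbered cyclically, and a Fourier transform is at hand.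

  The obstacle on the algebraic side is that the Grothendieck ring consists of explicit matrices,
  while cohomology and induced representations live on cosets and on functions. A space acquires a
  class only through coordinates, obtained by embedding it linearly into sequences of bounded
  support and eliminating one coordinate at a time. On the topological side, gluing requires a
  choice of a translating group element. Two choices differ by the stabiliser, and the equivariance
  that defines the induced space absorbs this difference in cohomology.\<close>

text \<open>A fragment of the axioms of a linear representation; the remaining ones are transported along
  an injective linear map to some \<open>\<complex>\<^sup>n\<close> whenever they are used.\<close>

definition lin_rep :: "('k, 'm) monoid_scheme \<Rightarrow> ('k, 'v) rep \<Rightarrow> bool" where
  "lin_rep K V \<longleftrightarrow>
     \<zero>\<^bsub>fst V\<^esub> \<in> carrier (fst V) \<and>
     (\<forall>x\<in>carrier (fst V). \<forall>y\<in>carrier (fst V). x \<oplus>\<^bsub>fst V\<^esub> y \<in> carrier (fst V)) \<and>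
     (\<forall>c. \<forall>x\<in>carrier (fst V). c \<odot>\<^bsub>fst V\<^esub> x \<in> carrier (fst V)) \<and>
     (\<forall>x\<in>carrier (fst V). \<zero>\<^bsub>fst V\<^esub> \<oplus>\<^bsub>fst V\<^esub> x = x) \<and>
     (\<forall>x\<in>carrier (fst V). 0 \<odot>\<^bsub>fst V\<^esub> x = \<zero>\<^bsub>fst V\<^esub>) \<and>
     (\<forall>c. c \<odot>\<^bsub>fst V\<^esub> \<zero>\<^bsub>fst V\<^esub> = \<zero>\<^bsub>fst V\<^esub>) \<and>
     (\<forall>k\<in>carrier K. \<forall>x\<in>carrier (fst V). snd V k x \<in> carrier (fst V)) \<and>
     (\<forall>k\<in>carrier K. \<forall>x\<in>carrier (fst V). \<forall>y\<in>carrier (fst V).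
        snd V k (x \<oplus>\<^bsub>fst V\<^esub> y) = snd V k x \<oplus>\<^bsub>fst V\<^esub> snd V k y) \<and>
     (\<forall>k\<in>carrier K. \<forall>c. \<forall>x\<in>carrier (fst V).
        snd V k (c \<odot>\<^bsub>fst V\<^esub> x) = c \<odot>\<^bsub>fst V\<^esub> snd V k x) \<and>
     (\<forall>x\<in>carrier (fst V). snd V \<one>\<^bsub>K\<^esub> x = x) \<and>
     (\<forall>k\<in>carrier K. \<forall>k'\<in>carrier K. \<forall>x\<in>carrier (fst V).
        snd V (k \<otimes>\<^bsub>K\<^esub> k') x = snd V k (snd V k' x))"

section \<open>Isomorphism of representations as an equivalence relation\<close>

lemma rep_iso_refl: "rep_iso K V V"
  unfolding rep_iso_def by (rule exI[of _ id]) auto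

lemma rep_iso_trans:
  assumes "rep_iso K U V" and "rep_iso K V W"
  shows "rep_iso K U W"
proof -
  obtain S where S: "bij_betw S (carrier (fst U)) (carrier (fst V))"
    "\<And>x y. x \<in> carrier (fst U) \<Longrightarrow> y \<in> carrier (fst U) \<Longrightarrow> S (x \<oplus>\<^bsub>fst U\<^esub> y) = S x \<oplus>\<^bsub>fst V\<^esub> S y"
    "\<And>c x. x \<in> carrier (fst U) \<Longrightarrow> S (c \<odot>\<^bsub>fst U\<^esub> x) = c \<odot>\<^bsub>fst V\<^esub> S x"
    "\<And>k x. k \<in> carrier K \<Longrightarrow> x \<in> carrier (fst U) \<Longrightarrow> S (snd U k x) = snd V k (S x)"
    using assms(1) unfolding rep_iso_def by blast
  obtain T where T: "bij_betw T (carrier (fst V)) (carrier (fst W))"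
    "\<And>x y. x \<in> carrier (fst V) \<Longrightarrow> y \<in> carrier (fst V) \<Longrightarrow> T (x \<oplus>\<^bsub>fst V\<^esub> y) = T x \<oplus>\<^bsub>fst W\<^esub> T y"
    "\<And>c x. x \<in> carrier (fst V) \<Longrightarrow> T (c \<odot>\<^bsub>fst V\<^esub> x) = c \<odot>\<^bsub>fst W\<^esub> T x"
    "\<And>k x. k \<in> carrier K \<Longrightarrow> x \<in> carrier (fst V) \<Longrightarrow> T (snd V k x) = snd W k (T x)"
    using assms(2) unfolding rep_iso_def by blast
  have "S x \<in> carrier (fst V)" if "x \<in> carrier (fst U)" for x
    using S(1) that by (auto dest: bij_betwE)
  then show ?thesis
    unfolding rep_iso_def
    by (intro exI[of _ "T \<circ> S"]) (auto simp: S T intro: bij_betw_trans[OF S(1) T(1)])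
qed

text \<open>The inverse S is additive, homogeneous and equivariant because T takes both sides of
  each identity to the same vector. Injectivity of T is available only on the carrier, so both sides
  must lie in V; this is where \<open>lin_rep\<close> enters.\<close>

lemma rep_iso_sym:
  assumes "lin_rep K V" and "rep_iso K V W"
  shows "rep_iso K W V"
proof -
  obtain T where T: "bij_betw T (carrier (fst V)) (carrier (fst W))"
    "\<And>x y. x \<in> carrier (fst V) \<Longrightarrow> y \<in> carrier (fst V) \<Longrightarrow> T (x \<oplus>\<^bsub>fst V\<^esub> y) = T x \<oplus>\<^bsub>fst W\<^esub> T y"
    "\<And>c x. x \<in> carrier (fst V) \<Longrightarrow> T (c \<odot>\<^bsub>fst V\<^esub> x) = c \<odot>\<^bsub>fst W\<^esub> T x"
    "\<And>k x. k \<in> carrier K \<Longrightarrow> x \<in> carrier (fst V) \<Longrightarrow> T (snd V k x) = snd W k (T x)"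
    using assms(2) unfolding rep_iso_def by blast
  define S where "S = inv_into (carrier (fst V)) T"
  have S: "S y \<in> carrier (fst V)" "T (S y) = y" if "y \<in> carrier (fst W)" for y
    using T(1) that unfolding S_def bij_betw_def by (auto intro: inv_into_into f_inv_into_f)
  have ST: "S (T x) = x" if "x \<in> carrier (fst V)" for x
    using T(1) that unfolding S_def by (simp add: bij_betw_inv_into_left)
  have eq: "S y = x" if "x \<in> carrier (fst V)" "T x = y" for x y
    using ST that by blast
  show ?thesis
    unfolding rep_iso_def
  proof (intro exI[of _ S] conjI ballI allI)
    show "bij_betw S (carrier (fst W)) (carrier (fst V))"
      unfolding S_def by (rule bij_betw_inv_into[OF T(1)])
  qed (use assms(1) in \<open>auto intro!: eq simp: S T lin_rep_def\<close>)
qed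

section \<open>Matrix representations and intertwining matrices\<close>

lemma matrix_repsD:
  assumes "A \<in> matrix_reps K"
  shows "\<And>k. k \<in> carrier K \<Longrightarrow> snd A k \<in> carrier_mat (fst A) (fst A)"
    and "snd A \<one>\<^bsub>K\<^esub> = 1\<^sub>m (fst A)"
    and "\<And>k k'. k \<in> carrier K \<Longrightarrow> k' \<in> carrier K \<Longrightarrow> snd A (k \<otimes>\<^bsub>K\<^esub> k') = snd A k * snd A k'"
  using assms unfolding matrix_reps_def by (auto simp: case_prod_beta)

lemma rep_of_mrep_simps [simp]:
  "carrier (fst (rep_of_mrep A)) = carrier_vec (fst A)"
  "\<zero>\<^bsub>fst (rep_of_mrep A)\<^esub> = 0\<^sub>v (fst A)"
  "x \<oplus>\<^bsub>fst (rep_of_mrep A)\<^esub> y = x + y"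
  "c \<odot>\<^bsub>fst (rep_of_mrep A)\<^esub> x = c \<cdot>\<^sub>v x"
  "snd (rep_of_mrep A) k x = snd A k *\<^sub>v x"
  unfolding rep_of_mrep_def module_vec_def by simp_all

lemma lin_rep_rep_of_mrep:
  assumes "A \<in> matrix_reps K"
  shows "lin_rep K (rep_of_mrep A)"
proof -
  note A = matrix_repsD[OF assms]
  show ?thesis
    unfolding lin_rep_def rep_of_mrep_simps
    using A(2,3) mult_mat_vec_carrier[OF A(1)] mult_add_distrib_mat_vec[OF A(1)] mult_mat_vec[OF A(1)]
      assoc_mult_mat_vec[OF A(1) A(1)] by auto
qed

lemma linear_map_carrier_vec:
  fixes f :: "complex Matrix.vec \<Rightarrow> complex Matrix.vec"
  assumes f: "\<And>x. x \<in> carrier_vec n \<Longrightarrow> f x \<in> carrier_vec m"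
    and add: "\<And>x y. x \<in> carrier_vec n \<Longrightarrow> y \<in> carrier_vec n \<Longrightarrow> f (x + y) = f x + f y"
    and smult: "\<And>c x. x \<in> carrier_vec n \<Longrightarrow> f (c \<cdot>\<^sub>v x) = c \<cdot>\<^sub>v f x"
  obtains P where "P \<in> carrier_mat m n" and "\<And>x. x \<in> carrier_vec n \<Longrightarrow> f x = P *\<^sub>v x"
proof
  let ?P = "Matrix.mat m n (\<lambda>(i, j). vec_index (f (unit_vec n j)) i)"
  show "?P \<in> carrier_mat m n" by simp
  fix x :: "complex Matrix.vec" assume x: "x \<in> carrier_vec n"
  \<comment> \<open>The truncation of x to its first k coordinates. Induction on k adds one unit
    vector at a time and so replaces a sum of vectors.\<close>
  define t where "t k = Matrix.vec n (\<lambda>i. if i < k then vec_index x i else 0)" for k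
  have t: "t k \<in> carrier_vec n" for k by (simp add: t_def)
  have "k \<le> n \<Longrightarrow> f (t k) = Matrix.vec m (\<lambda>i. \<Sum>j<k. vec_index (f (unit_vec n j)) i * vec_index x j)" for k
  proof (induction k)
    case 0
    have "t 0 = 0 \<cdot>\<^sub>v x" using x by (auto simp: t_def)
    then have "f (t 0) = 0 \<cdot>\<^sub>v f x" using smult[OF x, of 0] by simp
    then show ?case using f[OF x] by auto
  next
    case (Suc k)
    have "t (Suc k) = t k + vec_index x k \<cdot>\<^sub>v unit_vec n k"
      using Suc.prems x by (auto simp: t_def less_Suc_eq)
    then have "f (t (Suc k)) = f (t k) + vec_index x k \<cdot>\<^sub>v f (unit_vec n k)"
      using t by (simp add: add smult)
    then show ?case using Suc f[of "unit_vec n k"] by auto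
  qed
  from this[of n] have "f (t n) = ?P *\<^sub>v x"
    using x by (auto simp: scalar_prod_def atLeast0LessThan)
  moreover have "t n = x" using x by (auto simp: t_def)
  ultimately show "f x = ?P *\<^sub>v x" by simp
qed

lemma rep_iso_mrepI:
  assumes A: "A \<in> matrix_reps K" and B: "B \<in> matrix_reps K"
    and P: "P \<in> carrier_mat (fst B) (fst A)" and P': "P' \<in> carrier_mat (fst A) (fst B)"
    and "P * P' = 1\<^sub>m (fst B)" and "P' * P = 1\<^sub>m (fst A)"
    and comm: "\<And>k. k \<in> carrier K \<Longrightarrow> P * snd A k = snd B k * P"
  shows "rep_iso K (rep_of_mrep A) (rep_of_mrep B)"
proof -
  have 1: "P' *\<^sub>v (P *\<^sub>v x) = x" if "x \<in> carrier_vec (fst A)" for x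
    using that assms(6) by (simp flip: assoc_mult_mat_vec[OF P' P])
  have 2: "P *\<^sub>v (P' *\<^sub>v x) = x" if "x \<in> carrier_vec (fst B)" for x
    using that assms(5) by (simp flip: assoc_mult_mat_vec[OF P P'])
  have 3: "P *\<^sub>v (snd A k *\<^sub>v x) = snd B k *\<^sub>v (P *\<^sub>v x)" if "x \<in> carrier_vec (fst A)" "k \<in> carrier K" for k x
    using that comm[OF that(2)] assoc_mult_mat_vec[OF P matrix_repsD(1)[OF A that(2)] that(1)]
      assoc_mult_mat_vec[OF matrix_repsD(1)[OF B that(2)] P that(1)] by simp
  have "bij_betw ((*\<^sub>v) P) (carrier_vec (fst A)) (carrier_vec (fst B))"
    by (rule bij_betw_byWitness[where f' = "(*\<^sub>v) P'"])
      (use 1 2 P P' in \<open>auto intro: mult_mat_vec_carrier\<close>)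
  then show ?thesis
    unfolding rep_iso_def using P 3
    by (intro exI[of _ "(*\<^sub>v) P"]) (auto simp: mult_add_distrib_mat_vec mult_mat_vec)
qed

lemma mat_eqI_mult_vec:
  fixes M :: "complex Matrix.mat"
  assumes M: "M \<in> carrier_mat m n" and N: "N \<in> carrier_mat m n"
    and eq: "\<And>x. x \<in> carrier_vec n \<Longrightarrow> M *\<^sub>v x = N *\<^sub>v x"
  shows "M = N"
proof (rule eq_matI)
  fix i j assume ij: "i < dim_row N" "j < dim_col N"
  then have "vec_index (M *\<^sub>v unit_vec n j) i = vec_index (N *\<^sub>v unit_vec n j) i"
    using N eq by simp
  then show "M $$ (i, j) = N $$ (i, j)"
    using ij M N by simp
qed (use M N in auto)

text \<open>Together with \<open>rep_iso_mrepI\<close> this translates abstract isomorphisms into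
  invertible intertwining matrices, so that sums and tensor products of isomorphisms become block
  and Kronecker products.\<close>

lemma rep_iso_mrepE:
  assumes A: "A \<in> matrix_reps K" and B: "B \<in> matrix_reps K"
    and iso: "rep_iso K (rep_of_mrep A) (rep_of_mrep B)"
  obtains P P' where "P \<in> carrier_mat (fst B) (fst A)" and "P' \<in> carrier_mat (fst A) (fst B)"
    and "P * P' = 1\<^sub>m (fst B)" and "P' * P = 1\<^sub>m (fst A)"
    and "\<And>k. k \<in> carrier K \<Longrightarrow> P * snd A k = snd B k * P"
proof -
  obtain T where T: "bij_betw T (carrier_vec (fst A)) (carrier_vec (fst B))"
    "\<And>x y. x \<in> carrier_vec (fst A) \<Longrightarrow> y \<in> carrier_vec (fst A) \<Longrightarrow> T (x + y) = T x + T y"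
    "\<And>c x. x \<in> carrier_vec (fst A) \<Longrightarrow> T (c \<cdot>\<^sub>v x) = c \<cdot>\<^sub>v T x"
    "\<And>k x. k \<in> carrier K \<Longrightarrow> x \<in> carrier_vec (fst A) \<Longrightarrow> T (snd A k *\<^sub>v x) = snd B k *\<^sub>v T x"
    using iso unfolding rep_iso_def rep_of_mrep_simps by blast
  have T0: "T x \<in> carrier_vec (fst B)" if "x \<in> carrier_vec (fst A)" for x
    using T(1) that by (auto dest: bij_betwE)
  obtain P where P: "P \<in> carrier_mat (fst B) (fst A)" "\<And>x. x \<in> carrier_vec (fst A) \<Longrightarrow> T x = P *\<^sub>v x"
    using linear_map_carrier_vec[of "fst A" T "fst B"] T0 T(2,3) by blast
  define S where "S = inv_into (carrier_vec (fst A)) T"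
  have S: "S y \<in> carrier_vec (fst A)" "T (S y) = y" if "y \<in> carrier_vec (fst B)" for y
    using T(1) that unfolding S_def bij_betw_def by (auto intro: inv_into_into f_inv_into_f)
  have ST: "S (T x) = x" if "x \<in> carrier_vec (fst A)" for x
    using T(1) that unfolding S_def by (simp add: bij_betw_inv_into_left)
  have eq: "S y = x" if "x \<in> carrier_vec (fst A)" "T x = y" for x y
    using ST that by blast
  have "S (x + y) = S x + S y" if "x \<in> carrier_vec (fst B)" "y \<in> carrier_vec (fst B)" for x y
    using that by (intro eq) (auto simp: S T)
  moreover have "S (c \<cdot>\<^sub>v x) = c \<cdot>\<^sub>v S x" if "x \<in> carrier_vec (fst B)" for c x
    using that by (intro eq) (auto simp: S T)
  ultimately obtain P' where P': "P' \<in> carrier_mat (fst A) (fst B)" "\<And>x. x \<in> carrier_vec (fst B) \<Longrightarrow> S x = P' *\<^sub>v x"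
    using linear_map_carrier_vec[of "fst B" S "fst A"] S(1) by blast
  have 1: "P * P' = 1\<^sub>m (fst B)"
  proof (rule mat_eqI_mult_vec)
    show "P * P' \<in> carrier_mat (fst B) (fst B)" using P P' by simp
    fix x :: "complex Matrix.vec" assume "x \<in> carrier_vec (fst B)"
    then show "(P * P') *\<^sub>v x = 1\<^sub>m (fst B) *\<^sub>v x" using P(2) P'(2) S by (simp add: assoc_mult_mat_vec[OF P(1) P'(1)] flip: P'(2) P(2))
  qed simp
  have 2: "P' * P = 1\<^sub>m (fst A)"
  proof (rule mat_eqI_mult_vec)
    show "P' * P \<in> carrier_mat (fst A) (fst A)" using P P' by simp
    fix x :: "complex Matrix.vec" assume "x \<in> carrier_vec (fst A)"
    then show "(P' * P) *\<^sub>v x = 1\<^sub>m (fst A) *\<^sub>v x" using P(2) P'(2) ST T0 by (simp add: assoc_mult_mat_vec[OF P'(1) P(1)] flip: P'(2) P(2))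
  qed simp
  have "P * snd A k = snd B k * P" if k: "k \<in> carrier K" for k
  proof (rule mat_eqI_mult_vec)
    note Ak = matrix_repsD(1)[OF A k] and Bk = matrix_repsD(1)[OF B k]
    show "P * snd A k \<in> carrier_mat (fst B) (fst A)" "snd B k * P \<in> carrier_mat (fst B) (fst A)"
      using P Ak Bk by auto
    fix x :: "complex Matrix.vec" assume x: "x \<in> carrier_vec (fst A)"
    then show "(P * snd A k) *\<^sub>v x = (snd B k * P) *\<^sub>v x"
      using T(4)[OF k x] P(2)[OF x] P(2)[OF mult_mat_vec_carrier[OF Ak x]] assoc_mult_mat_vec[OF P(1) Ak x]
        assoc_mult_mat_vec[OF Bk P(1) x] by simp
  qed
  then show thesis using that P P' 1 2 by blast
qed

section \<open>Existence of matrix models\<close>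

lemma ex_mrep_of_bij:
  assumes V: "lin_rep K V" and K: "group K"
    and T: "bij_betw T (carrier (fst V)) (carrier_vec n)"
    and add: "\<And>x y. x \<in> carrier (fst V) \<Longrightarrow> y \<in> carrier (fst V) \<Longrightarrow> T (x \<oplus>\<^bsub>fst V\<^esub> y) = T x + T y"
    and smult: "\<And>c x. x \<in> carrier (fst V) \<Longrightarrow> T (c \<odot>\<^bsub>fst V\<^esub> x) = c \<cdot>\<^sub>v T x"
  shows "\<exists>A\<in>matrix_reps K. rep_iso K V (rep_of_mrep A)"
proof -
  interpret group K by (rule K)
  define S where "S = inv_into (carrier (fst V)) T"
  have S: "S y \<in> carrier (fst V)" "T (S y) = y" if "y \<in> carrier_vec n" for y
    using T that unfolding S_def bij_betw_def by (auto intro: inv_into_into f_inv_into_f)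
  have ST: "S (T x) = x" if "x \<in> carrier (fst V)" for x
    using T that unfolding S_def by (simp add: bij_betw_inv_into_left)
  have T0: "T x \<in> carrier_vec n" if "x \<in> carrier (fst V)" for x
    using T that by (auto dest: bij_betwE)
  have eq: "S y = x" if "x \<in> carrier (fst V)" "T x = y" for x y
    using ST that by blast
  have Sadd: "S (x + y) = S x \<oplus>\<^bsub>fst V\<^esub> S y" if "x \<in> carrier_vec n" "y \<in> carrier_vec n" for x y
    using that V by (intro eq) (auto simp: S add lin_rep_def)
  have Ssmult: "S (c \<cdot>\<^sub>v x) = c \<odot>\<^bsub>fst V\<^esub> S x" if "x \<in> carrier_vec n" for c x
    using that V by (intro eq) (auto simp: S smult lin_rep_def)
  have act: "snd V k x \<in> carrier (fst V)" if "k \<in> carrier K" "x \<in> carrier (fst V)" for k x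
    using V that by (simp add: lin_rep_def)
  \<comment> \<open>T is only a linear bijection so far. The operators of V are conjugated by T,
    which makes T equivariant by construction.\<close>
  have "\<exists>P. P \<in> carrier_mat n n \<and> (\<forall>x\<in>carrier_vec n. T (snd V k (S x)) = P *\<^sub>v x)"
    if k: "k \<in> carrier K" for k
  proof (rule linear_map_carrier_vec[of n "\<lambda>x. T (snd V k (S x))" n])
  qed (use V k S in \<open>auto simp: Sadd Ssmult lin_rep_def add smult intro: T0\<close>)
  then obtain P where P: "\<And>k. k \<in> carrier K \<Longrightarrow> P k \<in> carrier_mat n n"
     "\<And>k x. k \<in> carrier K \<Longrightarrow> x \<in> carrier_vec n \<Longrightarrow> T (snd V k (S x)) = P k *\<^sub>v x"
    by metis
  have P1: "P \<one>\<^bsub>K\<^esub> = 1\<^sub>m n"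
    by (rule mat_eqI_mult_vec[OF P(1)]) (use V S in \<open>auto simp flip: P(2) simp: lin_rep_def\<close>)
  have Pm: "P (k \<otimes>\<^bsub>K\<^esub> k') = P k * P k'" if k: "k \<in> carrier K" "k' \<in> carrier K" for k k'
  proof (rule mat_eqI_mult_vec)
    fix x :: "complex Matrix.vec" assume x: "x \<in> carrier_vec n"
    have "P (k \<otimes>\<^bsub>K\<^esub> k') *\<^sub>v x = T (snd V k (snd V k' (S x)))"
      using V S k x by (simp flip: P(2) add: lin_rep_def)
    also have "\<dots> = P k *\<^sub>v (T (snd V k' (S x)))"
      using S k x T0 by (simp flip: P(2) add: ST act)
    also have "\<dots> = P k * P k' *\<^sub>v x"
      using k x P(2) assoc_mult_mat_vec[OF P(1) P(1)] by simp
    finally show "P (k \<otimes>\<^bsub>K\<^esub> k') *\<^sub>v x = P k * P k' *\<^sub>v x" .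
  qed (use k P(1) in \<open>auto intro: mult_carrier_mat\<close>)
  have "(n, P) \<in> matrix_reps K"
    unfolding matrix_reps_def using P(1) P1 Pm by auto
  moreover have "rep_iso K V (rep_of_mrep (n, P))"
    unfolding rep_iso_def using T add smult T0
    by (intro exI[of _ T]) (auto simp flip: P(2) simp: ST)
  ultimately show ?thesis by blast
qed

text \<open>Elimination by induction on the bound N of the supports: either all of W vanishes at N,
  or W is the sum of the line through one vector w and of its subspace of functions vanishing at N.
  In the second case the value at N becomes a new first coordinate.\<close>

lemma subspace_linear_bij:
  fixes W :: "(nat \<Rightarrow> complex) set"
  assumes "\<And>f i. f \<in> W \<Longrightarrow> N \<le> i \<Longrightarrow> f i = 0"
    and "(\<lambda>_. 0) \<in> W"
    and "\<And>f g. f \<in> W \<Longrightarrow> g \<in> W \<Longrightarrow> (\<lambda>i. f i + g i) \<in> W"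
    and "\<And>c f. f \<in> W \<Longrightarrow> (\<lambda>i. c * f i) \<in> W"
  shows "\<exists>n S. bij_betw S W (carrier_vec n) \<and>
    (\<forall>f\<in>W. \<forall>g\<in>W. S (\<lambda>i. f i + g i) = S f + S g) \<and> (\<forall>c. \<forall>f\<in>W. S (\<lambda>i. c * f i) = c \<cdot>\<^sub>v S f)"
  using assms
proof (induction N arbitrary: W)
  case 0
  then have W: "W = {\<lambda>_. 0}" by fastforce
  have "carrier_vec 0 = {vNil :: complex Matrix.vec}" by auto
  then show ?case unfolding W
    by (intro exI[of _ "0::nat"] exI[of _ "\<lambda>_. vNil"]) (auto simp: bij_betw_def)
next
  case (Suc N)
  let ?W = "{f \<in> W. f N = 0}"
  have "\<exists>n S. bij_betw S ?W (carrier_vec n) \<and>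
    (\<forall>f\<in>?W. \<forall>g\<in>?W. S (\<lambda>i. f i + g i) = S f + S g) \<and> (\<forall>c. \<forall>f\<in>?W. S (\<lambda>i. c * f i) = c \<cdot>\<^sub>v S f)"
  proof (rule Suc.IH)
    fix f i assume "f \<in> ?W" "N \<le> i"
    then show "f i = 0" using Suc.prems(1)[of f i] by (cases "i = N") auto
  qed (use Suc.prems in auto)
  then obtain n S where S: "bij_betw S ?W (carrier_vec n)"
    "\<And>f g. f \<in> ?W \<Longrightarrow> g \<in> ?W \<Longrightarrow> S (\<lambda>i. f i + g i) = S f + S g"
    "\<And>c f. f \<in> ?W \<Longrightarrow> S (\<lambda>i. c * f i) = c \<cdot>\<^sub>v S f" by blast
  show ?case
  proof (cases "?W = W")
    case True
    then show ?thesis using S unfolding True by blast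
  next
    case False
    then obtain w' where w': "w' \<in> W" "w' N \<noteq> 0" by auto
    \<comment> \<open>Normalised to the value 1 at N, so that subtracting \<open>f N\<close> times w
      projects f onto the functions vanishing at N; \<open>r\<close> is this projection.\<close>
    define w where "w = (\<lambda>i. inverse (w' N) * w' i)"
    have w: "w \<in> W" "w N = 1" using Suc.prems(4)[OF w'(1), of "inverse (w' N)"] w' by (auto simp: w_def)
    define r where "r f = (\<lambda>i. f i + (- f N) * w i)" for f :: "nat \<Rightarrow> complex"
    have r: "r f \<in> ?W" if "f \<in> W" for f
      using Suc.prems(3)[OF that Suc.prems(4)[OF w(1), of "- f N"]] w by (simp add: r_def)
    have rS: "S (r f) \<in> carrier_vec n" if "f \<in> W" for f
      using r[OF that] S(1) by (auto dest: bij_betwE)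
    have radd: "r (\<lambda>i. f i + g i) = (\<lambda>i. r f i + r g i)" for f g
      by (auto simp: r_def algebra_simps)
    have rsm: "r (\<lambda>i. c * f i) = (\<lambda>i. c * r f i)" for c f
      by (auto simp: r_def algebra_simps)
    define T where "T f = vCons (f N) (S (r f))" for f
    have "bij_betw T W (carrier_vec (Suc n))"
      unfolding bij_betw_def
    proof
      show "inj_on T W"
      proof
        fix f g assume fg: "f \<in> W" "g \<in> W" "T f = T g"
        then have "f N = g N" "S (r f) = S (r g)" by (auto simp: T_def)
        then have "r f = r g" using S(1) r[OF fg(1)] r[OF fg(2)] by (auto simp: bij_betw_def dest: inj_onD)
        then have "r f i + f N * w i = r g i + g N * w i" for i using \<open>f N = g N\<close> by simp
        then show "f = g" by (auto simp: r_def)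
      qed
      show "T ` W = carrier_vec (Suc n)"
      proof (intro equalityI subsetI)
        fix v assume "v \<in> T ` W" then show "v \<in> carrier_vec (Suc n)" using rS by (auto simp: T_def)
      next
        fix v :: "complex Matrix.vec" assume v: "v \<in> carrier_vec (Suc n)"
        then obtain a u where u: "v = vCons a u" "u \<in> carrier_vec n"
          by (cases v) auto
        have "u \<in> S ` ?W" using S(1) u(2) by (simp add: bij_betw_def)
        then obtain f where f: "f \<in> ?W" "S f = u" by blast
        define g where "g = (\<lambda>i. f i + a * w i)"
        have "g \<in> W" using Suc.prems(3)[OF _ Suc.prems(4)[OF w(1), of a]] f by (auto simp: g_def)
        moreover have "g N = a" using f w by (simp add: g_def)
        moreover have "r g = f" using \<open>g N = a\<close> by (auto simp: r_def g_def)
        ultimately show "v \<in> T ` W" using u f by (auto simp: T_def)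
      qed
    qed
    moreover have "T (\<lambda>i. f i + g i) = T f + T g" if "f \<in> W" "g \<in> W" for f g
      using rS[OF that(1)] rS[OF that(2)] unfolding T_def radd S(2)[OF r[OF that(1)] r[OF that(2)]]
      by (auto simp: vec_index_vCons intro!: eq_vecI)
    moreover have "T (\<lambda>i. c * f i) = c \<cdot>\<^sub>v T f" if "f \<in> W" for c f
      using rS[OF that] unfolding T_def rsm S(3)[OF r[OF that]]
      by (auto simp: vec_index_vCons intro!: eq_vecI)
    ultimately show ?thesis by blast
  qed
qed

text \<open>The form in which finite dimension is verified: coordinates that separate vectors are
  easier to exhibit than a basis. It serves both for induced representations and for representations
  contained in an induced one.\<close>

lemma ex_mrep_of_embedding:
  fixes T :: "'v \<Rightarrow> nat \<Rightarrow> complex"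
  assumes V: "lin_rep K V" and K: "group K"
    and inj: "inj_on T (carrier (fst V))"
    and fin: "\<And>x i. x \<in> carrier (fst V) \<Longrightarrow> N \<le> i \<Longrightarrow> T x i = 0"
    and add: "\<And>x y. x \<in> carrier (fst V) \<Longrightarrow> y \<in> carrier (fst V) \<Longrightarrow> T (x \<oplus>\<^bsub>fst V\<^esub> y) = (\<lambda>i. T x i + T y i)"
    and smult: "\<And>c x. x \<in> carrier (fst V) \<Longrightarrow> T (c \<odot>\<^bsub>fst V\<^esub> x) = (\<lambda>i. c * T x i)"
  shows "\<exists>A\<in>matrix_reps K. rep_iso K V (rep_of_mrep A)"
proof -
  let ?W = "T ` carrier (fst V)"
  have z0: "\<zero>\<^bsub>fst V\<^esub> \<in> carrier (fst V)" using V by (simp add: lin_rep_def)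
  moreover have "T \<zero>\<^bsub>fst V\<^esub> = (\<lambda>i. 0)"
    using V smult[OF z0, of 0] by (simp add: lin_rep_def)
  ultimately have z: "(\<lambda>_. 0) \<in> ?W" by (intro image_eqI[where x = "\<zero>\<^bsub>fst V\<^esub>"]) simp_all
  have "\<exists>n S. bij_betw S ?W (carrier_vec n) \<and>
    (\<forall>f\<in>?W. \<forall>g\<in>?W. S (\<lambda>i. f i + g i) = S f + S g) \<and> (\<forall>c. \<forall>f\<in>?W. S (\<lambda>i. c * f i) = c \<cdot>\<^sub>v S f)"
  proof (rule subspace_linear_bij[of _ N])
    show "(\<lambda>i. f i + g i) \<in> ?W" if "f \<in> ?W" "g \<in> ?W" for f g
    proof -
      obtain x y where xy: "x \<in> carrier (fst V)" "y \<in> carrier (fst V)" "f = T x" "g = T y"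
        using \<open>f \<in> ?W\<close> \<open>g \<in> ?W\<close> by blast
      moreover have "x \<oplus>\<^bsub>fst V\<^esub> y \<in> carrier (fst V)" using V xy by (simp add: lin_rep_def)
      ultimately show ?thesis using add by (intro image_eqI[where x = "x \<oplus>\<^bsub>fst V\<^esub> y"]) simp_all
    qed
    show "(\<lambda>i. c * f i) \<in> ?W" if "f \<in> ?W" for f c
    proof -
      obtain x where x: "x \<in> carrier (fst V)" "f = T x"
        using \<open>f \<in> ?W\<close> by blast
      moreover have "c \<odot>\<^bsub>fst V\<^esub> x \<in> carrier (fst V)" using V x by (simp add: lin_rep_def)
      ultimately show ?thesis using smult by (intro image_eqI[where x = "c \<odot>\<^bsub>fst V\<^esub> x"]) simp_all
    qed
    show "f i = 0" if "f \<in> ?W" "N \<le> i" for f i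
      using that fin by blast
  qed (rule z)
  then obtain n S where S: "bij_betw S ?W (carrier_vec n)"
    "\<forall>f\<in>?W. \<forall>g\<in>?W. S (\<lambda>i. f i + g i) = S f + S g"
    "\<forall>c. \<forall>f\<in>?W. S (\<lambda>i. c * f i) = c \<cdot>\<^sub>v S f"
    by (elim exE conjE) (rule that)
  have "bij_betw (S \<circ> T) (carrier (fst V)) (carrier_vec n)"
    using inj S(1) by (intro bij_betw_trans[of T _ ?W]) (auto simp: bij_betw_def)
  then show ?thesis
    by (rule ex_mrep_of_bij[OF V K]) (simp_all add: add smult S)
qed

section \<open>The Grothendieck ring\<close>

lemma matrix_repsI:
  assumes "\<And>k. k \<in> carrier K \<Longrightarrow> snd A k \<in> carrier_mat (fst A) (fst A)"
    and "snd A \<one>\<^bsub>K\<^esub> = 1\<^sub>m (fst A)"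
    and "\<And>k k'. k \<in> carrier K \<Longrightarrow> k' \<in> carrier K \<Longrightarrow> snd A (k \<otimes>\<^bsub>K\<^esub> k') = snd A k * snd A k'"
  shows "A \<in> matrix_reps K"
  using assms unfolding matrix_reps_def by (auto simp: case_prod_beta)

lemma four_block_diag_mult:
  fixes P Q R S :: "complex Matrix.mat"
  assumes "P \<in> carrier_mat a b" "R \<in> carrier_mat b c" "Q \<in> carrier_mat a' b'" "S \<in> carrier_mat b' c'"
  shows "four_block_mat P (0\<^sub>m a b') (0\<^sub>m a' b) Q * four_block_mat R (0\<^sub>m b c') (0\<^sub>m b' c) S
    = four_block_mat (P * R) (0\<^sub>m a c') (0\<^sub>m a' c) (Q * S)"
  using assms by (subst mult_four_block_mat[OF assms(1) _ _ assms(3) assms(2) _ _ assms(4)]) auto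

lemma mrep_sum_simps [simp]:
  "fst (mrep_sum A B) = fst A + fst B"
  "snd (mrep_sum A B) k = four_block_mat (snd A k) (0\<^sub>m (fst A) (fst B)) (0\<^sub>m (fst B) (fst A)) (snd B k)"
  by (simp_all add: mrep_sum_def)

lemma mrep_sum_closed [intro, simp]:
  assumes A: "A \<in> matrix_reps K" and B: "B \<in> matrix_reps K"
  shows "mrep_sum A B \<in> matrix_reps K"
proof (rule matrix_repsI)
  fix k k' assume k: "k \<in> carrier K" and k': "k' \<in> carrier K"
  show "snd (mrep_sum A B) (k \<otimes>\<^bsub>K\<^esub> k') = snd (mrep_sum A B) k * snd (mrep_sum A B) k'"
    using matrix_repsD(3)[OF A k k'] matrix_repsD(3)[OF B k k']
    by (simp add: four_block_diag_mult[OF matrix_repsD(1)[OF A k] matrix_repsD(1)[OF A k']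
          matrix_repsD(1)[OF B k] matrix_repsD(1)[OF B k']])
qed (use matrix_repsD[OF A] matrix_repsD[OF B] in \<open>auto simp: four_block_one_mat\<close>)

lemma mrep_zero_closed [intro, simp]: "mrep_zero \<in> matrix_reps K"
  by (rule matrix_repsI) (auto simp: mrep_zero_def)

text \<open>Commutativity, associativity and distributivity of sums and tensor products are all
  permutations of basis vectors; this reduces them to arithmetic with indices.\<close>

lemma rep_iso_reindex:
  assumes A: "A \<in> matrix_reps K" and B: "B \<in> matrix_reps K"
    and \<sigma>: "bij_betw \<sigma> {..<fst B} {..<fst A}"
    and eq: "\<And>k i j. k \<in> carrier K \<Longrightarrow> i < fst B \<Longrightarrow> j < fst B \<Longrightarrow>
      snd B k $$ (i, j) = snd A k $$ (\<sigma> i, \<sigma> j)"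
  shows "rep_iso K (rep_of_mrep A) (rep_of_mrep B)"
proof -
  define \<tau> where "\<tau> = inv_into {..<fst B} \<sigma>"
  have \<sigma>1: "\<sigma> i < fst A" if "i < fst B" for i
    using bij_betwE[OF \<sigma>] that by auto
  have \<tau>1: "\<tau> i < fst B" "\<sigma> (\<tau> i) = i" if "i < fst A" for i
    using that \<sigma> unfolding \<tau>_def
    by (metis bij_betw_def inv_into_into lessThan_iff, metis bij_betw_inv_into_right lessThan_iff)
  have \<tau>\<sigma>: "\<tau> (\<sigma> i) = i" if "i < fst B" for i
    using that \<sigma> unfolding \<tau>_def by (metis bij_betw_inv_into_left lessThan_iff)
  define T where "T v = Matrix.vec (fst B) (\<lambda>i. vec_index v (\<sigma> i))" for v :: "complex Matrix.vec"
  have "bij_betw T (carrier_vec (fst A)) (carrier_vec (fst B))"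
    by (rule bij_betw_byWitness[where f' = "\<lambda>v. Matrix.vec (fst A) (\<lambda>i. vec_index v (\<tau> i))"])
      (auto simp: T_def \<tau>1 \<sigma>1 \<tau>\<sigma>)
  moreover have "T (snd A k *\<^sub>v v) = snd B k *\<^sub>v T v" if k: "k \<in> carrier K" and v: "v \<in> carrier_vec (fst A)" for k v
  proof
    note Ak = matrix_repsD(1)[OF A k] and Bk = matrix_repsD(1)[OF B k]
    show "dim_vec (T (snd A k *\<^sub>v v)) = dim_vec (snd B k *\<^sub>v T v)" using Bk by (simp add: T_def)
    fix i assume "i < dim_vec (snd B k *\<^sub>v T v)"
    then have i: "i < fst B" using Bk by simp
    have "vec_index (T (snd A k *\<^sub>v v)) i = (\<Sum>j<fst A. snd A k $$ (\<sigma> i, j) * vec_index v j)"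
      using i Ak \<sigma>1[OF i] v by (simp add: T_def scalar_prod_def atLeast0LessThan)
    also have "\<dots> = (\<Sum>j<fst B. snd A k $$ (\<sigma> i, \<sigma> j) * vec_index v (\<sigma> j))"
      by (rule sum.reindex_bij_betw[OF \<sigma>, symmetric])
    also have "\<dots> = vec_index (snd B k *\<^sub>v T v) i"
      using i Bk eq[OF k i] by (simp add: T_def scalar_prod_def atLeast0LessThan)
    finally show "vec_index (T (snd A k *\<^sub>v v)) i = vec_index (snd B k *\<^sub>v T v) i" .
  qed
  ultimately show ?thesis
    unfolding rep_iso_def rep_of_mrep_simps
    by (intro exI[of _ T]) (auto simp: T_def \<sigma>1 intro!: eq_vecI)
qed

lemma mrep_sum_comm:
  assumes A: "A \<in> matrix_reps K" and B: "B \<in> matrix_reps K"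
  shows "rep_iso K (rep_of_mrep (mrep_sum A B)) (rep_of_mrep (mrep_sum B A))"
proof (rule rep_iso_reindex[where \<sigma> = "\<lambda>i. if i < fst B then fst A + i else i - fst B"])
  show "bij_betw (\<lambda>i. if i < fst B then fst A + i else i - fst B) {..<fst (mrep_sum B A)} {..<fst (mrep_sum A B)}"
    by (rule bij_betw_byWitness[where f' = "\<lambda>i. if i < fst A then fst B + i else i - fst A"]) auto
  show "snd (mrep_sum B A) k $$ (i, j) = snd (mrep_sum A B) k $$
      (if i < fst B then fst A + i else i - fst B, if j < fst B then fst A + j else j - fst B)"
    if "k \<in> carrier K" "i < fst (mrep_sum B A)" "j < fst (mrep_sum B A)" for k i j
    using that matrix_repsD(1)[OF A that(1)] matrix_repsD(1)[OF B that(1)] by auto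
qed (use A B in auto)

lemma mrep_sum_assoc:
  assumes A: "A \<in> matrix_reps K" and B: "B \<in> matrix_reps K" and C: "C \<in> matrix_reps K"
  shows "rep_iso K (rep_of_mrep (mrep_sum (mrep_sum A B) C)) (rep_of_mrep (mrep_sum A (mrep_sum B C)))"
proof (rule rep_iso_reindex[where \<sigma> = id])
  show "snd (mrep_sum A (mrep_sum B C)) k $$ (i, j) = snd (mrep_sum (mrep_sum A B) C) k $$ (id i, id j)"
    if "k \<in> carrier K" "i < fst (mrep_sum A (mrep_sum B C))" "j < fst (mrep_sum A (mrep_sum B C))" for k i j
    using that matrix_repsD(1)[OF A that(1)] matrix_repsD(1)[OF B that(1)] matrix_repsD(1)[OF C that(1)]
    by auto
qed (use A B C in \<open>auto simp: add.assoc\<close>)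

lemma mrep_sum_zero:
  assumes A: "A \<in> matrix_reps K"
  shows "rep_iso K (rep_of_mrep (mrep_sum mrep_zero A)) (rep_of_mrep A)"
proof (rule rep_iso_reindex[where \<sigma> = id])
  show "snd A k $$ (i, j) = snd (mrep_sum mrep_zero A) k $$ (id i, id j)"
    if "k \<in> carrier K" "i < fst A" "j < fst A" for k i j
    using that matrix_repsD(1)[OF A that(1)] by (auto simp: mrep_zero_def)
qed (use A in \<open>auto simp: mrep_zero_def simp del: mrep_zero_closed intro: mrep_zero_closed[unfolded mrep_zero_def] mrep_sum_closed[unfolded mrep_zero_def]\<close>)

lemma mrep_sum_cong:
  assumes A: "A \<in> matrix_reps K" "A' \<in> matrix_reps K" and B: "B \<in> matrix_reps K" "B' \<in> matrix_reps K"
    and isoA: "rep_iso K (rep_of_mrep A) (rep_of_mrep A')" and isoB: "rep_iso K (rep_of_mrep B) (rep_of_mrep B')"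
  shows "rep_iso K (rep_of_mrep (mrep_sum A B)) (rep_of_mrep (mrep_sum A' B'))"
proof -
  obtain P P' where P: "P \<in> carrier_mat (fst A') (fst A)" "P' \<in> carrier_mat (fst A) (fst A')"
    "P * P' = 1\<^sub>m (fst A')" "P' * P = 1\<^sub>m (fst A)" "\<And>k. k \<in> carrier K \<Longrightarrow> P * snd A k = snd A' k * P"
    using rep_iso_mrepE[OF A isoA] by metis
  obtain Q Q' where Q: "Q \<in> carrier_mat (fst B') (fst B)" "Q' \<in> carrier_mat (fst B) (fst B')"
    "Q * Q' = 1\<^sub>m (fst B')" "Q' * Q = 1\<^sub>m (fst B)" "\<And>k. k \<in> carrier K \<Longrightarrow> Q * snd B k = snd B' k * Q"
    using rep_iso_mrepE[OF B isoB] by metis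
  let ?P = "four_block_mat P (0\<^sub>m (fst A') (fst B)) (0\<^sub>m (fst B') (fst A)) Q"
  let ?P' = "four_block_mat P' (0\<^sub>m (fst A) (fst B')) (0\<^sub>m (fst B) (fst A')) Q'"
  show ?thesis
  proof (rule rep_iso_mrepI[of _ _ _ ?P ?P'])
    fix k assume k: "k \<in> carrier K"
    show "?P * snd (mrep_sum A B) k = snd (mrep_sum A' B') k * ?P"
      by (simp add: four_block_diag_mult[OF P(1) matrix_repsD(1)[OF A(1) k] Q(1) matrix_repsD(1)[OF B(1) k]]
        four_block_diag_mult[OF matrix_repsD(1)[OF A(2) k] P(1) matrix_repsD(1)[OF B(2) k] Q(1)] P(5)[OF k] Q(5)[OF k])
  next
    show "?P * ?P' = 1\<^sub>m (fst (mrep_sum A' B'))"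
      by (simp add: four_block_diag_mult[OF P(1,2) Q(1,2)] P(3) Q(3) four_block_one_mat)
    show "?P' * ?P = 1\<^sub>m (fst (mrep_sum A B))"
      by (simp add: four_block_diag_mult[OF P(2,1) Q(2,1)] P(4) Q(4) four_block_one_mat)
  qed (use A B P(1,2) Q(1,2) in auto)
qed

section \<open>Kronecker products\<close>

definition kron :: "complex Matrix.mat \<Rightarrow> complex Matrix.mat \<Rightarrow> complex Matrix.mat" where
  "kron M N = Matrix.mat (dim_row M * dim_row N) (dim_col M * dim_col N)
     (\<lambda>(i, j). M $$ (i div dim_row N, j div dim_col N) * N $$ (i mod dim_row N, j mod dim_col N))"

lemma kron_carrier: "M \<in> carrier_mat a b \<Longrightarrow> N \<in> carrier_mat c d \<Longrightarrow> kron M N \<in> carrier_mat (a * c) (b * d)"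
  unfolding kron_def by auto

lemma div_mod_less_mult: "i div b < a" "i mod b < b" if "i < a * b" for i a b :: nat
  using that by (simp add: less_mult_imp_div_less, cases "b = 0") auto

text \<open>The pair (u, v) has the number u * b + v, which is the numbering of basis vectors in a
  Kronecker product.\<close>

lemma sum_div_mod:
  fixes f :: "nat \<Rightarrow> nat \<Rightarrow> 'a::comm_monoid_add"
  shows "(\<Sum>s<a * b. f (s div b) (s mod b)) = (\<Sum>u<a. \<Sum>v<b. f u v)"
proof -
  have "(\<Sum>u<a. \<Sum>v<b. f u v) = (\<Sum>(u, v)\<in>{..<a} \<times> {..<b}. f u v)"
    by (simp add: sum.cartesian_product)
  also have "\<dots> = (\<Sum>s<a * b. f (s div b) (s mod b))"
  proof (rule sum.reindex_bij_witness[of _ "\<lambda>s. (s div b, s mod b)" "\<lambda>(u, v). u * b + v"])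
    fix p assume "p \<in> {..<a} \<times> {..<b}"
    then obtain u v where p: "p = (u, v)" "u < a" "v < b" by auto
    have "u * b + v < Suc u * b" using p by simp
    also have "\<dots> \<le> a * b" using p by (intro mult_le_mono1) simp
    finally show "(case p of (u, v) \<Rightarrow> u * b + v) \<in> {..<a * b}" using p by simp
  qed (auto dest: div_mod_less_mult)
  finally show ?thesis ..
qed

text \<open>The factors are rectangular so that the rule also covers intertwiners between
  representations whose degrees are not yet known to agree.\<close>

lemma kron_mult:
  assumes M: "M \<in> carrier_mat a b" and M': "M' \<in> carrier_mat b c"
    and N: "N \<in> carrier_mat p q" and N': "N' \<in> carrier_mat q r"
  shows "kron M N * kron M' N' = kron (M * M') (N * N')"
proof (rule eq_matI)
  fix i j assume "i < dim_row (kron (M * M') (N * N'))" "j < dim_col (kron (M * M') (N * N'))"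
  then have i: "i < a * p" and j: "j < c * r" using assms by (auto simp: kron_def)
  note ij = div_mod_less_mult[OF i] div_mod_less_mult[OF j]
  have "(kron M N * kron M' N') $$ (i, j) = (\<Sum>s<b * q.
      (M $$ (i div p, s div q) * N $$ (i mod p, s mod q)) * (M' $$ (s div q, j div r) * N' $$ (s mod q, j mod r)))"
    using assms i j by (simp add: kron_def scalar_prod_def atLeast0LessThan)
  also have "\<dots> = (\<Sum>u<b. \<Sum>v<q. (M $$ (i div p, u) * N $$ (i mod p, v)) * (M' $$ (u, j div r) * N' $$ (v, j mod r)))"
    by (rule sum_div_mod)
  also have "\<dots> = (\<Sum>u<b. M $$ (i div p, u) * M' $$ (u, j div r)) * (\<Sum>v<q. N $$ (i mod p, v) * N' $$ (v, j mod r))"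
    by (simp add: sum_product ac_simps)
  also have "\<dots> = kron (M * M') (N * N') $$ (i, j)"
    using assms i j ij by (simp add: kron_def scalar_prod_def atLeast0LessThan)
  finally show "(kron M N * kron M' N') $$ (i, j) = kron (M * M') (N * N') $$ (i, j)" .
qed (use assms in \<open>auto simp: kron_def\<close>)

lemma div_mod_eq_iff: "i div b = j div b \<and> i mod b = j mod b \<longleftrightarrow> i = j" for i j b :: nat
  by (metis div_mult_mod_eq)

lemma kron_one: "kron (1\<^sub>m a) (1\<^sub>m b) = 1\<^sub>m (a * b)"
proof (rule eq_matI)
  fix i j assume "i < dim_row (1\<^sub>m (a * b) :: complex Matrix.mat)" "j < dim_col (1\<^sub>m (a * b) :: complex Matrix.mat)"
  then have i: "i < a * b" and j: "j < a * b" by auto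
  then show "kron (1\<^sub>m a) (1\<^sub>m b) $$ (i, j) = (1\<^sub>m (a * b) :: complex Matrix.mat) $$ (i, j)"
    using div_mod_less_mult[OF i] div_mod_less_mult[OF j] div_mod_eq_iff[of i b j] by (auto simp: kron_def)
qed (auto simp: kron_def)

lemma mrep_tensor_fst [simp]: "fst (mrep_tensor A B) = fst A * fst B"
  by (simp add: mrep_tensor_def)

lemma mrep_tensor_snd:
  assumes "A \<in> matrix_reps K" and "B \<in> matrix_reps K" and "k \<in> carrier K"
  shows "snd (mrep_tensor A B) k = kron (snd A k) (snd B k)"
  using matrix_repsD(1)[OF assms(1,3)] matrix_repsD(1)[OF assms(2,3)]
  by (auto simp: mrep_tensor_def kron_def)

lemma mrep_tensor_closed [intro, simp]:
  assumes "Group.monoid K" and A: "A \<in> matrix_reps K" and B: "B \<in> matrix_reps K"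
  shows "mrep_tensor A B \<in> matrix_reps K"
proof (rule matrix_repsI)
  interpret Group.monoid K by fact
  show "snd (mrep_tensor A B) \<one>\<^bsub>K\<^esub> = 1\<^sub>m (fst (mrep_tensor A B))"
    by (simp add: mrep_tensor_snd[OF A B] matrix_repsD(2)[OF A] matrix_repsD(2)[OF B] kron_one)
  fix k assume k: "k \<in> carrier K"
  show "snd (mrep_tensor A B) k \<in> carrier_mat (fst (mrep_tensor A B)) (fst (mrep_tensor A B))"
    using kron_carrier[OF matrix_repsD(1)[OF A k] matrix_repsD(1)[OF B k]] by (simp add: mrep_tensor_snd[OF A B k])
  fix k' assume k': "k' \<in> carrier K"
  show "snd (mrep_tensor A B) (k \<otimes>\<^bsub>K\<^esub> k') = snd (mrep_tensor A B) k * snd (mrep_tensor A B) k'"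
    using k k' by (simp add: mrep_tensor_snd[OF A B] matrix_repsD(3)[OF A] matrix_repsD(3)[OF B]
      kron_mult[OF matrix_repsD(1)[OF A k] matrix_repsD(1)[OF A k'] matrix_repsD(1)[OF B k] matrix_repsD(1)[OF B k']])
qed

text \<open>The Kronecker product of an intertwiner with an identity matrix. The corresponding fact
  for the right factor follows from commutativity.\<close>

lemma mrep_tensor_cong_left:
  assumes K: "Group.monoid K" and A: "A \<in> matrix_reps K" "A' \<in> matrix_reps K" and B: "B \<in> matrix_reps K"
    and iso: "rep_iso K (rep_of_mrep A) (rep_of_mrep A')"
  shows "rep_iso K (rep_of_mrep (mrep_tensor A B)) (rep_of_mrep (mrep_tensor A' B))"
proof -
  obtain P P' where P: "P \<in> carrier_mat (fst A') (fst A)" "P' \<in> carrier_mat (fst A) (fst A')"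
    "P * P' = 1\<^sub>m (fst A')" "P' * P = 1\<^sub>m (fst A)" "\<And>k. k \<in> carrier K \<Longrightarrow> P * snd A k = snd A' k * P"
    using rep_iso_mrepE[OF A iso] by metis
  let ?I = "1\<^sub>m (fst B) :: complex Matrix.mat"
  have I: "?I \<in> carrier_mat (fst B) (fst B)" by simp
  show ?thesis
  proof (rule rep_iso_mrepI[of _ _ _ "kron P ?I" "kron P' ?I"])
    fix k assume k: "k \<in> carrier K"
    note Bk = matrix_repsD(1)[OF B k]
    show "kron P ?I * snd (mrep_tensor A B) k = snd (mrep_tensor A' B) k * kron P ?I"
      using kron_mult[OF P(1) matrix_repsD(1)[OF A(1) k] I Bk]
        kron_mult[OF matrix_repsD(1)[OF A(2) k] P(1) Bk I] P(5)[OF k] Bk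
      by (simp add: mrep_tensor_snd[OF A(1) B k] mrep_tensor_snd[OF A(2) B k])
  next
    show "kron P ?I * kron P' ?I = 1\<^sub>m (fst (mrep_tensor A' B))"
      by (simp add: kron_mult[OF P(1,2) I I] P(3) kron_one)
    show "kron P' ?I * kron P ?I = 1\<^sub>m (fst (mrep_tensor A B))"
      by (simp add: kron_mult[OF P(2,1) I I] P(4) kron_one)
  qed (use K A B P(1,2) I in \<open>auto intro: kron_carrier\<close>)
qed

lemma mrep_tensor_comm:
  assumes K: "Group.monoid K" and A: "A \<in> matrix_reps K" and B: "B \<in> matrix_reps K"
  shows "rep_iso K (rep_of_mrep (mrep_tensor A B)) (rep_of_mrep (mrep_tensor B A))"
proof (rule rep_iso_reindex[where \<sigma> = "\<lambda>i. (i mod fst A) * fst B + i div fst A"])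
  \<comment> \<open>An index of the product of B with A is u * \<open>fst A\<close> + v with u <
    \<open>fst B\<close> and v < \<open>fst A\<close>; exchanging the factors sends it to v *
    \<open>fst B\<close> + u.\<close>
  have lt: "(i mod b) * a + i div b < b * a" if i: "i < a * b" for i a b :: nat
  proof -
    have "(i mod b) * a + i div b < Suc (i mod b) * a" using div_mod_less_mult[OF i] by simp
    also have "\<dots> \<le> b * a" using div_mod_less_mult[OF i] by (intro mult_le_mono1) simp
    finally show ?thesis .
  qed
  have inv: "((((i mod b) * a + i div b) mod a) * b + ((i mod b) * a + i div b) div a) = i"
    if i: "i < a * b" for i a b :: nat
    using div_mod_less_mult[OF i] by simp
  show "bij_betw (\<lambda>i. (i mod fst A) * fst B + i div fst A) {..<fst (mrep_tensor B A)} {..<fst (mrep_tensor A B)}"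
    by (rule bij_betw_byWitness[where f' = "\<lambda>i. (i mod fst B) * fst A + i div fst B"])
      (use lt inv in auto)
  fix k i j assume k: "k \<in> carrier K" and "i < fst (mrep_tensor B A)" "j < fst (mrep_tensor B A)"
  then have i: "i < fst B * fst A" and j: "j < fst B * fst A" by auto
  show "snd (mrep_tensor B A) k $$ (i, j) = snd (mrep_tensor A B) k $$
      ((i mod fst A) * fst B + i div fst A, (j mod fst A) * fst B + j div fst A)"
    using i j lt[OF i] lt[OF j] div_mod_less_mult[OF i] div_mod_less_mult[OF j]
    by (simp add: mrep_tensor_def)
qed (use K A B in auto)

text \<open>With the sum in the left factor, which carries the leading part of a Kronecker index,
  the two blocks stay contiguous. The identity permutation therefore suffices, and only the bounds
  and the offset of the second block are to be matched.\<close>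

lemma mrep_tensor_distrib:
  assumes K: "Group.monoid K" and A: "A \<in> matrix_reps K" and B: "B \<in> matrix_reps K" and C: "C \<in> matrix_reps K"
  shows "rep_iso K (rep_of_mrep (mrep_tensor (mrep_sum A B) C))
    (rep_of_mrep (mrep_sum (mrep_tensor A C) (mrep_tensor B C)))"
proof (rule rep_iso_reindex[where \<sigma> = id])
  fix k i j assume k: "k \<in> carrier K" and "i < fst (mrep_sum (mrep_tensor A C) (mrep_tensor B C))"
    "j < fst (mrep_sum (mrep_tensor A C) (mrep_tensor B C))"
  then have i: "i < (fst A + fst B) * fst C" and j: "j < (fst A + fst B) * fst C"
    by (auto simp: algebra_simps)
  \<comment> \<open>If C had degree zero there would be no index i at all; so division by the degree
    behaves as expected.\<close>
  have c: "fst C > 0" using i by (cases "fst C") auto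
  note Ak = matrix_repsD(1)[OF A k] and Bk = matrix_repsD(1)[OF B k] and Ck = matrix_repsD(1)[OF C k]
  have iff: "s < a * fst C \<longleftrightarrow> s div fst C < a" for s a
    using c by (simp add: div_less_iff_less_mult)
  have sub: "(s - a * fst C) div fst C = s div fst C - a" "(s - a * fst C) mod fst C = s mod fst C"
    if "\<not> s < a * fst C" for s a
  proof -
    have s: "s = (s - a * fst C) + a * fst C" using that by simp
    show "(s - a * fst C) div fst C = s div fst C - a"
      by (subst (2) s) (use c in simp)
    show "(s - a * fst C) mod fst C = s mod fst C"
      by (subst (2) s) (use c in simp)
  qed
  have lt: "s - fst A * fst C < fst B * fst C" if "s < (fst A + fst B) * fst C" "\<not> s < fst A * fst C" for s
    using that by (simp add: algebra_simps)
  note ij = div_mod_less_mult[OF i] div_mod_less_mult[OF j]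
  show "snd (mrep_sum (mrep_tensor A C) (mrep_tensor B C)) k $$ (i, j) =
      snd (mrep_tensor (mrep_sum A B) C) k $$ (id i, id j)"
    using i j ij Ak Bk Ck iff[of i "fst A"] iff[of j "fst A"] sub[of i "fst A"] sub[of j "fst A"] lt[OF i] lt[OF j]
    by (simp add: mrep_tensor_def algebra_simps)
qed (use K A B C in \<open>auto simp: algebra_simps\<close>)

section \<open>The semiring of isomorphism classes\<close>

definition iso_class :: "('k, 'm) monoid_scheme \<Rightarrow> 'k mrep \<Rightarrow> 'k mrep set" where
  "iso_class K A = {B \<in> matrix_reps K. rep_iso K (rep_of_mrep A) (rep_of_mrep B)}"

text \<open>The Grothendieck ring is built from this semiring, in which rearrangements of direct sums
  up to isomorphism become equations.\<close>

definition iso_classes :: "('k, 'm) monoid_scheme \<Rightarrow> 'k mrep set ring" where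
  "iso_classes K = \<lparr>carrier = iso_class K ` matrix_reps K,
     mult = (\<lambda>x y. \<Union>A\<in>x. \<Union>B\<in>y. iso_class K (mrep_tensor A B)),
     one = iso_class K (mrep_char (\<lambda>_. 1)),
     zero = iso_class K mrep_zero,
     add = (\<lambda>x y. \<Union>A\<in>x. \<Union>B\<in>y. iso_class K (mrep_sum A B))\<rparr>"

lemma iso_class_eq_iff:
  assumes A: "A \<in> matrix_reps K" and B: "B \<in> matrix_reps K"
  shows "iso_class K A = iso_class K B \<longleftrightarrow> rep_iso K (rep_of_mrep A) (rep_of_mrep B)"
proof
  assume "iso_class K A = iso_class K B"
  moreover have "B \<in> iso_class K B" using B by (simp add: iso_class_def rep_iso_refl)
  ultimately show "rep_iso K (rep_of_mrep A) (rep_of_mrep B)" by (auto simp: iso_class_def)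
next
  assume AB: "rep_iso K (rep_of_mrep A) (rep_of_mrep B)"
  note BA = rep_iso_sym[OF lin_rep_rep_of_mrep[OF A] AB]
  show "iso_class K A = iso_class K B"
    unfolding iso_class_def using rep_iso_trans[OF AB] rep_iso_trans[OF BA] by blast
qed

lemma iso_class_self: "A \<in> matrix_reps K \<Longrightarrow> A \<in> iso_class K A"
  by (simp add: iso_class_def rep_iso_refl)

lemma iso_classD:
  assumes "A \<in> matrix_reps K" and "A' \<in> iso_class K A"
  shows "A' \<in> matrix_reps K" and "iso_class K A' = iso_class K A"
  using assms iso_class_eq_iff[of A K A'] by (auto simp: iso_class_def)

text \<open>Operations on classes are unions over representatives. Once the united sets are shown to
  coincide, the union is that common set because there are representatives at all.\<close>

lemma UN_UN_constant:
  assumes "a \<in> I" and "b \<in> J" and "\<And>x y. x \<in> I \<Longrightarrow> y \<in> J \<Longrightarrow> f x y = c"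
  shows "(\<Union>x\<in>I. \<Union>y\<in>J. f x y) = c"
proof -
  have "(\<Union>x\<in>I. \<Union>y\<in>J. f x y) = (\<Union>x\<in>I. \<Union>y\<in>J. c)"
    by (intro SUP_cong refl assms(3))
  also have "\<dots> = c"
    using assms(1,2) by auto
  finally show ?thesis .
qed

lemma UN_UN_prod_constant:
  assumes "(a, b) \<in> I" and "(c, d) \<in> J"
    and eq: "\<And>a b c d. (a, b) \<in> I \<Longrightarrow> (c, d) \<in> J \<Longrightarrow> f a b c d = z"
  shows "(\<Union>(a, b)\<in>I. \<Union>(c, d)\<in>J. f a b c d) = z"
proof -
  have "(\<Union>x\<in>I. \<Union>y\<in>J. f (fst x) (snd x) (fst y) (snd y)) = z"
    by (rule UN_UN_constant[OF assms(1,2)]) (simp add: eq)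
  then show ?thesis by (simp add: case_prod_beta')
qed

lemma iso_class_mrep_sum:
  assumes "A \<in> matrix_reps K" "A' \<in> matrix_reps K" "B \<in> matrix_reps K" "B' \<in> matrix_reps K"
    and "iso_class K A = iso_class K A'" and "iso_class K B = iso_class K B'"
  shows "iso_class K (mrep_sum A B) = iso_class K (mrep_sum A' B')"
  using assms mrep_sum_cong[OF assms(1-4)] by (simp add: iso_class_eq_iff)

text \<open>The right factor is changed by moving it to the left, changing it there, and moving it
  back.\<close>

lemma iso_class_mrep_tensor:
  assumes K: "Group.monoid K"
    and A: "A \<in> matrix_reps K" "A' \<in> matrix_reps K" and B: "B \<in> matrix_reps K" "B' \<in> matrix_reps K"
    and eq: "iso_class K A = iso_class K A'" "iso_class K B = iso_class K B'"
  shows "iso_class K (mrep_tensor A B) = iso_class K (mrep_tensor A' B')"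
proof -
  note [simp] = K
  have left: "iso_class K (mrep_tensor A B) = iso_class K (mrep_tensor A' B)"
    if "A \<in> matrix_reps K" "A' \<in> matrix_reps K" "B \<in> matrix_reps K" "iso_class K A = iso_class K A'" for A A' B
    using that mrep_tensor_cong_left[OF K that(1-3)] by (simp add: iso_class_eq_iff)
  have comm: "iso_class K (mrep_tensor A B) = iso_class K (mrep_tensor B A)"
    if "A \<in> matrix_reps K" "B \<in> matrix_reps K" for A B
    using that mrep_tensor_comm[OF K that] by (simp add: iso_class_eq_iff)
  have "iso_class K (mrep_tensor A B) = iso_class K (mrep_tensor A' B)"
    by (rule left) (use A B eq in auto)
  also have "\<dots> = iso_class K (mrep_tensor B A')" by (rule comm) (use A B in auto)
  also have "\<dots> = iso_class K (mrep_tensor B' A')" by (rule left) (use A B eq in auto)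
  also have "\<dots> = iso_class K (mrep_tensor A' B')" by (rule comm) (use A B in auto)
  finally show ?thesis .
qed

lemma iso_classes_carrier: "A \<in> matrix_reps K \<Longrightarrow> iso_class K A \<in> carrier (iso_classes K)"
  by (simp add: iso_classes_def)

lemma iso_classes_zero: "\<zero>\<^bsub>iso_classes K\<^esub> = iso_class K mrep_zero"
  by (simp add: iso_classes_def)

lemma iso_classes_add:
  assumes A: "A \<in> matrix_reps K" and B: "B \<in> matrix_reps K"
  shows "iso_class K A \<oplus>\<^bsub>iso_classes K\<^esub> iso_class K B = iso_class K (mrep_sum A B)"
proof -
  have "iso_class K (mrep_sum A' B') = iso_class K (mrep_sum A B)"
    if "A' \<in> iso_class K A" "B' \<in> iso_class K B" for A' B'
    using iso_classD[OF A that(1)] iso_classD[OF B that(2)] A B by (intro iso_class_mrep_sum) auto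
  then show ?thesis
    unfolding iso_classes_def ring.simps by (rule UN_UN_constant[OF iso_class_self[OF A] iso_class_self[OF B]])
qed

lemma iso_classes_mult:
  assumes K: "Group.monoid K" and A: "A \<in> matrix_reps K" and B: "B \<in> matrix_reps K"
  shows "iso_class K A \<otimes>\<^bsub>iso_classes K\<^esub> iso_class K B = iso_class K (mrep_tensor A B)"
proof -
  have "iso_class K (mrep_tensor A' B') = iso_class K (mrep_tensor A B)"
    if "A' \<in> iso_class K A" "B' \<in> iso_class K B" for A' B'
    using iso_classD[OF A that(1)] iso_classD[OF B that(2)] A B K by (intro iso_class_mrep_tensor) auto
  then show ?thesis
    unfolding iso_classes_def monoid.simps partial_object.simps by (rule UN_UN_constant[OF iso_class_self[OF A] iso_class_self[OF B]])
qed

lemma iso_classes_cases: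
  assumes "x \<in> carrier (iso_classes K)"
  obtains A where "A \<in> matrix_reps K" and "x = iso_class K A"
  using assms by (auto simp: iso_classes_def)

lemma abelian_monoid_iso_classes: "abelian_monoid (iso_classes K)"
proof (rule abelian_monoidI)
  fix x y z
  assume x: "x \<in> carrier (iso_classes K)" and y: "y \<in> carrier (iso_classes K)" and z: "z \<in> carrier (iso_classes K)"
  obtain A where A: "A \<in> matrix_reps K" "x = iso_class K A" by (rule iso_classes_cases[OF x])
  obtain B where B: "B \<in> matrix_reps K" "y = iso_class K B" by (rule iso_classes_cases[OF y])
  obtain C where C: "C \<in> matrix_reps K" "z = iso_class K C" by (rule iso_classes_cases[OF z])
  show "x \<oplus>\<^bsub>iso_classes K\<^esub> y \<oplus>\<^bsub>iso_classes K\<^esub> z = x \<oplus>\<^bsub>iso_classes K\<^esub> (y \<oplus>\<^bsub>iso_classes K\<^esub> z)"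
    using A B C by (simp add: iso_classes_add iso_class_eq_iff mrep_sum_assoc)
next
  fix x y
  assume x: "x \<in> carrier (iso_classes K)" and y: "y \<in> carrier (iso_classes K)"
  obtain A where A: "A \<in> matrix_reps K" "x = iso_class K A" by (rule iso_classes_cases[OF x])
  obtain B where B: "B \<in> matrix_reps K" "y = iso_class K B" by (rule iso_classes_cases[OF y])
  show "x \<oplus>\<^bsub>iso_classes K\<^esub> y = y \<oplus>\<^bsub>iso_classes K\<^esub> x"
    using A B by (simp add: iso_classes_add iso_class_eq_iff mrep_sum_comm)
  show "x \<oplus>\<^bsub>iso_classes K\<^esub> y \<in> carrier (iso_classes K)"
    using A B by (simp add: iso_classes_add iso_classes_carrier)
  show "\<zero>\<^bsub>iso_classes K\<^esub> \<oplus>\<^bsub>iso_classes K\<^esub> x = x"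
    using A by (simp add: iso_classes_add iso_classes_zero iso_class_eq_iff mrep_sum_zero)
qed (simp add: iso_classes_zero iso_classes_carrier)

lemma iso_classes_ring_laws:
  assumes K: "Group.monoid K"
    and x: "x \<in> carrier (iso_classes K)" and y: "y \<in> carrier (iso_classes K)"
  shows "x \<otimes>\<^bsub>iso_classes K\<^esub> y \<in> carrier (iso_classes K)"
    and "x \<otimes>\<^bsub>iso_classes K\<^esub> y = y \<otimes>\<^bsub>iso_classes K\<^esub> x"
    and "z \<in> carrier (iso_classes K) \<Longrightarrow> (x \<oplus>\<^bsub>iso_classes K\<^esub> y) \<otimes>\<^bsub>iso_classes K\<^esub> z =
      x \<otimes>\<^bsub>iso_classes K\<^esub> z \<oplus>\<^bsub>iso_classes K\<^esub> y \<otimes>\<^bsub>iso_classes K\<^esub> z"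
proof -
  note [simp] = K
  obtain A where A: "A \<in> matrix_reps K" "x = iso_class K A" by (rule iso_classes_cases[OF x])
  obtain B where B: "B \<in> matrix_reps K" "y = iso_class K B" by (rule iso_classes_cases[OF y])
  show "x \<otimes>\<^bsub>iso_classes K\<^esub> y \<in> carrier (iso_classes K)"
    using A B by (simp add: iso_classes_mult iso_classes_carrier)
  show "x \<otimes>\<^bsub>iso_classes K\<^esub> y = y \<otimes>\<^bsub>iso_classes K\<^esub> x"
    using A B by (simp add: iso_classes_mult iso_class_eq_iff mrep_tensor_comm)
  assume z: "z \<in> carrier (iso_classes K)"
  obtain C where C: "C \<in> matrix_reps K" "z = iso_class K C" by (rule iso_classes_cases[OF z])
  show "(x \<oplus>\<^bsub>iso_classes K\<^esub> y) \<otimes>\<^bsub>iso_classes K\<^esub> z =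
      x \<otimes>\<^bsub>iso_classes K\<^esub> z \<oplus>\<^bsub>iso_classes K\<^esub> y \<otimes>\<^bsub>iso_classes K\<^esub> z"
    using A B C by (simp add: iso_classes_mult iso_classes_add iso_class_eq_iff mrep_tensor_distrib)
qed

text \<open>In the commutative monoid of isomorphism classes the relation is that of group
  completion: two formal differences agree if their cross sums agree after adding some c.
  Well-definedness then becomes computation in that monoid.\<close>

lemma virtual_rel_iff:
  "((A, B), (A', B')) \<in> virtual_rel K \<longleftrightarrow>
     A \<in> matrix_reps K \<and> B \<in> matrix_reps K \<and> A' \<in> matrix_reps K \<and> B' \<in> matrix_reps K \<and>
     (\<exists>c\<in>carrier (iso_classes K).
        iso_class K A \<oplus>\<^bsub>iso_classes K\<^esub> iso_class K B' \<oplus>\<^bsub>iso_classes K\<^esub> c =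
        iso_class K A' \<oplus>\<^bsub>iso_classes K\<^esub> iso_class K B \<oplus>\<^bsub>iso_classes K\<^esub> c)"
proof (cases "A \<in> matrix_reps K \<and> B \<in> matrix_reps K \<and> A' \<in> matrix_reps K \<and> B' \<in> matrix_reps K")
  case True
  then have *: "iso_class K A \<oplus>\<^bsub>iso_classes K\<^esub> iso_class K B' \<oplus>\<^bsub>iso_classes K\<^esub> iso_class K C =
        iso_class K A' \<oplus>\<^bsub>iso_classes K\<^esub> iso_class K B \<oplus>\<^bsub>iso_classes K\<^esub> iso_class K C \<longleftrightarrow>
     rep_iso K (rep_of_mrep (mrep_sum (mrep_sum A B') C)) (rep_of_mrep (mrep_sum (mrep_sum A' B) C))"
    if "C \<in> matrix_reps K" for C
    using that by (simp add: iso_classes_add iso_class_eq_iff)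
  have "carrier (iso_classes K) = iso_class K ` matrix_reps K" by (simp add: iso_classes_def)
  then show ?thesis using True * by (simp add: virtual_rel_def)
qed (auto simp: virtual_rel_def)

lemma equiv_virtual_rel: "equiv (matrix_reps K \<times> matrix_reps K) (virtual_rel K)"
proof (rule equivI)
  interpret M: abelian_monoid "iso_classes K" by (rule abelian_monoid_iso_classes)
  note [simp] = iso_classes_carrier
  show "virtual_rel K \<subseteq> (matrix_reps K \<times> matrix_reps K) \<times> (matrix_reps K \<times> matrix_reps K)"
    by (auto simp: virtual_rel_def)
  show "refl_on (matrix_reps K \<times> matrix_reps K) (virtual_rel K)"
    by (rule refl_onI) (auto simp: virtual_rel_iff intro!: exI[of _ "\<zero>\<^bsub>iso_classes K\<^esub>"])
  show "sym (virtual_rel K)"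
  proof (rule symI)
    fix p q assume "(p, q) \<in> virtual_rel K"
    moreover obtain A B A' B' where "p = (A, B)" "q = (A', B')" by (cases p; cases q)
    ultimately show "(q, p) \<in> virtual_rel K"
      unfolding virtual_rel_iff by (simp add: virtual_rel_iff) (elim conjE bexE, rule bexI, rule sym)
  qed
  show "trans (virtual_rel K)"
  proof (rule transI)
    fix p q r assume pq: "(p, q) \<in> virtual_rel K" and qr: "(q, r) \<in> virtual_rel K"
    obtain A B A' B' A'' B'' where pqr: "p = (A, B)" "q = (A', B')" "r = (A'', B'')"
      by (cases p; cases q; cases r)
    let ?a = "iso_class K A" and ?b = "iso_class K B" and ?a' = "iso_class K A'" and ?b' = "iso_class K B'"
      and ?a'' = "iso_class K A''" and ?b'' = "iso_class K B''"
    obtain c where c: "c \<in> carrier (iso_classes K)"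
      "?a \<oplus>\<^bsub>iso_classes K\<^esub> ?b' \<oplus>\<^bsub>iso_classes K\<^esub> c = ?a' \<oplus>\<^bsub>iso_classes K\<^esub> ?b \<oplus>\<^bsub>iso_classes K\<^esub> c"
      and 1: "A \<in> matrix_reps K" "B \<in> matrix_reps K" "A' \<in> matrix_reps K" "B' \<in> matrix_reps K"
      using pq unfolding pqr virtual_rel_iff by blast
    obtain d where d: "d \<in> carrier (iso_classes K)"
      "?a' \<oplus>\<^bsub>iso_classes K\<^esub> ?b'' \<oplus>\<^bsub>iso_classes K\<^esub> d = ?a'' \<oplus>\<^bsub>iso_classes K\<^esub> ?b' \<oplus>\<^bsub>iso_classes K\<^esub> d"
      and 2: "A'' \<in> matrix_reps K" "B'' \<in> matrix_reps K"
      using qr unfolding pqr virtual_rel_iff by blast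
    \<comment> \<open>The two given equations are added. Their middle terms a' and b' occur on both
      sides but cannot be cancelled in a monoid, so they join c and d in the summand that witnesses
      the relation.\<close>
    let ?z = "?a' \<oplus>\<^bsub>iso_classes K\<^esub> ?b' \<oplus>\<^bsub>iso_classes K\<^esub> c \<oplus>\<^bsub>iso_classes K\<^esub> d"
    have "?a \<oplus>\<^bsub>iso_classes K\<^esub> ?b'' \<oplus>\<^bsub>iso_classes K\<^esub> ?z =
      (?a \<oplus>\<^bsub>iso_classes K\<^esub> ?b' \<oplus>\<^bsub>iso_classes K\<^esub> c) \<oplus>\<^bsub>iso_classes K\<^esub> (?a' \<oplus>\<^bsub>iso_classes K\<^esub> ?b'' \<oplus>\<^bsub>iso_classes K\<^esub> d)"
      using 1 2 c(1) d(1) by (simp add: M.a_ac)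
    also have "\<dots> = ?a'' \<oplus>\<^bsub>iso_classes K\<^esub> ?b \<oplus>\<^bsub>iso_classes K\<^esub> ?z"
      unfolding c(2) d(2) using 1 2 c(1) d(1) by (simp add: M.a_ac)
    finally have *: "?a \<oplus>\<^bsub>iso_classes K\<^esub> ?b'' \<oplus>\<^bsub>iso_classes K\<^esub> ?z = ?a'' \<oplus>\<^bsub>iso_classes K\<^esub> ?b \<oplus>\<^bsub>iso_classes K\<^esub> ?z" .
    have "?z \<in> carrier (iso_classes K)" using 1 2 c(1) d(1) by simp
    with * show "(p, r) \<in> virtual_rel K" unfolding pqr virtual_rel_iff using 1 2 by blast
  qed
qed

lemma virtual_class_eq_iff:
  assumes "A \<in> matrix_reps K" "B \<in> matrix_reps K" "A' \<in> matrix_reps K" "B' \<in> matrix_reps K"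
  shows "virtual_class K A B = virtual_class K A' B' \<longleftrightarrow> ((A, B), (A', B')) \<in> virtual_rel K"
  unfolding virtual_class_def using assms by (intro eq_equiv_class_iff[OF equiv_virtual_rel]) auto

lemma virtual_class_self:
  "A \<in> matrix_reps K \<Longrightarrow> B \<in> matrix_reps K \<Longrightarrow> (A, B) \<in> virtual_class K A B"
  unfolding virtual_class_def by (rule equiv_class_self[OF equiv_virtual_rel]) auto

lemma virtual_classD:
  assumes "(A', B') \<in> virtual_class K A B"
  shows "A' \<in> matrix_reps K" and "B' \<in> matrix_reps K" and "((A, B), (A', B')) \<in> virtual_rel K"
  using assms by (auto simp: virtual_class_def virtual_rel_def)

lemma virtual_class_iso:
  assumes "A \<in> matrix_reps K" "B \<in> matrix_reps K" "A' \<in> matrix_reps K" "B' \<in> matrix_reps K"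
    and "rep_iso K (rep_of_mrep A) (rep_of_mrep A')" "rep_iso K (rep_of_mrep B) (rep_of_mrep B')"
  shows "virtual_class K A B = virtual_class K A' B'"
proof -
  interpret M: abelian_monoid "iso_classes K" by (rule abelian_monoid_iso_classes)
  have "iso_class K A = iso_class K A'" "iso_class K B = iso_class K B'"
    using assms by (simp_all add: iso_class_eq_iff)
  then have "((A, B), (A', B')) \<in> virtual_rel K"
    using assms(1-4) by (auto simp: virtual_rel_iff intro: M.zero_closed)
  then show ?thesis using assms by (simp add: virtual_class_eq_iff)
qed

section \<open>Addition and multiplication in the Grothendieck ring\<close>

lemma Rep_ring_carrier: "carrier (Rep_ring K) = {virtual_class K A B | A B. A \<in> matrix_reps K \<and> B \<in> matrix_reps K}"
  by (auto simp: Rep_ring_def quotient_def virtual_class_def)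

lemma Rep_ring_add:
  assumes A: "A \<in> matrix_reps K" and B: "B \<in> matrix_reps K" and C: "C \<in> matrix_reps K" and D: "D \<in> matrix_reps K"
  shows "virtual_class K A B \<oplus>\<^bsub>Rep_ring K\<^esub> virtual_class K C D = virtual_class K (mrep_sum A C) (mrep_sum B D)"
proof -
  interpret M: abelian_monoid "iso_classes K" by (rule abelian_monoid_iso_classes)
  note [simp] = iso_classes_carrier
  have eq: "virtual_class K (mrep_sum A' C') (mrep_sum B' D') = virtual_class K (mrep_sum A C) (mrep_sum B D)"
    if AB: "(A', B') \<in> virtual_class K A B" and CD: "(C', D') \<in> virtual_class K C D" for A' B' C' D'
  proof -
    note 1 = virtual_classD(1,2)[OF AB] virtual_classD(1,2)[OF CD]
    let ?a = "iso_class K A" and ?b = "iso_class K B" and ?a' = "iso_class K A'" and ?b' = "iso_class K B'"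
      and ?c = "iso_class K C" and ?d = "iso_class K D" and ?c' = "iso_class K C'" and ?d' = "iso_class K D'"
    obtain x where x: "x \<in> carrier (iso_classes K)"
      "?a \<oplus>\<^bsub>iso_classes K\<^esub> ?b' \<oplus>\<^bsub>iso_classes K\<^esub> x = ?a' \<oplus>\<^bsub>iso_classes K\<^esub> ?b \<oplus>\<^bsub>iso_classes K\<^esub> x"
      using virtual_classD(3)[OF AB] unfolding virtual_rel_iff by blast
    obtain y where y: "y \<in> carrier (iso_classes K)"
      "?c \<oplus>\<^bsub>iso_classes K\<^esub> ?d' \<oplus>\<^bsub>iso_classes K\<^esub> y = ?c' \<oplus>\<^bsub>iso_classes K\<^esub> ?d \<oplus>\<^bsub>iso_classes K\<^esub> y"
      using virtual_classD(3)[OF CD] unfolding virtual_rel_iff by blast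
    have "(?a \<oplus>\<^bsub>iso_classes K\<^esub> ?c) \<oplus>\<^bsub>iso_classes K\<^esub> (?b' \<oplus>\<^bsub>iso_classes K\<^esub> ?d') \<oplus>\<^bsub>iso_classes K\<^esub> (x \<oplus>\<^bsub>iso_classes K\<^esub> y) =
      (?a \<oplus>\<^bsub>iso_classes K\<^esub> ?b' \<oplus>\<^bsub>iso_classes K\<^esub> x) \<oplus>\<^bsub>iso_classes K\<^esub> (?c \<oplus>\<^bsub>iso_classes K\<^esub> ?d' \<oplus>\<^bsub>iso_classes K\<^esub> y)"
      using 1 A B C D x(1) y(1) by (simp add: M.a_ac)
    also have "\<dots> = (?a' \<oplus>\<^bsub>iso_classes K\<^esub> ?c') \<oplus>\<^bsub>iso_classes K\<^esub> (?b \<oplus>\<^bsub>iso_classes K\<^esub> ?d) \<oplus>\<^bsub>iso_classes K\<^esub> (x \<oplus>\<^bsub>iso_classes K\<^esub> y)"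
      unfolding x(2) y(2) using 1 A B C D x(1) y(1) by (simp add: M.a_ac)
    finally have "((mrep_sum A C, mrep_sum B D), (mrep_sum A' C', mrep_sum B' D')) \<in> virtual_rel K"
      using 1 A B C D x(1) y(1) by (auto simp: virtual_rel_iff simp flip: iso_classes_add)
    then show ?thesis using 1 A B C D by (simp flip: virtual_class_eq_iff)
  qed
  show ?thesis
    unfolding Rep_ring_def ring.simps
    by (rule UN_UN_prod_constant[OF virtual_class_self[OF A B] virtual_class_self[OF C D]]) (rule eq)
qed

lemma Rep_ring_mult:
  assumes K: "Group.monoid K"
    and A: "A \<in> matrix_reps K" and B: "B \<in> matrix_reps K" and C: "C \<in> matrix_reps K" and D: "D \<in> matrix_reps K"
  shows "virtual_class K A B \<otimes>\<^bsub>Rep_ring K\<^esub> virtual_class K C D =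
    virtual_class K (mrep_sum (mrep_tensor A C) (mrep_tensor B D)) (mrep_sum (mrep_tensor A D) (mrep_tensor B C))"
proof -
  interpret M: abelian_monoid "iso_classes K" by (rule abelian_monoid_iso_classes)
  let ?M = "iso_classes K"
  let ?V = "\<lambda>A B C D. virtual_class K (mrep_sum (mrep_tensor A C) (mrep_tensor B D)) (mrep_sum (mrep_tensor A D) (mrep_tensor B C))"
  note [simp] = iso_classes_carrier K
  note laws = iso_classes_ring_laws[OF K]
  have mc: "x \<otimes>\<^bsub>?M\<^esub> y \<in> carrier ?M" if "x \<in> carrier ?M" "y \<in> carrier ?M" for x y
    using laws(1)[OF that] .
  \<comment> \<open>Only the left factor varies here; \<open>eq2\<close> exchanges the factors and
    so covers the right one.\<close>
  have eq1: "?V A B C D = ?V A' B' C D"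
    if AB: "((A, B), (A', B')) \<in> virtual_rel K" and C: "C \<in> matrix_reps K" and D: "D \<in> matrix_reps K" for A B A' B' C D
  proof -
    let ?a = "iso_class K A" and ?b = "iso_class K B" and ?a' = "iso_class K A'" and ?b' = "iso_class K B'"
      and ?c = "iso_class K C" and ?d = "iso_class K D"
    obtain x where x: "x \<in> carrier ?M"
      "?a \<oplus>\<^bsub>?M\<^esub> ?b' \<oplus>\<^bsub>?M\<^esub> x = ?a' \<oplus>\<^bsub>?M\<^esub> ?b \<oplus>\<^bsub>?M\<^esub> x"
      and 1: "A \<in> matrix_reps K" "B \<in> matrix_reps K" "A' \<in> matrix_reps K" "B' \<in> matrix_reps K"
      using AB unfolding virtual_rel_iff by blast
    \<comment> \<open>The relation is multiplied by c and, with its sides exchanged, by d. Adding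
      the results leaves the two multiples of x as the common summand.\<close>
    let ?y = "x \<otimes>\<^bsub>?M\<^esub> ?c \<oplus>\<^bsub>?M\<^esub> x \<otimes>\<^bsub>?M\<^esub> ?d"
    have y: "?y \<in> carrier ?M" using x C D by (simp add: mc)
    have "(?a \<otimes>\<^bsub>?M\<^esub> ?c \<oplus>\<^bsub>?M\<^esub> ?b \<otimes>\<^bsub>?M\<^esub> ?d) \<oplus>\<^bsub>?M\<^esub> (?a' \<otimes>\<^bsub>?M\<^esub> ?d \<oplus>\<^bsub>?M\<^esub> ?b' \<otimes>\<^bsub>?M\<^esub> ?c) \<oplus>\<^bsub>?M\<^esub> ?y =
      (?a \<oplus>\<^bsub>?M\<^esub> ?b' \<oplus>\<^bsub>?M\<^esub> x) \<otimes>\<^bsub>?M\<^esub> ?c \<oplus>\<^bsub>?M\<^esub> (?a' \<oplus>\<^bsub>?M\<^esub> ?b \<oplus>\<^bsub>?M\<^esub> x) \<otimes>\<^bsub>?M\<^esub> ?d"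
      using 1 C D x(1) by (simp add: M.a_ac laws(3) mc)
    also have "\<dots> = (?a' \<oplus>\<^bsub>?M\<^esub> ?b \<oplus>\<^bsub>?M\<^esub> x) \<otimes>\<^bsub>?M\<^esub> ?c \<oplus>\<^bsub>?M\<^esub> (?a \<oplus>\<^bsub>?M\<^esub> ?b' \<oplus>\<^bsub>?M\<^esub> x) \<otimes>\<^bsub>?M\<^esub> ?d"
      by (simp only: x(2))
    also have "\<dots> = (?a' \<otimes>\<^bsub>?M\<^esub> ?c \<oplus>\<^bsub>?M\<^esub> ?b' \<otimes>\<^bsub>?M\<^esub> ?d) \<oplus>\<^bsub>?M\<^esub> (?a \<otimes>\<^bsub>?M\<^esub> ?d \<oplus>\<^bsub>?M\<^esub> ?b \<otimes>\<^bsub>?M\<^esub> ?c) \<oplus>\<^bsub>?M\<^esub> ?y"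
      using 1 C D x(1) by (simp add: M.a_ac laws(3) mc)
    finally have "((mrep_sum (mrep_tensor A C) (mrep_tensor B D), mrep_sum (mrep_tensor A D) (mrep_tensor B C)),
        (mrep_sum (mrep_tensor A' C) (mrep_tensor B' D), mrep_sum (mrep_tensor A' D) (mrep_tensor B' C))) \<in> virtual_rel K"
      unfolding virtual_rel_iff using 1 C D y by (auto simp flip: iso_classes_add iso_classes_mult)
    then show ?thesis using 1 C D by (simp add: virtual_class_eq_iff)
  qed
  have eq2: "?V A B C D = ?V C D A B"
    if A: "A \<in> matrix_reps K" and B: "B \<in> matrix_reps K" and C: "C \<in> matrix_reps K" and D: "D \<in> matrix_reps K" for A B C D
  proof (rule virtual_class_iso)
    show "rep_iso K (rep_of_mrep (mrep_sum (mrep_tensor A C) (mrep_tensor B D))) (rep_of_mrep (mrep_sum (mrep_tensor C A) (mrep_tensor D B)))"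
      by (rule mrep_sum_cong) (use A B C D in \<open>auto intro: mrep_tensor_comm[OF K]\<close>)
    have "rep_iso K (rep_of_mrep (mrep_sum (mrep_tensor A D) (mrep_tensor B C))) (rep_of_mrep (mrep_sum (mrep_tensor D A) (mrep_tensor C B)))"
      by (rule mrep_sum_cong) (use A B C D in \<open>auto intro: mrep_tensor_comm[OF K]\<close>)
    moreover have "rep_iso K (rep_of_mrep (mrep_sum (mrep_tensor D A) (mrep_tensor C B))) (rep_of_mrep (mrep_sum (mrep_tensor C B) (mrep_tensor D A)))"
      by (rule mrep_sum_comm) (use A B C D in auto)
    ultimately show "rep_iso K (rep_of_mrep (mrep_sum (mrep_tensor A D) (mrep_tensor B C))) (rep_of_mrep (mrep_sum (mrep_tensor C B) (mrep_tensor D A)))"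
      by (rule rep_iso_trans)
  qed (use A B C D in auto)
  \<comment> \<open>Change the left factor, exchange the factors, change the new left factor, and
    exchange back.\<close>
  have eq: "?V A' B' C' D' = ?V A B C D"
    if AB: "(A', B') \<in> virtual_class K A B" and CD: "(C', D') \<in> virtual_class K C D" for A' B' C' D'
  proof -
    note 1 = virtual_classD(1,2)[OF AB] virtual_classD(1,2)[OF CD]
    note 2 = virtual_classD(3)[OF AB] virtual_classD(3)[OF CD]
    show ?thesis
      unfolding eq1[OF 2(1) C D] eq2[OF 1(1,2) C D] eq1[OF 2(2) 1(1,2)] eq2[OF 1(3,4) 1(1,2)] ..
  qed
  show ?thesis
    unfolding Rep_ring_def ring.simps monoid.simps partial_object.simps
    by (rule UN_UN_prod_constant[OF virtual_class_self[OF A B] virtual_class_self[OF C D]]) (rule eq)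
qed

text \<open>This much structure is what the evaluation of the finite sum in \<open>Phi\<close>
  relies on.\<close>

lemma abelian_monoid_Rep_ring: "abelian_monoid (Rep_ring K)"
proof (rule abelian_monoidI)
  have zero: "\<zero>\<^bsub>Rep_ring K\<^esub> = virtual_class K mrep_zero mrep_zero" by (simp add: Rep_ring_def)
  show "\<zero>\<^bsub>Rep_ring K\<^esub> \<in> carrier (Rep_ring K)" unfolding zero Rep_ring_carrier by blast
  fix x y assume x: "x \<in> carrier (Rep_ring K)" and y: "y \<in> carrier (Rep_ring K)"
  obtain A B where A: "A \<in> matrix_reps K" "B \<in> matrix_reps K" "x = virtual_class K A B" using x by (auto simp: Rep_ring_carrier)
  obtain C D where C: "C \<in> matrix_reps K" "D \<in> matrix_reps K" "y = virtual_class K C D" using y by (auto simp: Rep_ring_carrier)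
  show "x \<oplus>\<^bsub>Rep_ring K\<^esub> y \<in> carrier (Rep_ring K)"
    unfolding A C Rep_ring_add[OF A(1,2) C(1,2)] Rep_ring_carrier using A C by blast
  show "x \<oplus>\<^bsub>Rep_ring K\<^esub> y = y \<oplus>\<^bsub>Rep_ring K\<^esub> x"
    using A C by (simp add: Rep_ring_add virtual_class_iso mrep_sum_comm)
  show "\<zero>\<^bsub>Rep_ring K\<^esub> \<oplus>\<^bsub>Rep_ring K\<^esub> x = x"
    using A by (simp add: Rep_ring_add zero virtual_class_iso mrep_sum_zero)
  fix z assume z: "z \<in> carrier (Rep_ring K)"
  obtain E F where E: "E \<in> matrix_reps K" "F \<in> matrix_reps K" "z = virtual_class K E F" using z by (auto simp: Rep_ring_carrier)
  show "x \<oplus>\<^bsub>Rep_ring K\<^esub> y \<oplus>\<^bsub>Rep_ring K\<^esub> z = x \<oplus>\<^bsub>Rep_ring K\<^esub> (y \<oplus>\<^bsub>Rep_ring K\<^esub> z)"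
    using A C E by (simp add: Rep_ring_add virtual_class_iso mrep_sum_assoc)
qed

section \<open>Induced representations\<close>

lemma ind_rep_simps [simp]:
  "carrier (fst (ind_rep K H V)) = {f \<in> carrier K \<rightarrow>\<^sub>E carrier (fst V).
     \<forall>h\<in>H. \<forall>k\<in>carrier K. f (h \<otimes>\<^bsub>K\<^esub> k) = snd V h (f k)}"
  "\<zero>\<^bsub>fst (ind_rep K H V)\<^esub> = (\<lambda>k\<in>carrier K. \<zero>\<^bsub>fst V\<^esub>)"
  "f \<oplus>\<^bsub>fst (ind_rep K H V)\<^esub> g = (\<lambda>k\<in>carrier K. f k \<oplus>\<^bsub>fst V\<^esub> g k)"
  "c \<odot>\<^bsub>fst (ind_rep K H V)\<^esub> f = (\<lambda>k\<in>carrier K. c \<odot>\<^bsub>fst V\<^esub> f k)"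
  "snd (ind_rep K H V) x f = (\<lambda>k\<in>carrier K. f (k \<otimes>\<^bsub>K\<^esub> x))"
  by (simp_all add: ind_rep_def)

lemma ind_rep_eqI:
  assumes "f \<in> carrier (fst (ind_rep K H V))" and "g \<in> carrier (fst (ind_rep K H V))"
    and "\<And>k. k \<in> carrier K \<Longrightarrow> f k = g k"
  shows "f = g"
  using assms by (auto intro: PiE_ext)

lemma lin_repD:
  assumes "lin_rep K V"
  shows "\<zero>\<^bsub>fst V\<^esub> \<in> carrier (fst V)"
    and "\<And>x y. x \<in> carrier (fst V) \<Longrightarrow> y \<in> carrier (fst V) \<Longrightarrow> x \<oplus>\<^bsub>fst V\<^esub> y \<in> carrier (fst V)"
    and "\<And>c x. x \<in> carrier (fst V) \<Longrightarrow> c \<odot>\<^bsub>fst V\<^esub> x \<in> carrier (fst V)"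
    and "\<And>x. x \<in> carrier (fst V) \<Longrightarrow> \<zero>\<^bsub>fst V\<^esub> \<oplus>\<^bsub>fst V\<^esub> x = x"
    and "\<And>x. x \<in> carrier (fst V) \<Longrightarrow> 0 \<odot>\<^bsub>fst V\<^esub> x = \<zero>\<^bsub>fst V\<^esub>"
    and "\<And>c. c \<odot>\<^bsub>fst V\<^esub> \<zero>\<^bsub>fst V\<^esub> = \<zero>\<^bsub>fst V\<^esub>"
    and "\<And>k x. k \<in> carrier K \<Longrightarrow> x \<in> carrier (fst V) \<Longrightarrow> snd V k x \<in> carrier (fst V)"
    and "\<And>k x y. k \<in> carrier K \<Longrightarrow> x \<in> carrier (fst V) \<Longrightarrow> y \<in> carrier (fst V) \<Longrightarrow>
        snd V k (x \<oplus>\<^bsub>fst V\<^esub> y) = snd V k x \<oplus>\<^bsub>fst V\<^esub> snd V k y"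
    and "\<And>k c x. k \<in> carrier K \<Longrightarrow> x \<in> carrier (fst V) \<Longrightarrow>
        snd V k (c \<odot>\<^bsub>fst V\<^esub> x) = c \<odot>\<^bsub>fst V\<^esub> snd V k x"
    and "\<And>x. x \<in> carrier (fst V) \<Longrightarrow> snd V \<one>\<^bsub>K\<^esub> x = x"
    and "\<And>k k' x. k \<in> carrier K \<Longrightarrow> k' \<in> carrier K \<Longrightarrow> x \<in> carrier (fst V) \<Longrightarrow>
        snd V (k \<otimes>\<^bsub>K\<^esub> k') x = snd V k (snd V k' x)"
    and "\<And>k. k \<in> carrier K \<Longrightarrow> snd V k \<zero>\<^bsub>fst V\<^esub> = \<zero>\<^bsub>fst V\<^esub>"
proof -
  show "snd V k \<zero>\<^bsub>fst V\<^esub> = \<zero>\<^bsub>fst V\<^esub>" if "k \<in> carrier K" for k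
  proof -
    have "snd V k (0 \<odot>\<^bsub>fst V\<^esub> \<zero>\<^bsub>fst V\<^esub>) = 0 \<odot>\<^bsub>fst V\<^esub> snd V k \<zero>\<^bsub>fst V\<^esub>"
      using assms that unfolding lin_rep_def by blast
    also have "\<dots> = \<zero>\<^bsub>fst V\<^esub>" using assms that unfolding lin_rep_def by blast
    finally show ?thesis using assms by (simp add: lin_rep_def)
  qed
qed (use assms in \<open>auto simp: lin_rep_def\<close>)

lemma lin_rep_ind_rep:
  assumes K: "group K" and H: "subgroup H K" and V: "lin_rep (K\<lparr>carrier := H\<rparr>) V"
  shows "lin_rep K (ind_rep K H V)"
proof -
  interpret group K by (rule K)
  note HK = subgroup.mem_carrier[OF H]
  note V = lin_repD[OF V, simplified]
  note mem = PiE_mem[where S = "carrier K" and T = "\<lambda>_. carrier (fst V)"]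
    and arb = PiE_arb[where S = "carrier K" and T = "\<lambda>_. carrier (fst V)"]
  show ?thesis
    unfolding lin_rep_def ind_rep_simps
    by (intro conjI ballI allI) (auto simp: V HK mem arb m_assoc fun_eq_iff restrict_def)
qed

lemma ind_rep_cong:
  assumes K: "group K" and H: "subgroup H K" and V: "lin_rep (K\<lparr>carrier := H\<rparr>) V"
    and iso: "rep_iso (K\<lparr>carrier := H\<rparr>) V W"
  shows "rep_iso K (ind_rep K H V) (ind_rep K H W)"
proof -
  interpret group K by (rule K)
  note HK = subgroup.mem_carrier[OF H]
  note V = lin_repD[OF V, simplified]
  obtain T where T: "bij_betw T (carrier (fst V)) (carrier (fst W))"
    "\<And>x y. x \<in> carrier (fst V) \<Longrightarrow> y \<in> carrier (fst V) \<Longrightarrow> T (x \<oplus>\<^bsub>fst V\<^esub> y) = T x \<oplus>\<^bsub>fst W\<^esub> T y"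
    "\<And>c x. x \<in> carrier (fst V) \<Longrightarrow> T (c \<odot>\<^bsub>fst V\<^esub> x) = c \<odot>\<^bsub>fst W\<^esub> T x"
    "\<And>k x. k \<in> H \<Longrightarrow> x \<in> carrier (fst V) \<Longrightarrow> T (snd V k x) = snd W k (T x)"
    using iso unfolding rep_iso_def by auto
  define S where "S = inv_into (carrier (fst V)) T"
  have S: "S y \<in> carrier (fst V)" "T (S y) = y" if "y \<in> carrier (fst W)" for y
    using T(1) that unfolding S_def bij_betw_def by (auto intro: inv_into_into f_inv_into_f)
  have ST: "S (T x) = x" if "x \<in> carrier (fst V)" for x
    using T(1) that unfolding S_def by (simp add: bij_betw_inv_into_left)
  have T0: "T x \<in> carrier (fst W)" if "x \<in> carrier (fst V)" for x
    using T(1) that by (auto dest: bij_betwE)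
  note mem = PiE_mem[where S = "carrier K" and T = "\<lambda>_. carrier (fst V)"]
    and arb = PiE_arb[where S = "carrier K" and T = "\<lambda>_. carrier (fst V)"]
  note mem' = PiE_mem[where S = "carrier K" and T = "\<lambda>_. carrier (fst W)"]
    and arb' = PiE_arb[where S = "carrier K" and T = "\<lambda>_. carrier (fst W)"]
  have SH: "S (snd W h y) = snd V h (S y)" if "h \<in> H" "y \<in> carrier (fst W)" for h y
    using T(4)[OF that(1) S(1)[OF that(2)]] S(2)[OF that(2)] ST[OF V(7)[OF that(1) S(1)[OF that(2)]]] by simp
  define U where "U f = (\<lambda>k\<in>carrier K. T (f k))" for f
  have "bij_betw U (carrier (fst (ind_rep K H V))) (carrier (fst (ind_rep K H W)))"
  proof (rule bij_betw_byWitness[where f' = "\<lambda>f. \<lambda>k\<in>carrier K. S (f k)"])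
    show "\<forall>f\<in>carrier (fst (ind_rep K H V)). (\<lambda>k\<in>carrier K. S (U f k)) = f"
      by (auto simp: U_def ST mem arb fun_eq_iff restrict_def)
    show "\<forall>f\<in>carrier (fst (ind_rep K H W)). U (\<lambda>k\<in>carrier K. S (f k)) = f"
      by (auto simp: U_def S mem' arb' fun_eq_iff restrict_def)
    show "U ` carrier (fst (ind_rep K H V)) \<subseteq> carrier (fst (ind_rep K H W))"
      by (auto simp: U_def T(4) mem HK T0)
    show "(\<lambda>f. \<lambda>k\<in>carrier K. S (f k)) ` carrier (fst (ind_rep K H W)) \<subseteq> carrier (fst (ind_rep K H V))"
      by (auto simp: S(1) mem' HK SH)
  qed
  then show ?thesis
    unfolding rep_iso_def
    by (intro exI[of _ U]) (auto simp: U_def T(2,3) mem intro!: restrict_ext)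
qed

text \<open>A function in the induced space is determined by its values on the finite group. Listing
  the group by r and writing the coordinates of all values one after another embeds the space into
  sequences supported below card K times the degree of A.\<close>

lemma ex_mrep_ind_rep:
  assumes K: "group K" and H: "subgroup H K" and fin: "finite (carrier K)"
    and A: "A \<in> matrix_reps (K\<lparr>carrier := H\<rparr>)"
  shows "\<exists>A'\<in>matrix_reps K. rep_iso K (ind_rep K H (rep_of_mrep A)) (rep_of_mrep A')"
proof -
  interpret group K by (rule K)
  obtain r where r: "bij_betw r {..<card (carrier K)} (carrier K)"
    using ex_bij_betw_nat_finite[OF fin] by (auto simp: atLeast0LessThan)
  let ?n = "fst A" and ?N = "card (carrier K) * fst A"
  define T where "T f i = (if i < ?N then vec_index (f (r (i div ?n))) (i mod ?n) else 0)"
    for f :: "'a \<Rightarrow> complex Matrix.vec" and i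
  have rK: "r (i div ?n) \<in> carrier K" "i mod ?n < ?n" if "i < ?N" for i
    using bij_betwE[OF r] div_mod_less_mult[OF that] by auto
  show ?thesis
  proof (rule ex_mrep_of_embedding[where T = T and N = ?N])
    show "inj_on T (carrier (fst (ind_rep K H (rep_of_mrep A))))"
    proof
      fix f g assume f: "f \<in> carrier (fst (ind_rep K H (rep_of_mrep A)))"
        and g: "g \<in> carrier (fst (ind_rep K H (rep_of_mrep A)))" and eq: "T f = T g"
      show "f = g"
      proof (rule ind_rep_eqI[OF f g])
        fix k assume k: "k \<in> carrier K"
        then have "k \<in> r ` {..<card (carrier K)}" using r by (simp add: bij_betw_def)
        then obtain i where i: "i < card (carrier K)" "r i = k" by blast
        have fg: "f k \<in> carrier_vec ?n" "g k \<in> carrier_vec ?n"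
          using f g k by (auto simp: PiE_mem)
        show "f k = g k"
        proof
          fix j assume "j < dim_vec (g k)"
          then have j: "j < ?n" using fg by simp
          have "i * ?n + j < Suc i * ?n" using j by simp
          also have "\<dots> \<le> ?N" using i by (intro mult_le_mono1) simp
          finally have "T f (i * ?n + j) = vec_index (f k) j" "T g (i * ?n + j) = vec_index (g k) j"
            using i j by (auto simp: T_def)
          then show "vec_index (f k) j = vec_index (g k) j" using eq by simp
        qed (use fg in simp)
      qed
    qed
    fix x y assume "x \<in> carrier (fst (ind_rep K H (rep_of_mrep A)))" "y \<in> carrier (fst (ind_rep K H (rep_of_mrep A)))"
    then have "x k \<in> carrier_vec ?n" "y k \<in> carrier_vec ?n" if "k \<in> carrier K" for k
      using that by (auto simp: PiE_mem)
    then have "dim_vec (x k) = ?n" "dim_vec (y k) = ?n" if "k \<in> carrier K" for k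
      using that by (simp_all add: carrier_vecD)
    then show "T (x \<oplus>\<^bsub>fst (ind_rep K H (rep_of_mrep A))\<^esub> y) = (\<lambda>i. T x i + T y i)"
      using rK by (auto simp: T_def fun_eq_iff)
  next
    fix c x assume "x \<in> carrier (fst (ind_rep K H (rep_of_mrep A)))"
    then have "x k \<in> carrier_vec ?n" if "k \<in> carrier K" for k
      using that by (auto simp: PiE_mem)
    then have "dim_vec (x k) = ?n" if "k \<in> carrier K" for k
      using that by (simp add: carrier_vecD)
    then show "T (c \<odot>\<^bsub>fst (ind_rep K H (rep_of_mrep A))\<^esub> x) = (\<lambda>i. c * T x i)"
      using rK by (auto simp: T_def fun_eq_iff)
  qed (use K H A in \<open>auto simp: T_def intro: lin_rep_ind_rep lin_rep_rep_of_mrep\<close>)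
qed

lemma mrep_sum_append:
  assumes A: "A \<in> matrix_reps K" and B: "B \<in> matrix_reps K" and k: "k \<in> carrier K"
    and u: "u \<in> carrier_vec (fst A)" and w: "w \<in> carrier_vec (fst B)"
  shows "snd (mrep_sum A B) k *\<^sub>v (u @\<^sub>v w) = (snd A k *\<^sub>v u) @\<^sub>v (snd B k *\<^sub>v w)"
proof -
  note Ak = matrix_repsD(1)[OF A k] and Bk = matrix_repsD(1)[OF B k]
  have "snd (mrep_sum A B) k *\<^sub>v (u @\<^sub>v w) = (snd A k *\<^sub>v u + 0\<^sub>m (fst A) (fst B) *\<^sub>v w) @\<^sub>v
    (0\<^sub>m (fst B) (fst A) *\<^sub>v u + snd B k *\<^sub>v w)"
    unfolding mrep_sum_simps by (rule four_block_mat_mult_vec) (use Ak Bk u w in auto)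
  also have "0\<^sub>m (fst A) (fst B) *\<^sub>v w = 0\<^sub>v (fst A)" using w by auto
  also have "0\<^sub>m (fst B) (fst A) *\<^sub>v u = 0\<^sub>v (fst B)" using u by auto
  finally show ?thesis using mult_mat_vec_carrier[OF Ak u] mult_mat_vec_carrier[OF Bk w] by simp
qed

text \<open>Induction is additive: an equivariant function into a direct sum is a pair of
  equivariant functions. This is what lets induction descend to virtual representations.\<close>

lemma rep_iso_ind_rep_sum:
  assumes K: "group K" and H: "subgroup H K"
    and A: "A \<in> matrix_reps (K\<lparr>carrier := H\<rparr>)" and B: "B \<in> matrix_reps (K\<lparr>carrier := H\<rparr>)"
    and A': "A' \<in> matrix_reps K" and B': "B' \<in> matrix_reps K"
    and isoA: "rep_iso K (ind_rep K H (rep_of_mrep A)) (rep_of_mrep A')"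
    and isoB: "rep_iso K (ind_rep K H (rep_of_mrep B)) (rep_of_mrep B')"
  shows "rep_iso K (ind_rep K H (rep_of_mrep (mrep_sum A B))) (rep_of_mrep (mrep_sum A' B'))"
proof -
  interpret group K by (rule K)
  note HK = subgroup.mem_carrier[OF H]
  let ?IA = "ind_rep K H (rep_of_mrep A)" and ?IB = "ind_rep K H (rep_of_mrep B)"
    and ?I = "ind_rep K H (rep_of_mrep (mrep_sum A B))"
  obtain S where S: "bij_betw S (carrier (fst ?IA)) (carrier_vec (fst A'))"
    "\<And>x y. x \<in> carrier (fst ?IA) \<Longrightarrow> y \<in> carrier (fst ?IA) \<Longrightarrow> S (x \<oplus>\<^bsub>fst ?IA\<^esub> y) = S x + S y"
    "\<And>c x. x \<in> carrier (fst ?IA) \<Longrightarrow> S (c \<odot>\<^bsub>fst ?IA\<^esub> x) = c \<cdot>\<^sub>v S x"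
    "\<And>k x. k \<in> carrier K \<Longrightarrow> x \<in> carrier (fst ?IA) \<Longrightarrow> S (snd ?IA k x) = snd A' k *\<^sub>v S x"
    using isoA unfolding rep_iso_def[of _ ?IA] rep_of_mrep_simps by blast
  obtain T where T: "bij_betw T (carrier (fst ?IB)) (carrier_vec (fst B'))"
    "\<And>x y. x \<in> carrier (fst ?IB) \<Longrightarrow> y \<in> carrier (fst ?IB) \<Longrightarrow> T (x \<oplus>\<^bsub>fst ?IB\<^esub> y) = T x + T y"
    "\<And>c x. x \<in> carrier (fst ?IB) \<Longrightarrow> T (c \<odot>\<^bsub>fst ?IB\<^esub> x) = c \<cdot>\<^sub>v T x"
    "\<And>k x. k \<in> carrier K \<Longrightarrow> x \<in> carrier (fst ?IB) \<Longrightarrow> T (snd ?IB k x) = snd B' k *\<^sub>v T x"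
    using isoB unfolding rep_iso_def[of _ ?IB] rep_of_mrep_simps by blast
  have Sc: "S x \<in> carrier_vec (fst A')" if "x \<in> carrier (fst ?IA)" for x
    using bij_betwE[OF S(1)] that by blast
  have Tc: "T x \<in> carrier_vec (fst B')" if "x \<in> carrier (fst ?IB)" for x
    using bij_betwE[OF T(1)] that by blast
  define p where "p f = (\<lambda>k\<in>carrier K. vec_first (f k) (fst A))" for f :: "'a \<Rightarrow> complex Matrix.vec"
  define q where "q f = (\<lambda>k\<in>carrier K. vec_last (f k) (fst B))" for f :: "'a \<Rightarrow> complex Matrix.vec"
  define j where "j u w = (\<lambda>k\<in>carrier K. u k @\<^sub>v w k)" for u w :: "'a \<Rightarrow> complex Matrix.vec"
  have first: "vec_first (u @\<^sub>v w) (fst A) = u" "vec_last (u @\<^sub>v w) (fst B) = w"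
    if "u \<in> carrier_vec (fst A)" "w \<in> carrier_vec (fst B)" for u w :: "complex Matrix.vec"
    using that by (auto simp: vec_first_def vec_last_def)
  have act: "snd (mrep_sum A B) h *\<^sub>v (u @\<^sub>v w) = (snd A h *\<^sub>v u) @\<^sub>v (snd B h *\<^sub>v w)"
    if "h \<in> H" "u \<in> carrier_vec (fst A)" "w \<in> carrier_vec (fst B)" for h u w
    using mrep_sum_append[OF A B] that by simp
  have Acl: "snd A h *\<^sub>v u \<in> carrier_vec (fst A)" if "h \<in> H" "u \<in> carrier_vec (fst A)" for h u
    using matrix_repsD(1)[OF A, of h] that by auto
  have Bcl: "snd B h *\<^sub>v u \<in> carrier_vec (fst B)" if "h \<in> H" "u \<in> carrier_vec (fst B)" for h u
    using matrix_repsD(1)[OF B, of h] that by auto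
  have j: "j u w \<in> carrier (fst ?I)" "p (j u w) = u" "q (j u w) = w"
    if u: "u \<in> carrier (fst ?IA)" and w: "w \<in> carrier (fst ?IB)" for u w
  proof -
    have uw: "u k \<in> carrier_vec (fst A)" "w k \<in> carrier_vec (fst B)" if "k \<in> carrier K" for k
      using u w that by (auto simp: PiE_mem)
    show "j u w \<in> carrier (fst ?I)"
      using u w uw by (auto simp: j_def act HK simp del: mrep_sum_simps(2))
    show "p (j u w) = u"
      using u uw by (auto simp: p_def j_def first intro!: PiE_ext[of _ "carrier K" "\<lambda>_. carrier_vec (fst A)"])
    show "q (j u w) = w"
      using w uw by (auto simp: q_def j_def first intro!: PiE_ext[of _ "carrier K" "\<lambda>_. carrier_vec (fst B)"])
  qed
  have pq: "p f \<in> carrier (fst ?IA)" "q f \<in> carrier (fst ?IB)" "j (p f) (q f) = f"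
    if f: "f \<in> carrier (fst ?I)" for f
  proof -
    have fk: "f k \<in> carrier_vec (fst A + fst B)" if "k \<in> carrier K" for k
      using f that by (auto simp: PiE_mem)
    have fh: "f (h \<otimes>\<^bsub>K\<^esub> k) = (snd A h *\<^sub>v vec_first (f k) (fst A)) @\<^sub>v (snd B h *\<^sub>v vec_last (f k) (fst B))"
      if "k \<in> carrier K" "h \<in> H" for h k
    proof -
      have "f (h \<otimes>\<^bsub>K\<^esub> k) = snd (mrep_sum A B) h *\<^sub>v f k" using f that by simp
      also have "f k = vec_first (f k) (fst A) @\<^sub>v vec_last (f k) (fst B)"
        by (rule vec_first_last_append[OF fk[OF that(1)], symmetric])
      also have "snd (mrep_sum A B) h *\<^sub>v \<dots> = (snd A h *\<^sub>v vec_first (f k) (fst A)) @\<^sub>v (snd B h *\<^sub>v vec_last (f k) (fst B))"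
        by (rule act) (use that in auto)
      finally show ?thesis .
    qed
    show "p f \<in> carrier (fst ?IA)"
      by (auto simp: p_def fh HK first Acl Bcl)
    show "q f \<in> carrier (fst ?IB)"
      by (auto simp: q_def fh HK first Acl Bcl)
    show "j (p f) (q f) = f"
      using f fk by (auto simp: p_def q_def j_def intro!: PiE_ext[of _ "carrier K" "\<lambda>_. carrier_vec (fst A + fst B)"])
  qed
  define U where "U f = S (p f) @\<^sub>v T (q f)" for f
  have "bij_betw U (carrier (fst ?I)) (carrier_vec (fst A' + fst B'))"
    unfolding bij_betw_def
  proof
    show "inj_on U (carrier (fst ?I))"
    proof
      fix f g assume f: "f \<in> carrier (fst ?I)" and g: "g \<in> carrier (fst ?I)" and eq: "U f = U g"
      then have "S (p f) = S (p g)" "T (q f) = T (q g)"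
        using append_vec_eq[OF Sc Sc, OF pq(1)[OF f] pq(1)[OF g]] by (auto simp: U_def)
      then have "p f = p g" "q f = q g"
        using inj_onD[OF bij_betw_imp_inj_on[OF S(1)] _ pq(1)[OF f] pq(1)[OF g]]
          inj_onD[OF bij_betw_imp_inj_on[OF T(1)] _ pq(2)[OF f] pq(2)[OF g]] by blast+
      then have "j (p f) (q f) = j (p g) (q g)" by (simp only:)
      then show "f = g" unfolding pq(3)[OF f] pq(3)[OF g] .
    qed
    show "U ` carrier (fst ?I) = carrier_vec (fst A' + fst B')"
    proof (intro equalityI subsetI)
      fix v assume "v \<in> U ` carrier (fst ?I)"
      then show "v \<in> carrier_vec (fst A' + fst B')" using Sc[OF pq(1)] Tc[OF pq(2)] unfolding U_def by blast
    next
      fix v :: "complex Matrix.vec" assume v: "v \<in> carrier_vec (fst A' + fst B')"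
      have "vec_first v (fst A') \<in> S ` carrier (fst ?IA)" "vec_last v (fst B') \<in> T ` carrier (fst ?IB)"
        unfolding bij_betw_imp_surj_on[OF S(1)] bij_betw_imp_surj_on[OF T(1)] by simp_all
      then obtain u w where u: "u \<in> carrier (fst ?IA)" "S u = vec_first v (fst A')"
        and w: "w \<in> carrier (fst ?IB)" "T w = vec_last v (fst B')" by (elim imageE) (rule that, simp_all only:)
      have "U (j u w) = v" using v by (simp add: U_def j[OF u(1) w(1)] u(2) w(2))
      then show "v \<in> U ` carrier (fst ?I)" using j(1)[OF u(1) w(1)] by blast
    qed
  qed
  moreover have "U (f \<oplus>\<^bsub>fst ?I\<^esub> g) = U f + U g" if f: "f \<in> carrier (fst ?I)" and g: "g \<in> carrier (fst ?I)" for f g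
  proof -
    have fk: "f k \<in> carrier_vec (fst A + fst B)" "g k \<in> carrier_vec (fst A + fst B)" if "k \<in> carrier K" for k
      using f g that by (auto simp: PiE_mem)
    have "p (f \<oplus>\<^bsub>fst ?I\<^esub> g) = p f \<oplus>\<^bsub>fst ?IA\<^esub> p g" "q (f \<oplus>\<^bsub>fst ?I\<^esub> g) = q f \<oplus>\<^bsub>fst ?IB\<^esub> q g"
      using carrier_vecD[OF fk(1)] carrier_vecD[OF fk(2)]
      by (auto simp: p_def q_def vec_first_def vec_last_def fun_eq_iff intro!: eq_vecI)
    then show ?thesis
      using append_vec_add[OF Sc Sc Tc Tc, OF pq(1)[OF f] pq(1)[OF g] pq(2)[OF f] pq(2)[OF g]]
      unfolding U_def by (simp only: S(2)[OF pq(1)[OF f] pq(1)[OF g]] T(2)[OF pq(2)[OF f] pq(2)[OF g]])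
  qed
  moreover have "U (c \<odot>\<^bsub>fst ?I\<^esub> f) = c \<cdot>\<^sub>v U f" if f: "f \<in> carrier (fst ?I)" for c f
  proof -
    have fk: "f k \<in> carrier_vec (fst A + fst B)" if "k \<in> carrier K" for k
      using f that by (auto simp: PiE_mem)
    have "p (c \<odot>\<^bsub>fst ?I\<^esub> f) = c \<odot>\<^bsub>fst ?IA\<^esub> p f" "q (c \<odot>\<^bsub>fst ?I\<^esub> f) = c \<odot>\<^bsub>fst ?IB\<^esub> q f"
      using carrier_vecD[OF fk]
      by (auto simp: p_def q_def vec_first_def vec_last_def fun_eq_iff intro!: eq_vecI)
    moreover have "c \<cdot>\<^sub>v (S (p f) @\<^sub>v T (q f)) = (c \<cdot>\<^sub>v S (p f)) @\<^sub>v (c \<cdot>\<^sub>v T (q f))"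
      by (rule eq_vecI) auto
    ultimately show ?thesis
      unfolding U_def by (simp only: S(3)[OF pq(1)[OF f]] T(3)[OF pq(2)[OF f]])
  qed
  moreover have "U (snd ?I k f) = snd (mrep_sum A' B') k *\<^sub>v U f"
    if k: "k \<in> carrier K" and f: "f \<in> carrier (fst ?I)" for k f
  proof -
    have "p (snd ?I k f) = snd ?IA k (p f)" "q (snd ?I k f) = snd ?IB k (q f)"
      using k by (auto simp: p_def q_def)
    then show ?thesis
      using mrep_sum_append[OF A' B' k Sc Tc, OF pq(1)[OF f] pq(2)[OF f]]
      unfolding U_def by (simp only: S(4)[OF k pq(1)[OF f]] T(4)[OF k pq(2)[OF f]])
  qed
  ultimately show ?thesis
    unfolding rep_iso_def[of _ ?I] rep_of_mrep_simps mrep_sum_simps(1)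
    by (intro exI[of _ U] conjI ballI allI) blast+
qed

section \<open>Restriction and induction of virtual classes\<close>

lemma matrix_reps_subgroup:
  assumes "subgroup H K" and "A \<in> matrix_reps K"
  shows "A \<in> matrix_reps (K\<lparr>carrier := H\<rparr>)"
  using assms(2) subgroup.mem_carrier[OF assms(1)] by (auto simp: matrix_reps_def)

lemma rep_iso_subgroup:
  assumes "subgroup H K" and "rep_iso K V W"
  shows "rep_iso (K\<lparr>carrier := H\<rparr>) V W"
proof -
  have "\<forall>k\<in>H. k \<in> carrier K" using subgroup.mem_carrier[OF assms(1)] by blast
  then show ?thesis
    using assms(2) unfolding rep_iso_def by (elim ex_forward) simp
qed

lemma Res_virtual_class:
  assumes H: "subgroup H K" and A: "A \<in> matrix_reps K" and B: "B \<in> matrix_reps K"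
  shows "Res K H (virtual_class K A B) = virtual_class (K\<lparr>carrier := H\<rparr>) A B"
proof -
  have "virtual_class (K\<lparr>carrier := H\<rparr>) A' B' = virtual_class (K\<lparr>carrier := H\<rparr>) A B"
    if "(A', B') \<in> virtual_class K A B" for A' B'
  proof -
    note 1 = virtual_classD[OF that]
    note 2 = matrix_reps_subgroup[OF H]
    have "((A, B), (A', B')) \<in> virtual_rel (K\<lparr>carrier := H\<rparr>)"
      using 1(3) by (auto simp: virtual_rel_def intro: 2 rep_iso_subgroup[OF H])
    then show ?thesis using 1(1,2) A B 2 by (simp flip: virtual_class_eq_iff)
  qed
  then have "Res K H (virtual_class K A B) = (\<Union>x\<in>virtual_class K A B. virtual_class (K\<lparr>carrier := H\<rparr>) A B)"
    unfolding Res_def by (intro SUP_cong refl) (simp add: case_prod_beta)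
  also have "\<dots> = virtual_class (K\<lparr>carrier := H\<rparr>) A B"
    using virtual_class_self[OF A B] by (intro SUP_const) blast
  finally show ?thesis .
qed

lemmas [trans] = rep_iso_trans

text \<open>Independence of all choices: an isomorphism that relates two pairs over the subgroup is
  induced to K, and additivity turns it into an isomorphism relating any matrix models of the
  induced pairs.\<close>

lemma Ind_virtual_class:
  assumes K: "group K" and H: "subgroup H K" and fin: "finite (carrier K)"
    and A: "A \<in> matrix_reps (K\<lparr>carrier := H\<rparr>)" and B: "B \<in> matrix_reps (K\<lparr>carrier := H\<rparr>)"
    and A': "A' \<in> matrix_reps K" and B': "B' \<in> matrix_reps K"
    and isoA: "rep_iso K (ind_rep K H (rep_of_mrep A)) (rep_of_mrep A')"
    and isoB: "rep_iso K (ind_rep K H (rep_of_mrep B)) (rep_of_mrep B')"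
  shows "Ind K H (virtual_class (K\<lparr>carrier := H\<rparr>) A B) = virtual_class K A' B'"
proof -
  let ?L = "K\<lparr>carrier := H\<rparr>"
  have *: "virtual_class K A1' B1' = virtual_class K A' B'"
    if AB: "(A1, B1) \<in> virtual_class ?L A B" and A1': "A1' \<in> matrix_reps K" and B1': "B1' \<in> matrix_reps K"
      and isoA1: "rep_iso K (ind_rep K H (rep_of_mrep A1)) (rep_of_mrep A1')"
      and isoB1: "rep_iso K (ind_rep K H (rep_of_mrep B1)) (rep_of_mrep B1')"
    for A1 B1 A1' B1'
  proof -
    note 1 = virtual_classD(1,2)[OF AB]
    obtain C where C: "C \<in> matrix_reps ?L"
      and isoC: "rep_iso ?L (rep_of_mrep (mrep_sum (mrep_sum A B1) C)) (rep_of_mrep (mrep_sum (mrep_sum A1 B) C))"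
      using virtual_classD(3)[OF AB] unfolding virtual_rel_def by blast
    obtain C' where C': "C' \<in> matrix_reps K" and isoC': "rep_iso K (ind_rep K H (rep_of_mrep C)) (rep_of_mrep C')"
      using ex_mrep_ind_rep[OF K H fin C] by blast
    have l: "rep_iso K (ind_rep K H (rep_of_mrep (mrep_sum (mrep_sum A B1) C))) (rep_of_mrep (mrep_sum (mrep_sum A' B1') C'))"
      by (rule rep_iso_ind_rep_sum[OF K H mrep_sum_closed[OF A 1(2)] C mrep_sum_closed[OF A' B1'] C'
            rep_iso_ind_rep_sum[OF K H A 1(2) A' B1' isoA isoB1] isoC'])
    have r: "rep_iso K (ind_rep K H (rep_of_mrep (mrep_sum (mrep_sum A1 B) C))) (rep_of_mrep (mrep_sum (mrep_sum A1' B') C'))"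
      by (rule rep_iso_ind_rep_sum[OF K H mrep_sum_closed[OF 1(1) B] C mrep_sum_closed[OF A1' B'] C'
            rep_iso_ind_rep_sum[OF K H 1(1) B A1' B' isoA1 isoB] isoC'])
    have lin: "lin_rep ?L (rep_of_mrep (mrep_sum (mrep_sum A B1) C))"
      using A 1 C by (intro lin_rep_rep_of_mrep) auto
    have "rep_iso K (rep_of_mrep (mrep_sum (mrep_sum A' B1') C')) (ind_rep K H (rep_of_mrep (mrep_sum (mrep_sum A B1) C)))"
      by (rule rep_iso_sym[OF lin_rep_ind_rep[OF K H lin] l])
    also note ind_rep_cong[OF K H lin isoC]
    also note r
    finally have "((A', B'), (A1', B1')) \<in> virtual_rel K"
      using A' B' A1' B1' C' by (auto simp: virtual_rel_def)
    then show ?thesis using A' B' A1' B1' by (simp flip: virtual_class_eq_iff)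
  qed
  show ?thesis
  proof (intro equalityI subsetI)
    fix x assume "x \<in> Ind K H (virtual_class ?L A B)"
    then show "x \<in> virtual_class K A' B'" unfolding Ind_def using * by blast
  next
    fix x assume "x \<in> virtual_class K A' B'"
    then show "x \<in> Ind K H (virtual_class ?L A B)"
      using virtual_class_self[OF A B] A' B' isoA isoB unfolding Ind_def by blast
  qed
qed

section \<open>Classes of representations on arbitrary spaces\<close>

lemma rep_class_eq:
  assumes V: "lin_rep K V" and A: "A \<in> matrix_reps K" and iso: "rep_iso K V (rep_of_mrep A)"
  shows "rep_class K V = virtual_class K A mrep_zero"
proof -
  have "virtual_class K B mrep_zero = virtual_class K A mrep_zero"
    if "B \<in> matrix_reps K" "rep_iso K V (rep_of_mrep B)" for B
    using that A rep_iso_trans[OF rep_iso_sym[OF V that(2)] iso]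
    by (intro virtual_class_iso) (auto intro: rep_iso_refl)
  then have "rep_class K V = (\<Union>B\<in>{B \<in> matrix_reps K. rep_iso K V (rep_of_mrep B)}. virtual_class K A mrep_zero)"
    unfolding rep_class_def by (intro SUP_cong refl) blast
  also have "\<dots> = virtual_class K A mrep_zero" using A iso by (intro SUP_const) blast
  finally show ?thesis .
qed

text \<open>V sits inside its induced representation as the functions supported on H: v becomes h
  \<mapsto> h v, extended by zero, and evaluation at the identity recovers v. Coordinates of the
  large space thus restrict to coordinates of V.\<close>

lemma ex_mrep_of_ind_rep:
  assumes K: "group K" and H: "subgroup H K" and V: "lin_rep (K\<lparr>carrier := H\<rparr>) V"
    and A: "A \<in> matrix_reps K" and iso: "rep_iso K (ind_rep K H V) (rep_of_mrep A)"
  shows "\<exists>B\<in>matrix_reps (K\<lparr>carrier := H\<rparr>). rep_iso (K\<lparr>carrier := H\<rparr>) V (rep_of_mrep B)"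
proof -
  interpret group K by (rule K)
  interpret H: subgroup H K by (rule H)
  note V' = lin_repD[OF V, simplified]
  obtain S where S: "bij_betw S (carrier (fst (ind_rep K H V))) (carrier_vec (fst A))"
    "\<And>x y. x \<in> carrier (fst (ind_rep K H V)) \<Longrightarrow> y \<in> carrier (fst (ind_rep K H V)) \<Longrightarrow>
      S (x \<oplus>\<^bsub>fst (ind_rep K H V)\<^esub> y) = S x + S y"
    "\<And>c x. x \<in> carrier (fst (ind_rep K H V)) \<Longrightarrow> S (c \<odot>\<^bsub>fst (ind_rep K H V)\<^esub> x) = c \<cdot>\<^sub>v S x"
    using iso unfolding rep_iso_def[of _ "ind_rep K H V"] rep_of_mrep_simps by blast
  have Sc: "S x \<in> carrier_vec (fst A)" if "x \<in> carrier (fst (ind_rep K H V))" for x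
    using bij_betwE[OF S(1)] that by blast
  define j where "j v = (\<lambda>k\<in>carrier K. if k \<in> H then snd V k v else \<zero>\<^bsub>fst V\<^esub>)" for v
  have Hk: "h \<otimes>\<^bsub>K\<^esub> k \<in> H \<longleftrightarrow> k \<in> H" if "h \<in> H" "k \<in> carrier K" for h k
  proof
    assume "h \<otimes>\<^bsub>K\<^esub> k \<in> H"
    then have "inv\<^bsub>K\<^esub> h \<otimes>\<^bsub>K\<^esub> (h \<otimes>\<^bsub>K\<^esub> k) \<in> H" using that by simp
    then show "k \<in> H" using that by (simp flip: m_assoc)
  qed (use that in simp)
  have j: "j v \<in> carrier (fst (ind_rep K H V))" if "v \<in> carrier (fst V)" for v
    using that by (auto simp: j_def V' Hk)
  have jadd: "j (v \<oplus>\<^bsub>fst V\<^esub> w) = j v \<oplus>\<^bsub>fst (ind_rep K H V)\<^esub> j w"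
    if "v \<in> carrier (fst V)" "w \<in> carrier (fst V)" for v w
    using that by (auto simp: j_def V' fun_eq_iff)
  have jsmult: "j (c \<odot>\<^bsub>fst V\<^esub> v) = c \<odot>\<^bsub>fst (ind_rep K H V)\<^esub> j v" if "v \<in> carrier (fst V)" for c v
    using that by (auto simp: j_def V' fun_eq_iff)
  have jinj: "v = w" if "v \<in> carrier (fst V)" "w \<in> carrier (fst V)" "j v = j w" for v w
    using fun_cong[OF that(3), of "\<one>\<^bsub>K\<^esub>"] that(1,2) by (simp add: j_def V')
  have "group (K\<lparr>carrier := H\<rparr>)" by (rule subgroup_imp_group[OF H])
  then show ?thesis
  proof (rule ex_mrep_of_embedding[OF V, where N = "fst A" and
      T = "\<lambda>v i. if i < fst A then vec_index (S (j v)) i else 0"])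
    show "inj_on (\<lambda>v i. if i < fst A then vec_index (S (j v)) i else 0) (carrier (fst V))"
    proof
      fix v w assume v: "v \<in> carrier (fst V)" and w: "w \<in> carrier (fst V)"
        and eq: "(\<lambda>i. if i < fst A then vec_index (S (j v)) i else 0) = (\<lambda>i. if i < fst A then vec_index (S (j w)) i else 0)"
      have "S (j v) = S (j w)"
      proof
        show "dim_vec (S (j v)) = dim_vec (S (j w))" using Sc[OF j[OF v]] Sc[OF j[OF w]] by simp
        show "vec_index (S (j v)) i = vec_index (S (j w)) i" if "i < dim_vec (S (j w))" for i
          using fun_cong[OF eq, of i] that Sc[OF j[OF w]] by simp
      qed
      then have "j v = j w" using inj_onD[OF bij_betw_imp_inj_on[OF S(1)] _ j[OF v] j[OF w]] by blast
      then show "v = w" by (rule jinj[OF v w])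
    qed
    fix v w assume v: "v \<in> carrier (fst V)" and w: "w \<in> carrier (fst V)"
    show "(\<lambda>i. if i < fst A then vec_index (S (j (v \<oplus>\<^bsub>fst V\<^esub> w))) i else 0) =
      (\<lambda>i. (if i < fst A then vec_index (S (j v)) i else 0) + (if i < fst A then vec_index (S (j w)) i else 0))"
      unfolding jadd[OF v w] S(2)[OF j[OF v] j[OF w]] using Sc[OF j[OF w]] by (auto simp: fun_eq_iff)
  next
    fix c v assume v: "v \<in> carrier (fst V)"
    show "(\<lambda>i. if i < fst A then vec_index (S (j (c \<odot>\<^bsub>fst V\<^esub> v))) i else 0) =
      (\<lambda>i. c * (if i < fst A then vec_index (S (j v)) i else 0))"
      unfolding jsmult[OF v] S(3)[OF j[OF v]] using Sc[OF j[OF v]] by (auto simp: fun_eq_iff)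
  qed simp
qed

text \<open>The class of an actual representation has the zero representation as its negative part,
  so inducing it requires this case.\<close>

lemma rep_iso_ind_rep_zero:
  assumes K: "group K" and H: "subgroup H K"
  shows "rep_iso K (ind_rep K H (rep_of_mrep mrep_zero)) (rep_of_mrep mrep_zero)"
proof -
  interpret group K by (rule K)
  have 0: "carrier_vec (fst mrep_zero) = {vNil :: complex Matrix.vec}" by (auto simp: mrep_zero_def)
  have 1: "snd mrep_zero k *\<^sub>v x = vNil" for k :: 'a and x :: "complex Matrix.vec"
    by (auto simp: mrep_zero_def)
  let ?f = "\<lambda>k\<in>carrier K. vNil :: complex Matrix.vec"
  have "carrier (fst (ind_rep K H (rep_of_mrep mrep_zero))) \<subseteq> {?f}"
    unfolding ind_rep_simps rep_of_mrep_simps 0 by (auto intro!: PiE_ext)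
  moreover have "?f \<in> carrier (fst (ind_rep K H (rep_of_mrep mrep_zero)))"
    unfolding ind_rep_simps rep_of_mrep_simps 0 using subgroup.mem_carrier[OF H] by (auto simp: 1)
  ultimately have "carrier (fst (ind_rep K H (rep_of_mrep mrep_zero))) = {?f}" by blast
  then have "bij_betw (\<lambda>_. vNil :: complex Matrix.vec) (carrier (fst (ind_rep K H (rep_of_mrep mrep_zero)))) {vNil}"
    by (simp only:) (simp add: bij_betw_def)
  then show ?thesis
    unfolding rep_iso_def rep_of_mrep_simps 0
    by (intro exI[of _ "\<lambda>_. vNil"]) (auto simp: 1)
qed

theorem rep_class_ind_rep:
  assumes K: "group K" and H: "subgroup H K" and fin: "finite (carrier K)"
    and V: "lin_rep K V" and W: "lin_rep (K\<lparr>carrier := H\<rparr>) W"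
    and iso: "rep_iso K V (ind_rep K H W)"
  shows "rep_class K V = Ind K H (rep_class (K\<lparr>carrier := H\<rparr>) W)"
proof (cases "\<exists>B\<in>matrix_reps (K\<lparr>carrier := H\<rparr>). rep_iso (K\<lparr>carrier := H\<rparr>) W (rep_of_mrep B)")
  case True
  then obtain B where B: "B \<in> matrix_reps (K\<lparr>carrier := H\<rparr>)" "rep_iso (K\<lparr>carrier := H\<rparr>) W (rep_of_mrep B)" by blast
  obtain A where A: "A \<in> matrix_reps K" "rep_iso K (ind_rep K H (rep_of_mrep B)) (rep_of_mrep A)"
    using ex_mrep_ind_rep[OF K H fin B(1)] by blast
  have zero: "mrep_zero \<in> matrix_reps (K\<lparr>carrier := H\<rparr>)" by simp
  have "Ind K H (rep_class (K\<lparr>carrier := H\<rparr>) W) = virtual_class K A mrep_zero"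
    unfolding rep_class_eq[OF W B] by (rule Ind_virtual_class[OF K H fin B(1) zero A(1) mrep_zero_closed A(2) rep_iso_ind_rep_zero[OF K H]])
  moreover have "rep_iso K V (rep_of_mrep A)"
    using rep_iso_trans[OF iso rep_iso_trans[OF ind_rep_cong[OF K H W B(2)] A(2)]] .
  ultimately show ?thesis using rep_class_eq[OF V A(1)] by simp
next
  case False
  \<comment> \<open>A matrix model of V would be one of the representation induced from W, and W
    would inherit coordinates from it. Hence neither side has representatives, and the union in
    \<open>Ind\<close> is empty as well.\<close>
  have "\<not> rep_iso K V (rep_of_mrep A)" if A: "A \<in> matrix_reps K" for A
  proof
    assume "rep_iso K V (rep_of_mrep A)"
    with rep_iso_sym[OF V iso] have "rep_iso K (ind_rep K H W) (rep_of_mrep A)" by (rule rep_iso_trans)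
    from ex_mrep_of_ind_rep[OF K H W A this] False show False by blast
  qed
  then have "rep_class K V = {}" by (auto simp: rep_class_def)
  moreover have "rep_class (K\<lparr>carrier := H\<rparr>) W = {}" using False by (auto simp: rep_class_def)
  ultimately show ?thesis by (simp add: Ind_def)
qed

section \<open>Inducing from the kernel of a linear character\<close>

lemma sum_powers_root_of_unity:
  fixes q :: complex
  assumes "q ^ e = 1"
  shows "(\<Sum>j<e. q ^ j) = (if q = 1 then of_nat e else 0)"
  using assms by (simp add: geometric_sum)

text \<open>Brings the terms of a Fourier sum into the form q^j with q = \<omega>^(i' - i), so that
  the sum over j is geometric.\<close>

lemma inverse_power_mult:
  fixes \<omega> :: complex
  assumes "\<omega> \<noteq> 0"
  shows "inverse (\<omega> ^ i) ^ j * (\<omega> ^ j) ^ i' = (inverse (\<omega> ^ i) * \<omega> ^ i') ^ j"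
  by (simp add: power_mult_distrib power_mult mult.commute flip: power_mult)

text \<open>The diagonal model of 1 + \<theta> + ... + \<theta>^(n - 1). Having this sum as a single
  matrix representation means that only one tensor product has to be compared with the induced
  representation.\<close>

definition mrep_char_powers :: "('k \<Rightarrow> complex) \<Rightarrow> nat \<Rightarrow> 'k mrep" where
  "mrep_char_powers \<theta> n = (n, \<lambda>k. Matrix.mat n n (\<lambda>(i, j). if i = j then \<theta> k ^ i else 0))"

lemma mrep_char_powers_closed:
  assumes "\<theta> \<one>\<^bsub>K\<^esub> = 1"
    and "\<And>k k'. k \<in> carrier K \<Longrightarrow> k' \<in> carrier K \<Longrightarrow> \<theta> (k \<otimes>\<^bsub>K\<^esub> k') = \<theta> k * \<theta> k'"
  shows "mrep_char_powers \<theta> n \<in> matrix_reps K"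
proof (rule matrix_repsI)
  fix k k' assume k: "k \<in> carrier K" "k' \<in> carrier K"
  show "snd (mrep_char_powers \<theta> n) (k \<otimes>\<^bsub>K\<^esub> k') = snd (mrep_char_powers \<theta> n) k * snd (mrep_char_powers \<theta> n) k'"
  proof (rule eq_matI)
    fix i j assume "i < dim_row (snd (mrep_char_powers \<theta> n) k * snd (mrep_char_powers \<theta> n) k')"
      "j < dim_col (snd (mrep_char_powers \<theta> n) k * snd (mrep_char_powers \<theta> n) k')"
    then have ij: "i < n" "j < n" by (auto simp: mrep_char_powers_def)
    have "(snd (mrep_char_powers \<theta> n) k * snd (mrep_char_powers \<theta> n) k') $$ (i, j) =
        (\<Sum>s<n. (if i = s then \<theta> k ^ i else 0) * (if s = j then \<theta> k' ^ s else 0))"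
      using ij by (simp add: mrep_char_powers_def scalar_prod_def atLeast0LessThan)
    also have "\<dots> = (\<Sum>s<n. if s = i then (if i = j then \<theta> k ^ i * \<theta> k' ^ i else 0) else 0)"
      by (intro sum.cong refl) auto
    also have "\<dots> = (if i = j then \<theta> k ^ i * \<theta> k' ^ i else 0)"
      using ij by simp
    finally show "snd (mrep_char_powers \<theta> n) (k \<otimes>\<^bsub>K\<^esub> k') $$ (i, j) =
        (snd (mrep_char_powers \<theta> n) k * snd (mrep_char_powers \<theta> n) k') $$ (i, j)"
      using ij k by (simp add: mrep_char_powers_def assms power_mult_distrib)
  qed (auto simp: mrep_char_powers_def)
qed (auto simp: mrep_char_powers_def assms one_mat_def)

lemma mrep_char_closed:
  assumes "\<theta> \<one>\<^bsub>K\<^esub> = 1"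
    and "\<And>k k'. k \<in> carrier K \<Longrightarrow> k' \<in> carrier K \<Longrightarrow> \<theta> (k \<otimes>\<^bsub>K\<^esub> k') = \<theta> k * \<theta> k'"
  shows "mrep_char \<theta> \<in> matrix_reps K"
  by (rule matrix_repsI) (auto simp: mrep_char_def assms scalar_prod_def)

lemma mrep_char_powers_Suc:
  "mrep_char_powers \<theta> (Suc n) = mrep_sum (mrep_char_powers \<theta> n) (mrep_char (\<lambda>k. \<theta> k ^ n))"
proof (rule prod_eqI)
  show "snd (mrep_char_powers \<theta> (Suc n)) = snd (mrep_sum (mrep_char_powers \<theta> n) (mrep_char (\<lambda>k. \<theta> k ^ n)))"
    by (rule ext, rule eq_matI) (auto simp: mrep_char_powers_def mrep_char_def less_Suc_eq)
qed (simp add: mrep_char_powers_def mrep_char_def)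

lemma finsum_mrep_char_powers:
  assumes one: "\<theta> \<one>\<^bsub>K\<^esub> = 1"
    and mult: "\<And>k k'. k \<in> carrier K \<Longrightarrow> k' \<in> carrier K \<Longrightarrow> \<theta> (k \<otimes>\<^bsub>K\<^esub> k') = \<theta> k * \<theta> k'"
  shows "(\<Oplus>\<^bsub>Rep_ring K\<^esub> i\<in>{..<n}. virtual_class K (mrep_char (\<lambda>k. \<theta> k ^ i)) mrep_zero) =
    virtual_class K (mrep_char_powers \<theta> n) mrep_zero"
proof (induction n)
  interpret R: abelian_monoid "Rep_ring K" by (rule abelian_monoid_Rep_ring)
  case 0
  have "rep_iso K (rep_of_mrep (mrep_char_powers \<theta> 0)) (rep_of_mrep mrep_zero)"
  proof (rule rep_iso_reindex[where \<sigma> = id])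
    show "mrep_char_powers \<theta> 0 \<in> matrix_reps K" by (rule mrep_char_powers_closed[OF assms])
    show "bij_betw id {..<fst (mrep_zero :: 'a mrep)} {..<fst (mrep_char_powers \<theta> 0)}"
      by (simp add: mrep_zero_def mrep_char_powers_def)
  qed (auto simp: mrep_zero_def[THEN arg_cong, of fst])
  then have "virtual_class K (mrep_char_powers \<theta> 0) mrep_zero = virtual_class K mrep_zero mrep_zero"
    by (intro virtual_class_iso mrep_char_powers_closed assms) (auto intro: rep_iso_refl)
  moreover have "\<zero>\<^bsub>Rep_ring K\<^esub> = virtual_class K mrep_zero mrep_zero" by (simp add: Rep_ring_def)
  ultimately show ?case by simp
next
  interpret R: abelian_monoid "Rep_ring K" by (rule abelian_monoid_Rep_ring)
  case (Suc n)
  have c: "mrep_char (\<lambda>k. \<theta> k ^ i) \<in> matrix_reps K" for i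
    by (rule mrep_char_closed) (simp_all add: assms power_mult_distrib)
  have p: "mrep_char_powers \<theta> n \<in> matrix_reps K" by (rule mrep_char_powers_closed[OF assms])
  have cl: "virtual_class K (mrep_char (\<lambda>k. \<theta> k ^ i)) mrep_zero \<in> carrier (Rep_ring K)" for i
    unfolding Rep_ring_carrier using c by blast
  have pl: "virtual_class K (mrep_char_powers \<theta> n) mrep_zero \<in> carrier (Rep_ring K)"
    unfolding Rep_ring_carrier using p by blast
  have "(\<Oplus>\<^bsub>Rep_ring K\<^esub> i\<in>{..<Suc n}. virtual_class K (mrep_char (\<lambda>k. \<theta> k ^ i)) mrep_zero) =
     virtual_class K (mrep_char (\<lambda>k. \<theta> k ^ n)) mrep_zero \<oplus>\<^bsub>Rep_ring K\<^esub> virtual_class K (mrep_char_powers \<theta> n) mrep_zero"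
    using cl unfolding lessThan_Suc by (subst R.finsum_insert) (auto simp: Suc.IH)
  also have "\<dots> = virtual_class K (mrep_char_powers \<theta> n) mrep_zero \<oplus>\<^bsub>Rep_ring K\<^esub> virtual_class K (mrep_char (\<lambda>k. \<theta> k ^ n)) mrep_zero"
    using cl pl by (rule R.a_comm)
  also have "\<dots> = virtual_class K (mrep_char_powers \<theta> (Suc n)) (mrep_sum mrep_zero mrep_zero)"
    by (simp add: Rep_ring_add p c mrep_char_powers_Suc)
  also have "\<dots> = virtual_class K (mrep_char_powers \<theta> (Suc n)) mrep_zero"
    by (rule virtual_class_iso) (auto simp: mrep_char_powers_closed[OF assms] mrep_sum_zero intro: rep_iso_refl)
  finally show ?case .
qed

text \<open>The isomorphism of the projection formula is the discrete Fourier transform on the cosets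
  of the kernel of \<open>\<theta>\<close>.\<close>

theorem rep_iso_tensor_char_powers:
  fixes \<theta> :: "'k \<Rightarrow> complex"
  assumes K: "group K"
    and mult: "\<And>k k'. k \<in> carrier K \<Longrightarrow> k' \<in> carrier K \<Longrightarrow> \<theta> (k \<otimes>\<^bsub>K\<^esub> k') = \<theta> k * \<theta> k'"
    and root: "\<And>k. k \<in> carrier K \<Longrightarrow> \<theta> k ^ e = 1"
    and surj: "\<And>z. z ^ e = 1 \<Longrightarrow> \<exists>k\<in>carrier K. \<theta> k = z"
    and e: "e > 0" and A: "A \<in> matrix_reps K"
  defines "H \<equiv> {k \<in> carrier K. \<theta> k = 1}"
  shows "rep_iso K (rep_of_mrep (mrep_tensor (mrep_char_powers \<theta> e) A)) (ind_rep K H (rep_of_mrep A))"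
proof -
  interpret group K by (rule K)
  note AD = matrix_repsD[OF A]
  let ?n = "fst A"
  have \<theta>0: "\<theta> k \<noteq> 0" if "k \<in> carrier K" for k
    using root[OF that] e by (metis power_0_left zero_neq_one not_gr_zero)
  have \<theta>1: "\<theta> \<one>\<^bsub>K\<^esub> = 1" using mult[of "\<one>\<^bsub>K\<^esub>" "\<one>\<^bsub>K\<^esub>"] \<theta>0[of "\<one>\<^bsub>K\<^esub>"] by simp
  have HK: "h \<in> carrier K" "\<theta> h = 1" if "h \<in> H" for h using that by (auto simp: H_def)
  \<comment> \<open>A primitive e-th root of unity, whose powers with exponents below e list all
    values of \<theta>.\<close>
  define \<omega> where "\<omega> = cis (2 * pi / of_nat e)"
  have \<omega>: "\<omega> ^ j = cis (2 * pi * of_nat j / of_nat e)" for j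
    unfolding \<omega>_def by (simp add: Complex.DeMoivre mult_ac)
  have bij: "bij_betw (\<lambda>j. \<omega> ^ j) {..<e} {z. z ^ e = 1}"
    using Complex.bij_betw_roots_unity[OF e] by (simp add: \<omega>)
  have \<omega>e: "(\<omega> ^ j) ^ e = 1" for j
  proof -
    have "\<omega> ^ e = 1" using e by (simp add: \<omega>)
    then show ?thesis by (metis power_commutes power_mult mult.commute power_one)
  qed
  have \<omega>0: "\<omega> \<noteq> 0" by (simp add: \<omega>_def)
  obtain k0 where k0: "k0 \<in> carrier K" "\<theta> k0 = \<omega>" using surj[of \<omega>] \<omega>e[of 1] by auto
  \<comment> \<open>Powers of one element with \<theta>-value \<omega>: they represent the e cosets
    of the kernel.\<close>
  define r where "r j = k0 [^]\<^bsub>K\<^esub> j" for j :: nat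
  have r: "r j \<in> carrier K" "\<theta> (r j) = \<omega> ^ j" for j
    unfolding r_def using k0 by (simp, induction j) (simp_all add: \<theta>1 mult)
  have root_power: "\<exists>j<e. \<theta> k = \<omega> ^ j" if "k \<in> carrier K" for k
    using bij root[OF that] unfolding bij_betw_def by (metis (mono_tags, lifting) imageE lessThan_iff mem_Collect_eq)
  \<comment> \<open>Orthogonality of the characters of a cyclic group of order e, the two halves of
    Fourier inversion being \<open>orth\<close> and \<open>orth'\<close>.\<close>
  have orth: "(\<Sum>j<e. inverse (\<omega> ^ i) ^ j * (\<omega> ^ j) ^ i') = (if i = i' then of_nat e else 0)" if "i < e" "i' < e" for i i'
  proof -
    let ?q = "inverse (\<omega> ^ i) * \<omega> ^ i'"
    have "?q ^ e = 1" by (simp add: power_mult_distrib power_inverse \<omega>e)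
    moreover have "?q = 1 \<longleftrightarrow> i = i'"
      using \<omega>0 inj_onD[OF bij_betw_imp_inj_on[OF bij], of i i'] that by (auto simp: field_simps)
    ultimately show ?thesis
      using sum_powers_root_of_unity[of ?q e] by (simp add: inverse_power_mult[OF \<omega>0])
  qed
  have orth': "(\<Sum>i<e. (\<omega> ^ l) ^ i * inverse (\<omega> ^ i) ^ j) = (if j = l then of_nat e else 0)" if "j < e" "l < e" for j l
    using orth[OF that] by (simp add: mult.commute power_inverse flip: power_mult)
  \<comment> \<open>A vector v of length e * n consists of e blocks of length n, one for each power
    of \<theta>. \<open>comb z v\<close> evaluates at z the polynomial with these blocks as
    coefficients.\<close>
  define comb where "comb z v = Matrix.vec ?n (\<lambda>a. \<Sum>i<e. z ^ i * vec_index v (i * ?n + a))" for z :: complex and v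
  \<comment> \<open>For h in the kernel \<theta> (h k) = \<theta> k, so the vector
    \<open>comb (\<theta> k) v\<close> is unchanged and only the matrix of h comes out in front: T v
    is equivariant.\<close>
  define T where "T v = (\<lambda>k\<in>carrier K. snd A k *\<^sub>v comb (\<theta> k) v)" for v
  \<comment> \<open>The inverse transform: the values at the coset representatives are first freed
    from the matrix of \<open>r j\<close>, which leaves samples of the polynomial at \<omega>^j, and
    its coefficient blocks are then recovered with the factor 1 / e.\<close>
  define S where "S f = Matrix.vec (e * ?n) (\<lambda>s. 1 / of_nat e *
    (\<Sum>j<e. inverse (\<omega> ^ (s div ?n)) ^ j * vec_index (snd A (inv\<^bsub>K\<^esub> (r j)) *\<^sub>v f (r j)) (s mod ?n)))"
    for f :: "'k \<Rightarrow> complex Matrix.vec"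
  have comb: "comb z v \<in> carrier_vec ?n" for z v by (simp add: comb_def)
  have inv1: "snd A (inv\<^bsub>K\<^esub> k) *\<^sub>v (snd A k *\<^sub>v v) = v" if k: "k \<in> carrier K" and v: "v \<in> carrier_vec ?n" for k v
  proof -
    have "snd A (inv\<^bsub>K\<^esub> k) *\<^sub>v (snd A k *\<^sub>v v) = snd A (inv\<^bsub>K\<^esub> k \<otimes>\<^bsub>K\<^esub> k) *\<^sub>v v"
      by (subst AD(3)) (use k v in \<open>simp_all add: assoc_mult_mat_vec[OF AD(1) AD(1)]\<close>)
    then show ?thesis using k v by (simp add: AD(2))
  qed
  have idx: "i * ?n + a < e * ?n" if "i < e" "a < ?n" for i a
  proof -
    have "i * ?n + a < Suc i * ?n" using that by simp
    also have "\<dots> \<le> e * ?n" using that by (intro mult_le_mono1) simp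
    finally show ?thesis .
  qed
  have Tc: "T v \<in> carrier (fst (ind_rep K H (rep_of_mrep A)))" for v
  proof -
    have "snd A k *\<^sub>v comb (\<theta> k) v \<in> carrier_vec ?n" if "k \<in> carrier K" for k
      using mult_mat_vec_carrier[OF AD(1)[OF that] comb] .
    moreover have "snd A (h \<otimes>\<^bsub>K\<^esub> k) *\<^sub>v comb (\<theta> (h \<otimes>\<^bsub>K\<^esub> k)) v = snd A h *\<^sub>v (snd A k *\<^sub>v comb (\<theta> k) v)"
      if "h \<in> H" "k \<in> carrier K" for h k
      using that HK[OF that(1)] by (simp add: mult AD(3) assoc_mult_mat_vec[OF AD(1) AD(1) comb])
    ultimately show ?thesis using HK by (auto simp: T_def)
  qed
  have TS: "T (S f) = f" if f: "f \<in> carrier (fst (ind_rep K H (rep_of_mrep A)))" for f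
  proof (rule ind_rep_eqI[OF Tc f])
    fix k assume k: "k \<in> carrier K"
    obtain l where l: "l < e" "\<theta> k = \<omega> ^ l" using root_power[OF k] by blast
    define w where "w j = snd A (inv\<^bsub>K\<^esub> (r j)) *\<^sub>v f (r j)" for j
    have fc: "f k \<in> carrier_vec ?n" if "k \<in> carrier K" for k using f that by (auto simp: PiE_mem)
    have wc: "w j \<in> carrier_vec ?n" for j
      unfolding w_def by (rule mult_mat_vec_carrier[OF AD(1) fc]) (simp_all add: r)
    have "comb (\<theta> k) (S f) = w l"
    proof
      fix a assume "a < dim_vec (w l)"
      then have a: "a < ?n" using wc[of l] by simp
      have "vec_index (comb (\<theta> k) (S f)) a = (\<Sum>i<e. (\<omega> ^ l) ^ i * (1 / of_nat e * (\<Sum>j<e. inverse (\<omega> ^ i) ^ j * vec_index (w j) a)))"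
        using a idx by (simp add: comb_def S_def l w_def)
      also have "\<dots> = 1 / of_nat e * (\<Sum>i<e. \<Sum>j<e. (\<omega> ^ l) ^ i * inverse (\<omega> ^ i) ^ j * vec_index (w j) a)"
        by (simp add: sum_distrib_left mult_ac)
      also have "\<dots> = 1 / of_nat e * (\<Sum>j<e. (\<Sum>i<e. (\<omega> ^ l) ^ i * inverse (\<omega> ^ i) ^ j) * vec_index (w j) a)"
        by (subst sum.swap) (simp add: sum_distrib_right)
      also have "\<dots> = 1 / of_nat e * (\<Sum>j<e. if j = l then of_nat e * vec_index (w j) a else 0)"
        using l by (intro arg_cong[where f = "\<lambda>x. 1 / of_nat e * x"] sum.cong refl) (simp add: orth')
      also have "\<dots> = vec_index (w l) a" using l e by simp
      finally show "vec_index (comb (\<theta> k) (S f)) a = vec_index (w l) a" .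
    qed (use wc[of l] in \<open>simp add: comb_def\<close>)
    then have "T (S f) k = snd A k *\<^sub>v w l" using k by (simp add: T_def)
    also have "\<dots> = snd A (k \<otimes>\<^bsub>K\<^esub> inv\<^bsub>K\<^esub> (r l)) *\<^sub>v f (r l)"
      unfolding w_def using k r by (simp add: AD(3) assoc_mult_mat_vec[OF AD(1) AD(1) fc])
    \<comment> \<open>k and \<open>r l\<close> have the same \<theta>-value, so their quotient lies
      in H and can be moved into the argument of f.\<close>
    also have "\<dots> = f (k \<otimes>\<^bsub>K\<^esub> inv\<^bsub>K\<^esub> (r l) \<otimes>\<^bsub>K\<^esub> r l)"
    proof -
      have "\<theta> (k \<otimes>\<^bsub>K\<^esub> inv\<^bsub>K\<^esub> (r l)) * \<theta> (r l) = \<theta> k"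
        using k r(1)[of l] mult[of "k \<otimes>\<^bsub>K\<^esub> inv\<^bsub>K\<^esub> (r l)" "r l"] by (simp add: m_assoc)
      then have "k \<otimes>\<^bsub>K\<^esub> inv\<^bsub>K\<^esub> (r l) \<in> H" using k r l \<omega>0 by (simp add: H_def)
      then show ?thesis using f r by simp
    qed
    also have "\<dots> = f k" using k r by (simp add: m_assoc)
    finally show "T (S f) k = f k" .
  qed
  have ST: "S (T v) = v" if v: "v \<in> carrier_vec (e * ?n)" for v
  proof
    fix s assume "s < dim_vec v"
    then have s: "s < e * ?n" using v by simp
    note s' = div_mod_less_mult[OF s]
    have "vec_index (S (T v)) s = 1 / of_nat e * (\<Sum>j<e. inverse (\<omega> ^ (s div ?n)) ^ j * vec_index (comb (\<omega> ^ j) v) (s mod ?n))"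
      using s by (simp add: S_def T_def r inv1[OF r(1) comb])
    also have "\<dots> = 1 / of_nat e * (\<Sum>j<e. \<Sum>i<e. inverse (\<omega> ^ (s div ?n)) ^ j * (\<omega> ^ j) ^ i * vec_index v (i * ?n + s mod ?n))"
      using s' by (simp add: comb_def sum_distrib_left mult_ac)
    also have "\<dots> = 1 / of_nat e * (\<Sum>i<e. (\<Sum>j<e. inverse (\<omega> ^ (s div ?n)) ^ j * (\<omega> ^ j) ^ i) * vec_index v (i * ?n + s mod ?n))"
      by (subst sum.swap) (simp add: sum_distrib_right)
    also have "\<dots> = 1 / of_nat e * (\<Sum>i<e. if i = s div ?n then of_nat e * vec_index v (i * ?n + s mod ?n) else 0)"
      using s' by (intro arg_cong[where f = "\<lambda>x. 1 / of_nat e * x"] sum.cong refl) (simp add: orth)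
    also have "\<dots> = vec_index v s" using s' e by simp
    finally show "vec_index (S (T v)) s = vec_index v s" .
  qed (use v in \<open>simp add: S_def\<close>)
  let ?D = "mrep_tensor (mrep_char_powers \<theta> e) A"
  \<comment> \<open>The source of equivariance: on the i-th block x acts with an extra factor
    \<theta> x ^ i, which is the effect of replacing z by z * \<theta> x. For z = \<theta> k this is
    the right translation from k to k x.\<close>
  have tensor: "comb z (snd ?D x *\<^sub>v v) = snd A x *\<^sub>v comb (z * \<theta> x) v"
    if x: "x \<in> carrier K" and v: "v \<in> carrier_vec (e * ?n)" for x v z
  proof
    note Ax = AD(1)[OF x]
    show "dim_vec (comb z (snd ?D x *\<^sub>v v)) = dim_vec (snd A x *\<^sub>v comb (z * \<theta> x) v)"
      using Ax by (simp add: comb_def)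
    fix a assume "a < dim_vec (snd A x *\<^sub>v comb (z * \<theta> x) v)"
    then have a: "a < ?n" using Ax by simp
    have entry: "vec_index (snd ?D x *\<^sub>v v) (i * ?n + a) =
        \<theta> x ^ i * (\<Sum>b<?n. snd A x $$ (a, b) * vec_index v (i * ?n + b))" if i: "i < e" for i
    proof -
      have "vec_index (snd ?D x *\<^sub>v v) (i * ?n + a) =
        (\<Sum>s<e * ?n. (if i = s div ?n then \<theta> x ^ i else 0) * snd A x $$ (a, s mod ?n) * vec_index v ((s div ?n) * ?n + s mod ?n))"
        using idx[OF i a] v i a
        by (simp add: mrep_tensor_def mrep_char_powers_def scalar_prod_def atLeast0LessThan div_mod_less_mult)
      also have "\<dots> = (\<Sum>j<e. \<Sum>b<?n. (if i = j then \<theta> x ^ i else 0) * snd A x $$ (a, b) * vec_index v (j * ?n + b))"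
        by (rule sum_div_mod)
      also have "\<dots> = (\<Sum>j<e. if j = i then (\<Sum>b<?n. \<theta> x ^ i * snd A x $$ (a, b) * vec_index v (i * ?n + b)) else 0)"
        by (intro sum.cong refl) auto
      also have "\<dots> = \<theta> x ^ i * (\<Sum>b<?n. snd A x $$ (a, b) * vec_index v (i * ?n + b))"
        using i by (simp add: sum_distrib_left mult_ac)
      finally show ?thesis .
    qed
    have "vec_index (comb z (snd ?D x *\<^sub>v v)) a =
        (\<Sum>i<e. z ^ i * (\<theta> x ^ i * (\<Sum>b<?n. snd A x $$ (a, b) * vec_index v (i * ?n + b))))"
      using a by (simp add: comb_def entry)
    also have "\<dots> = (\<Sum>i<e. \<Sum>b<?n. snd A x $$ (a, b) * ((z * \<theta> x) ^ i * vec_index v (i * ?n + b)))"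
      by (simp add: sum_distrib_left power_mult_distrib mult_ac)
    also have "\<dots> = (\<Sum>b<?n. snd A x $$ (a, b) * (\<Sum>i<e. (z * \<theta> x) ^ i * vec_index v (i * ?n + b)))"
      by (subst sum.swap) (simp add: sum_distrib_left)
    also have "\<dots> = vec_index (snd A x *\<^sub>v comb (z * \<theta> x) v) a"
      using a Ax by (simp add: comb_def scalar_prod_def atLeast0LessThan)
    finally show "vec_index (comb z (snd ?D x *\<^sub>v v)) a =
      vec_index (snd A x *\<^sub>v comb (z * \<theta> x) v) a" .
  qed
  have dim: "fst ?D = e * ?n" by (simp add: mrep_char_powers_def)
  have "bij_betw T (carrier_vec (e * ?n)) (carrier (fst (ind_rep K H (rep_of_mrep A))))"
  proof (rule bij_betw_byWitness[where f' = S])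
    show "T ` carrier_vec (e * ?n) \<subseteq> carrier (fst (ind_rep K H (rep_of_mrep A)))" using Tc by blast
    show "S ` carrier (fst (ind_rep K H (rep_of_mrep A))) \<subseteq> carrier_vec (e * ?n)" by (auto simp: S_def)
  qed (use ST TS in blast)+
  moreover have "T (v + w) = (\<lambda>k\<in>carrier K. T v k + T w k)"
    if "v \<in> carrier_vec (e * ?n)" "w \<in> carrier_vec (e * ?n)" for v w
  proof -
    have "comb z (v + w) = comb z v + comb z w" for z
      using that idx by (auto simp: comb_def sum.distrib distrib_left intro!: eq_vecI)
    then show ?thesis
      by (auto simp: T_def fun_eq_iff mult_add_distrib_mat_vec[OF AD(1) comb comb])
  qed
  moreover have "T (c \<cdot>\<^sub>v v) = (\<lambda>k\<in>carrier K. c \<cdot>\<^sub>v T v k)"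
    if "v \<in> carrier_vec (e * ?n)" for c v
  proof -
    have "comb z (c \<cdot>\<^sub>v v) = c \<cdot>\<^sub>v comb z v" for z
      using that idx by (auto simp: comb_def sum_distrib_left mult_ac intro!: eq_vecI)
    then show ?thesis
      by (auto simp: T_def fun_eq_iff mult_mat_vec[OF AD(1) comb])
  qed
  moreover have "T (snd ?D x *\<^sub>v v) = (\<lambda>k\<in>carrier K. T v (k \<otimes>\<^bsub>K\<^esub> x))"
    if "x \<in> carrier K" "v \<in> carrier_vec (e * ?n)" for x v
    using that by (auto simp: T_def fun_eq_iff tensor mult AD(3) assoc_mult_mat_vec[OF AD(1) AD(1) comb])
  ultimately show ?thesis
    unfolding rep_iso_def rep_of_mrep_simps dim ind_rep_simps(3-5)
    by (intro exI[of _ T]) blast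
qed

section \<open>Cohomology of a union of open translates\<close>

definition cohomology_class :: "nat \<Rightarrow> 'a topology \<Rightarrow> 'a cochain \<Rightarrow> 'a cochain set" where
  "cohomology_class p Y \<phi> = (\<lambda>b \<sigma>. b \<sigma> + \<phi> \<sigma>) ` coboundaries p Y"

lemma coboundary_add: "coboundary p Y (\<lambda>\<sigma>. \<phi> \<sigma> + \<psi> \<sigma>) = (\<lambda>\<sigma>. coboundary p Y \<phi> \<sigma> + coboundary p Y \<psi> \<sigma>)"
  by (auto simp: coboundary_def fun_eq_iff distrib_left sum.distrib)

lemma coboundary_smult: "coboundary p Y (\<lambda>\<sigma>. c * \<phi> \<sigma>) = (\<lambda>\<sigma>. c * coboundary p Y \<phi> \<sigma>)"
  by (auto simp: coboundary_def fun_eq_iff sum_distrib_left mult_ac simp del: sum.atMost_Suc)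

lemma cochains_add: "\<phi> \<in> cochains p Y \<Longrightarrow> \<psi> \<in> cochains p Y \<Longrightarrow> (\<lambda>\<sigma>. \<phi> \<sigma> + \<psi> \<sigma>) \<in> cochains p Y"
  and cochains_smult: "\<phi> \<in> cochains p Y \<Longrightarrow> (\<lambda>\<sigma>. c * \<phi> \<sigma>) \<in> cochains p Y"
  and cochains_zero: "(\<lambda>_. 0) \<in> cochains p Y"
  by (auto simp: cochains_def)

lemma coboundary_zero: "coboundary p Y (\<lambda>_. 0) = (\<lambda>_. 0)"
  by (auto simp: coboundary_def)

lemma coboundaries_add:
  assumes "a \<in> coboundaries p Y" and "b \<in> coboundaries p Y"
  shows "(\<lambda>\<sigma>. a \<sigma> + b \<sigma>) \<in> coboundaries p Y"
proof (cases p)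
  case (Suc q)
  then obtain \<phi> \<psi> where \<phi>: "\<phi> \<in> cochains q Y" "\<psi> \<in> cochains q Y" "a = coboundary q Y \<phi>" "b = coboundary q Y \<psi>"
    using assms by (auto simp: coboundaries_def)
  have "coboundary q Y (\<lambda>\<sigma>. \<phi> \<sigma> + \<psi> \<sigma>) \<in> coboundary q Y ` cochains q Y"
    using \<phi> by (intro imageI cochains_add)
  then show ?thesis by (simp add: Suc coboundaries_def coboundary_add \<phi>)
qed (use assms in \<open>auto simp: coboundaries_def\<close>)

lemma coboundaries_smult:
  assumes "a \<in> coboundaries p Y"
  shows "(\<lambda>\<sigma>. c * a \<sigma>) \<in> coboundaries p Y"
proof (cases p)
  case (Suc q)
  then obtain \<phi> where \<phi>: "\<phi> \<in> cochains q Y" "a = coboundary q Y \<phi>"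
    using assms by (auto simp: coboundaries_def)
  have "coboundary q Y (\<lambda>\<sigma>. c * \<phi> \<sigma>) \<in> coboundary q Y ` cochains q Y"
    using \<phi> by (intro imageI cochains_smult)
  then show ?thesis by (simp add: Suc coboundaries_def coboundary_smult \<phi>)
qed (use assms in \<open>auto simp: coboundaries_def\<close>)

lemma coboundaries_zero: "(\<lambda>_. 0) \<in> coboundaries p Y"
proof (cases p)
  case (Suc q)
  have "coboundary q Y (\<lambda>_. 0) \<in> coboundary q Y ` cochains q Y"
    by (intro imageI cochains_zero)
  then show ?thesis by (simp add: Suc coboundaries_def coboundary_zero)
qed (simp add: coboundaries_def)

lemma cocycles_add: "\<phi> \<in> cocycles p Y \<Longrightarrow> \<psi> \<in> cocycles p Y \<Longrightarrow> (\<lambda>\<sigma>. \<phi> \<sigma> + \<psi> \<sigma>) \<in> cocycles p Y"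
  and cocycles_smult: "\<phi> \<in> cocycles p Y \<Longrightarrow> (\<lambda>\<sigma>. c * \<phi> \<sigma>) \<in> cocycles p Y"
  and cocycles_zero: "(\<lambda>_. 0) \<in> cocycles p Y"
  by (auto simp: cocycles_def coboundary_add coboundary_smult coboundary_zero cochains_add cochains_smult cochains_zero)

lemma cohomology_class_self: "\<phi> \<in> cohomology_class p Y \<phi>"
  unfolding cohomology_class_def using coboundaries_zero by (intro image_eqI[where x = "\<lambda>_. 0"]) auto

lemma cohomology_class_iff: "\<psi> \<in> cohomology_class p Y \<phi> \<longleftrightarrow> (\<lambda>\<sigma>. \<psi> \<sigma> - \<phi> \<sigma>) \<in> coboundaries p Y"
proof
  assume "(\<lambda>\<sigma>. \<psi> \<sigma> - \<phi> \<sigma>) \<in> coboundaries p Y"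
  then show "\<psi> \<in> cohomology_class p Y \<phi>"
    unfolding cohomology_class_def by (intro image_eqI[where x = "\<lambda>\<sigma>. \<psi> \<sigma> - \<phi> \<sigma>"]) auto
qed (auto simp: cohomology_class_def)

lemma cohomology_class_eq_iff:
  "cohomology_class p Y \<phi> = cohomology_class p Y \<psi> \<longleftrightarrow> (\<lambda>\<sigma>. \<phi> \<sigma> - \<psi> \<sigma>) \<in> coboundaries p Y"
proof
  assume "cohomology_class p Y \<phi> = cohomology_class p Y \<psi>"
  then show "(\<lambda>\<sigma>. \<phi> \<sigma> - \<psi> \<sigma>) \<in> coboundaries p Y"
    using cohomology_class_self cohomology_class_iff by blast
next
  assume *: "(\<lambda>\<sigma>. \<phi> \<sigma> - \<psi> \<sigma>) \<in> coboundaries p Y"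
  have "(\<lambda>\<sigma>. \<omega> \<sigma> - \<phi> \<sigma>) \<in> coboundaries p Y \<longleftrightarrow> (\<lambda>\<sigma>. \<omega> \<sigma> - \<psi> \<sigma>) \<in> coboundaries p Y" for \<omega>
    using coboundaries_add[OF _ *, of "\<lambda>\<sigma>. \<omega> \<sigma> - \<phi> \<sigma>"]
      coboundaries_add[OF _ coboundaries_smult[OF *, of "- 1"], of "\<lambda>\<sigma>. \<omega> \<sigma> - \<psi> \<sigma>"]
    by (auto simp: algebra_simps)
  then show "cohomology_class p Y \<phi> = cohomology_class p Y \<psi>" by (auto simp: cohomology_class_iff)
qed

text \<open>The cosets and set operations of the quotient module are evaluated on representatives
  once; from here on, computations take place with cochains.\<close>

lemma cohomology_simps:
  "carrier (cohomology p Y) = cohomology_class p Y ` cocycles p Y"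
  "\<zero>\<^bsub>cohomology p Y\<^esub> = cohomology_class p Y (\<lambda>_. 0)"
  "cohomology_class p Y \<phi> \<oplus>\<^bsub>cohomology p Y\<^esub> cohomology_class p Y \<psi> = cohomology_class p Y (\<lambda>\<sigma>. \<phi> \<sigma> + \<psi> \<sigma>)"
  "c \<odot>\<^bsub>cohomology p Y\<^esub> cohomology_class p Y \<phi> = cohomology_class p Y (\<lambda>\<sigma>. c * \<phi> \<sigma>)"
proof -
  have coset: "coboundaries p Y +>\<^bsub>cocycle_module p Y\<^esub> \<phi> = cohomology_class p Y \<phi>" for \<phi>
    by (auto simp: a_r_coset_def' cocycle_module_def cohomology_class_def)
  show "carrier (cohomology p Y) = cohomology_class p Y ` cocycles p Y"
    by (auto simp: cohomology_def quotient_module_def A_RCOSETS_def' coset) (auto simp: cocycle_module_def)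
  show "\<zero>\<^bsub>cohomology p Y\<^esub> = cohomology_class p Y (\<lambda>_. 0)"
    by (auto simp: cohomology_def quotient_module_def cohomology_class_def)
  show "cohomology_class p Y \<phi> \<oplus>\<^bsub>cohomology p Y\<^esub> cohomology_class p Y \<psi> = cohomology_class p Y (\<lambda>\<sigma>. \<phi> \<sigma> + \<psi> \<sigma>)"
  proof -
    have "cohomology_class p Y \<phi> \<oplus>\<^bsub>cohomology p Y\<^esub> cohomology_class p Y \<psi> =
      {\<lambda>\<sigma>. a \<sigma> + b \<sigma> | a b. a \<in> cohomology_class p Y \<phi> \<and> b \<in> cohomology_class p Y \<psi>}"
      by (auto simp: cohomology_def quotient_module_def set_add_def' cocycle_module_def)
    also have "\<dots> = cohomology_class p Y (\<lambda>\<sigma>. \<phi> \<sigma> + \<psi> \<sigma>)"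
    proof (intro equalityI subsetI)
      fix x assume "x \<in> {\<lambda>\<sigma>. a \<sigma> + b \<sigma> | a b. a \<in> cohomology_class p Y \<phi> \<and> b \<in> cohomology_class p Y \<psi>}"
      then obtain a b where "x = (\<lambda>\<sigma>. a \<sigma> + b \<sigma>)" "(\<lambda>\<sigma>. a \<sigma> - \<phi> \<sigma>) \<in> coboundaries p Y" "(\<lambda>\<sigma>. b \<sigma> - \<psi> \<sigma>) \<in> coboundaries p Y"
        by (auto simp: cohomology_class_iff)
      then show "x \<in> cohomology_class p Y (\<lambda>\<sigma>. \<phi> \<sigma> + \<psi> \<sigma>)"
        using coboundaries_add[of "\<lambda>\<sigma>. a \<sigma> - \<phi> \<sigma>" p Y "\<lambda>\<sigma>. b \<sigma> - \<psi> \<sigma>"]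
        by (simp add: cohomology_class_iff algebra_simps)
    next
      fix x assume "x \<in> cohomology_class p Y (\<lambda>\<sigma>. \<phi> \<sigma> + \<psi> \<sigma>)"
      then have "(\<lambda>\<sigma>. x \<sigma> - \<psi> \<sigma>) \<in> cohomology_class p Y \<phi>"
        by (simp add: cohomology_class_iff algebra_simps)
      moreover have "x = (\<lambda>\<sigma>. (x \<sigma> - \<psi> \<sigma>) + \<psi> \<sigma>)" by simp
      ultimately show "x \<in> {\<lambda>\<sigma>. a \<sigma> + b \<sigma> | a b. a \<in> cohomology_class p Y \<phi> \<and> b \<in> cohomology_class p Y \<psi>}"
        using cohomology_class_self[of \<psi> p Y]
        by (intro CollectI exI[of _ "\<lambda>\<sigma>. x \<sigma> - \<psi> \<sigma>"] exI[of _ \<psi>]) simp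
    qed
    finally show ?thesis .
  qed
  show "c \<odot>\<^bsub>cohomology p Y\<^esub> cohomology_class p Y \<phi> = cohomology_class p Y (\<lambda>\<sigma>. c * \<phi> \<sigma>)"
  proof -
    have "c \<odot>\<^bsub>cohomology p Y\<^esub> cohomology_class p Y \<phi> = (\<Union>u\<in>cohomology_class p Y \<phi>. cohomology_class p Y (\<lambda>\<sigma>. c * u \<sigma>))"
      by (simp add: cohomology_def quotient_module_def coset) (simp add: cocycle_module_def)
    also have "\<dots> = (\<Union>u\<in>cohomology_class p Y \<phi>. cohomology_class p Y (\<lambda>\<sigma>. c * \<phi> \<sigma>))"
    proof (intro SUP_cong refl)
      fix u assume "u \<in> cohomology_class p Y \<phi>"
      then show "cohomology_class p Y (\<lambda>\<sigma>. c * u \<sigma>) = cohomology_class p Y (\<lambda>\<sigma>. c * \<phi> \<sigma>)"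
        using coboundaries_smult[of "\<lambda>\<sigma>. u \<sigma> - \<phi> \<sigma>" p Y c]
        by (simp add: cohomology_class_iff cohomology_class_eq_iff algebra_simps)
    qed
    also have "\<dots> = cohomology_class p Y (\<lambda>\<sigma>. c * \<phi> \<sigma>)"
      using cohomology_class_self by (intro SUP_const) blast
    finally show ?thesis .
  qed
qed

section \<open>Functoriality of pullbacks\<close>

lemma simplex_map_simplex_map:
  assumes "singular_simplex p U \<sigma>" and "continuous_map U Y f"
    and "\<And>x. x \<in> topspace U \<Longrightarrow> h x = g (f x)"
  shows "simplex_map p g (simplex_map p f \<sigma>) = simplex_map p h \<sigma>"
proof -
  have "simplex_map p h \<sigma> = simplex_map p (g \<circ> f) \<sigma>"
    by (rule simplex_map_eq[OF assms(1)]) (simp add: assms(3))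
  then show ?thesis by (simp add: simplex_map_compose)
qed

lemma singular_face_simplex_map_commute:
  assumes "k \<le> Suc p"
  shows "singular_face (Suc p) k (simplex_map (Suc p) f \<sigma>) = simplex_map p f (singular_face (Suc p) k \<sigma>)"
proof -
  have "singular_face (Suc p) k (simplex_map (Suc p) f \<sigma>) = simplex_map p f (\<sigma> \<circ> simplical_face k)"
    using singular_face_simplex_map[of "Suc p" k f \<sigma>] assms by simp
  also have "\<dots> = simplex_map p f (singular_face (Suc p) k \<sigma>)"
    by (auto simp: simplex_map_def singular_face_def)
  finally show ?thesis .
qed

lemma pullback_cochain_cochains: "pullback_cochain p Y f \<phi> \<in> cochains p Y"
  by (simp add: pullback_cochain_def cochains_def)

lemma pullback_cochain_add:
  "pullback_cochain p Y f (\<lambda>\<sigma>. \<phi> \<sigma> + \<psi> \<sigma>) = (\<lambda>\<sigma>. pullback_cochain p Y f \<phi> \<sigma> + pullback_cochain p Y f \<psi> \<sigma>)"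
  by (auto simp: pullback_cochain_def)

lemma pullback_cochain_smult:
  "pullback_cochain p Y f (\<lambda>\<sigma>. c * \<phi> \<sigma>) = (\<lambda>\<sigma>. c * pullback_cochain p Y f \<phi> \<sigma>)"
  by (auto simp: pullback_cochain_def)

lemma pullback_cochain_diff:
  "pullback_cochain p Y f (\<lambda>\<sigma>. \<phi> \<sigma> - \<psi> \<sigma>) = (\<lambda>\<sigma>. pullback_cochain p Y f \<phi> \<sigma> - pullback_cochain p Y f \<psi> \<sigma>)"
  by (auto simp: pullback_cochain_def)

lemma pullback_cochain_coboundary:
  assumes f: "continuous_map Y Z f"
  shows "pullback_cochain (Suc p) Y f (coboundary p Z \<phi>) = coboundary p Y (pullback_cochain p Y f \<phi>)"
proof
  fix \<sigma>
  show "pullback_cochain (Suc p) Y f (coboundary p Z \<phi>) \<sigma> = coboundary p Y (pullback_cochain p Y f \<phi>) \<sigma>"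
  proof (cases "singular_simplex (Suc p) Y \<sigma>")
    case True
    have "singular_simplex p Y (singular_face (Suc p) k \<sigma>)" if "k \<le> Suc p" for k
      using singular_simplex_singular_face[OF True _ that] by simp
    then show ?thesis
      using True singular_simplex_simplex_map[OF True f]
      by (simp add: pullback_cochain_def coboundary_def singular_face_simplex_map_commute)
  qed (simp add: pullback_cochain_def coboundary_def)
qed

lemma pullback_cochain_coboundaries:
  assumes f: "continuous_map Y Z f" and b: "b \<in> coboundaries p Z"
  shows "pullback_cochain p Y f b \<in> coboundaries p Y"
proof (cases p)
  case 0
  then show ?thesis using b by (auto simp: coboundaries_def pullback_cochain_def)
next
  case (Suc q)
  then obtain \<phi> where "b = coboundary q Z \<phi>" using b by (auto simp: coboundaries_def)
  then show ?thesis
    using Suc pullback_cochain_cochains[of q Y f \<phi>] by (auto simp: coboundaries_def pullback_cochain_coboundary[OF f])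
qed

lemma pullback_cochain_cocycles:
  assumes f: "continuous_map Y Z f" and "\<phi> \<in> cocycles p Z"
  shows "pullback_cochain p Y f \<phi> \<in> cocycles p Y"
proof -
  have "coboundary p Y (pullback_cochain p Y f \<phi>) = pullback_cochain (Suc p) Y f (\<lambda>_. 0)"
    using assms(2) by (simp add: cocycles_def flip: pullback_cochain_coboundary[OF f])
  then show ?thesis using pullback_cochain_cochains by (auto simp: cocycles_def pullback_cochain_def)
qed

lemma pullback_cohomology_class:
  assumes f: "continuous_map Y Z f"
  shows "pullback p Y f (cohomology_class p Z \<phi>) = cohomology_class p Y (pullback_cochain p Y f \<phi>)"
proof -
  have coset: "coboundaries p Y +>\<^bsub>cocycle_module p Y\<^esub> \<phi> = cohomology_class p Y \<phi>" for \<phi>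
    by (auto simp: a_r_coset_def' cocycle_module_def cohomology_class_def)
  have "pullback p Y f (cohomology_class p Z \<phi>) =
    (\<Union>\<psi>\<in>cohomology_class p Z \<phi>. cohomology_class p Y (pullback_cochain p Y f \<phi>))"
    unfolding pullback_def coset
  proof (intro SUP_cong refl)
    fix \<psi> assume "\<psi> \<in> cohomology_class p Z \<phi>"
    then show "cohomology_class p Y (pullback_cochain p Y f \<psi>) = cohomology_class p Y (pullback_cochain p Y f \<phi>)"
      using pullback_cochain_coboundaries[OF f, of "\<lambda>\<sigma>. \<psi> \<sigma> - \<phi> \<sigma>"]
      by (simp add: cohomology_class_iff cohomology_class_eq_iff pullback_cochain_diff)
  qed
  also have "\<dots> = cohomology_class p Y (pullback_cochain p Y f \<phi>)"
    using cohomology_class_self by (intro SUP_const) blast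
  finally show ?thesis .
qed

text \<open>The map h is compared with the composite only on points of the space, since the laws of
  the group action are available only there.\<close>

lemma pullback_cochain_comp:
  assumes f: "continuous_map U Y f" and h: "\<And>x. x \<in> topspace U \<Longrightarrow> h x = g (f x)"
  shows "pullback_cochain p U f (pullback_cochain p Y g \<phi>) = pullback_cochain p U h \<phi>"
  using singular_simplex_simplex_map[OF _ f] simplex_map_simplex_map[where f = f and g = g and h = h, OF _ f h]
  by (intro ext) (auto simp: pullback_cochain_def)

lemma pullback_comp:
  assumes f: "continuous_map U Y f" and g: "continuous_map Y Z g"
    and h: "\<And>x. x \<in> topspace U \<Longrightarrow> h x = g (f x)" and c: "c \<in> carrier (cohomology p Z)"
  shows "pullback p U f (pullback p Y g c) = pullback p U h c"
proof -
  have "continuous_map U Z (g \<circ> f)" using f g by (rule continuous_map_compose)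
  then have "continuous_map U Z h" by (rule continuous_map_eq) (simp add: h)
  then show ?thesis
    using c by (auto simp: cohomology_simps pullback_cohomology_class f g pullback_cochain_comp[where f = f and g = g and h = h, OF f h])
qed

lemma pullback_id:
  assumes "\<And>x. x \<in> topspace U \<Longrightarrow> f x = x" and c: "c \<in> carrier (cohomology p U)"
  shows "pullback p U f c = c"
proof -
  have "continuous_map U U f" by (rule continuous_map_eq[OF continuous_map_id]) (simp add: assms)
  moreover have "pullback_cochain p U f \<phi> = \<phi>" if "\<phi> \<in> cochains p U" for \<phi>
    using that by (intro ext) (auto simp: pullback_cochain_def cochains_def simplex_map_id_gen[of p U _ f] assms(1))
  ultimately show ?thesis using c by (auto simp: cohomology_simps pullback_cohomology_class cocycles_def)
qed

lemma pullback_linear: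
  assumes f: "continuous_map Y Z f" and u: "u \<in> carrier (cohomology p Z)"
  shows "pullback p Y f u \<in> carrier (cohomology p Y)"
    and "v \<in> carrier (cohomology p Z) \<Longrightarrow>
      pullback p Y f (u \<oplus>\<^bsub>cohomology p Z\<^esub> v) = pullback p Y f u \<oplus>\<^bsub>cohomology p Y\<^esub> pullback p Y f v"
    and "pullback p Y f (c \<odot>\<^bsub>cohomology p Z\<^esub> u) = c \<odot>\<^bsub>cohomology p Y\<^esub> pullback p Y f u"
  using u by (auto simp: cohomology_simps pullback_cohomology_class[OF f] pullback_cochain_add
    pullback_cochain_smult pullback_cochain_cocycles[OF f])

lemma lin_rep_cohomology_rep:
  assumes K: "group K" and act: "\<And>k. k \<in> carrier K \<Longrightarrow> continuous_map Y Y (act k)"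
    and act_mult: "\<And>k k' x. k \<in> carrier K \<Longrightarrow> k' \<in> carrier K \<Longrightarrow> x \<in> topspace Y \<Longrightarrow> act (k \<otimes>\<^bsub>K\<^esub> k') x = act k (act k' x)"
    and act_one: "\<And>x. x \<in> topspace Y \<Longrightarrow> act \<one>\<^bsub>K\<^esub> x = x"
  shows "lin_rep K (cohomology_rep K act Y p)"
proof -
  interpret group K by (rule K)
  have "pullback p Y (act (inv\<^bsub>K\<^esub> (k \<otimes>\<^bsub>K\<^esub> k'))) x = pullback p Y (act (inv\<^bsub>K\<^esub> k)) (pullback p Y (act (inv\<^bsub>K\<^esub> k')) x)"
    if "k \<in> carrier K" "k' \<in> carrier K" "x \<in> carrier (cohomology p Y)" for k k' x
    using that by (intro pullback_comp[symmetric, OF act act]) (auto simp: inv_mult_group act_mult)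
  moreover have "pullback p Y (act (inv\<^bsub>K\<^esub> \<one>\<^bsub>K\<^esub>)) x = x" if "x \<in> carrier (cohomology p Y)" for x
    using that by (intro pullback_id) (simp add: act_one)
  ultimately show ?thesis
    unfolding lin_rep_def cohomology_rep_def fst_conv snd_conv
    using pullback_linear[OF act[OF inv_closed]]
    by (intro conjI ballI allI) (auto simp: cohomology_simps cocycles_zero cocycles_add cocycles_smult)
qed

text \<open>By \<open>cover\<close> and \<open>separate\<close>, the elements that carry a given
  point of F into F0 form exactly one right coset of H. So F is the disjoint union of the open sets
  {x. k x \<in> F0}, one for each right coset H k.\<close>

locale open_translates = group K for K (structure) +
  fixes act :: "'a \<Rightarrow> 'v::topological_space \<Rightarrow> 'v" and F F0 :: "'v set" and H
  assumes act_cont: "\<And>k. k \<in> carrier K \<Longrightarrow> continuous_map (top_of_set F) (top_of_set F) (act k)"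
    and act_mult: "\<And>k k' x. k \<in> carrier K \<Longrightarrow> k' \<in> carrier K \<Longrightarrow> x \<in> F \<Longrightarrow> act (k \<otimes> k') x = act k (act k' x)"
    and act_one: "\<And>x. x \<in> F \<Longrightarrow> act \<one> x = x"
    and F0: "openin (top_of_set F) F0"
    and cover: "\<And>x. x \<in> F \<Longrightarrow> \<exists>k\<in>carrier K. act k x \<in> F0"
    and H: "subgroup H K"
    and separate: "\<And>k x. k \<in> carrier K \<Longrightarrow> x \<in> F0 \<Longrightarrow> act k x \<in> F0 \<longleftrightarrow> k \<in> H"
begin

abbreviation "FT \<equiv> top_of_set F"
abbreviation "F0T \<equiv> top_of_set F0"

lemma F0_subset: "F0 \<subseteq> F"
  using openin_subset[OF F0] by simp

lemma act_into: "k \<in> carrier K \<Longrightarrow> x \<in> F \<Longrightarrow> act k x \<in> F"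
  using act_cont[of k] by (auto simp: continuous_map_def)

lemma act_inv: "k \<in> carrier K \<Longrightarrow> x \<in> F \<Longrightarrow> act (inv k) (act k x) = x"
  "k \<in> carrier K \<Longrightarrow> x \<in> F \<Longrightarrow> act k (act (inv k) x) = x"
  by (simp_all flip: act_mult add: act_one)

lemma separate_translates: "k \<in> carrier K \<Longrightarrow> k' \<in> carrier K \<Longrightarrow> x \<in> F \<Longrightarrow> act k' x \<in> F0 \<Longrightarrow> act k x \<in> F0 \<longleftrightarrow> k \<otimes> inv k' \<in> H"
  using separate[of "k \<otimes> inv k'" "act k' x"] act_into[of k' x]
  by (simp add: act_mult act_inv)

lemma act_F0_cont: "k \<in> carrier K \<Longrightarrow> continuous_map F0T FT (act k)"
  using continuous_map_from_subtopology[OF act_cont, of k F0] F0_subset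
  by (simp add: subtopology_subtopology Int_absorb1)

lemma act_H_cont: "h \<in> H \<Longrightarrow> continuous_map F0T F0T (act h)"
  using act_F0_cont[of h] separate[of h] subgroup.mem_carrier[OF H, of h]
  by (auto simp: continuous_map_in_subtopology image_subset_iff)

lemma singular_simplex_F0: "singular_simplex p F0T \<sigma> \<longleftrightarrow> singular_simplex p FT \<sigma> \<and> \<sigma> ` standard_simplex p \<subseteq> F0"
  using F0_subset by (auto simp: singular_simplex_subtopology)

text \<open>The complement of one translate is the union of the translates belonging to the other
  cosets, all of which are open.\<close>

lemma clopen_preimage:
  assumes k: "k \<in> carrier K"
  shows "openin FT {x \<in> F. act k x \<in> F0}" "closedin FT {x \<in> F. act k x \<in> F0}"
proof -
  have op: "openin FT {x \<in> F. act k x \<in> F0}" if "k \<in> carrier K" for k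
    using openin_continuous_map_preimage[OF act_cont[OF that] F0] by simp
  show "openin FT {x \<in> F. act k x \<in> F0}" by (rule op[OF k])
  have "F - {x \<in> F. act k x \<in> F0} = (\<Union>k'\<in>{k' \<in> carrier K. k \<otimes> inv k' \<notin> H}. {x \<in> F. act k' x \<in> F0})"
    using k separate_translates[OF k] cover by auto blast
  moreover have "openin FT (\<Union>k'\<in>{k' \<in> carrier K. k \<otimes> inv k' \<notin> H}. {x \<in> F. act k' x \<in> F0})"
    using op by (intro openin_Union) auto
  ultimately show "closedin FT {x \<in> F. act k x \<in> F0}"
    by (auto simp: closedin_def)
qed

text \<open>The image of a simplex is connected and therefore cannot leave a translate that is open
  and closed.\<close>

lemma simplex_in_translate:
  assumes \<sigma>: "singular_simplex p FT \<sigma>" and k: "k \<in> carrier K"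
    and x: "x \<in> standard_simplex p" "act k (\<sigma> x) \<in> F0" and y: "y \<in> standard_simplex p"
  shows "act k (\<sigma> y) \<in> F0"
proof -
  have c: "continuous_map (subtopology (powertop_real UNIV) (standard_simplex p)) FT \<sigma>"
    using \<sigma> by (simp add: singular_simplex_def)
  have im: "\<sigma> ` standard_simplex p \<subseteq> F"
    using \<sigma> by (simp add: singular_simplex_subtopology)
  have "connectedin (subtopology (powertop_real UNIV) (standard_simplex p)) (standard_simplex p)"
    by (simp add: connectedin_subtopology connectedin_standard_simplex)
  then have "connectedin FT (\<sigma> ` standard_simplex p)"
    by (rule connectedin_continuous_map_image[OF c])
  then have "\<sigma> ` standard_simplex p \<subseteq> {x \<in> F. act k x \<in> F0} \<or> disjnt (\<sigma> ` standard_simplex p) {x \<in> F. act k x \<in> F0}"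
    using clopen_preimage[OF k] by (intro connectedin_clopen_cases)
  then show ?thesis using x y im by (auto simp: disjnt_iff)
qed

section \<open>Restricting cochains to the translates and gluing them\<close>

definition translator :: "nat \<Rightarrow> ((nat \<Rightarrow> real) \<Rightarrow> 'v) \<Rightarrow> 'a \<Rightarrow> bool" where
  "translator p \<sigma> k \<longleftrightarrow> k \<in> carrier K \<and> (\<forall>x\<in>standard_simplex p. act k (\<sigma> x) \<in> F0)"

lemma ex_translator: "singular_simplex p FT \<sigma> \<Longrightarrow> \<exists>k. translator p \<sigma> k"
proof -
  assume \<sigma>: "singular_simplex p FT \<sigma>"
  obtain x where x: "x \<in> standard_simplex p" using nonempty_standard_simplex by blast
  then have "\<sigma> x \<in> F" using \<sigma> by (auto simp: singular_simplex_subtopology)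
  then obtain k where "k \<in> carrier K" "act k (\<sigma> x) \<in> F0" using cover by blast
  then show ?thesis using simplex_in_translate[OF \<sigma> _ x] by (auto simp: translator_def)
qed

text \<open>A single point decides into which translate a simplex falls, and every face contains
  such a point.\<close>

lemma translator_face:
  assumes \<sigma>: "singular_simplex (Suc p) FT \<sigma>" and j: "j \<le> Suc p"
  shows "translator p (singular_face (Suc p) j \<sigma>) k \<longleftrightarrow> translator (Suc p) \<sigma> k"
proof
  have face: "simplical_face j x \<in> standard_simplex (Suc p)" if "x \<in> standard_simplex p" for x
    using simplical_face_in_standard_simplex[of "Suc p" j x] j that by simp
  show "translator (Suc p) \<sigma> k \<Longrightarrow> translator p (singular_face (Suc p) j \<sigma>) k"
    using face by (simp add: translator_def singular_face_def)
  assume t: "translator p (singular_face (Suc p) j \<sigma>) k"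
  obtain x where x: "x \<in> standard_simplex p" using nonempty_standard_simplex by blast
  then have "act k (\<sigma> (simplical_face j x)) \<in> F0" using t by (simp add: translator_def singular_face_def)
  then show "translator (Suc p) \<sigma> k"
    using simplex_in_translate[OF \<sigma> _ face[OF x]] t by (simp add: translator_def)
qed

text \<open>For a simplex moved out of F0 by the inverse of k, the translators form the coset H k
  whatever the simplex is. Hence the choice made by \<open>Eps\<close> depends on k alone.\<close>

lemma translator_simplex_map:
  assumes \<tau>: "singular_simplex p F0T \<tau>" and k: "k \<in> carrier K"
  shows "translator p (simplex_map p (act (inv k)) \<tau>) k' \<longleftrightarrow> k' \<in> carrier K \<and> k' \<otimes> inv k \<in> H"
proof -
  have "\<tau> x \<in> F0" if "x \<in> standard_simplex p" for x
    using \<tau> that by (auto simp: singular_simplex_F0)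
  then have "act k' (act (inv k) (\<tau> x)) \<in> F0 \<longleftrightarrow> k' \<otimes> inv k \<in> H" if "x \<in> standard_simplex p" "k' \<in> carrier K" for x
    using separate_translates[OF that(2) k act_into[OF inv_closed[OF k]], of "\<tau> x"] F0_subset that(1) k
    by (auto simp: act_inv)
  then show ?thesis
    using nonempty_standard_simplex[of p] by (auto simp: translator_def simplex_map_def)
qed

lemma simplex_map_translator:
  assumes \<sigma>: "singular_simplex p FT \<sigma>" and t: "translator p \<sigma> k"
  shows "singular_simplex p F0T (simplex_map p (act k) \<sigma>)"
  using t singular_simplex_simplex_map[OF \<sigma> act_cont, of k]
  by (auto simp: singular_simplex_F0 translator_def simplex_map_def)

text \<open>The chosen translator depends only on the translate of \<open>F0\<close> that contains the simplex, so it is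
  the same for a simplex and its faces.  This makes gluing commute with coboundaries.\<close>

definition glue :: "nat \<Rightarrow> ('a \<Rightarrow> 'v cochain) \<Rightarrow> 'v cochain" where
  "glue p \<theta> \<sigma> = (if singular_simplex p FT \<sigma>
     then \<theta> (Eps (translator p \<sigma>)) (simplex_map p (act (Eps (translator p \<sigma>))) \<sigma>) else 0)"

lemma glue_cochains: "glue p \<theta> \<in> cochains p FT"
  by (simp add: glue_def cochains_def)

lemma translator_Eps: "singular_simplex p FT \<sigma> \<Longrightarrow> translator p \<sigma> (Eps (translator p \<sigma>))"
  using ex_translator by (rule someI_ex)

lemma coboundary_glue: "coboundary p FT (glue p \<theta>) = glue (Suc p) (\<lambda>k. coboundary p F0T (\<theta> k))"
proof
  fix \<sigma>
  show "coboundary p FT (glue p \<theta>) \<sigma> = glue (Suc p) (\<lambda>k. coboundary p F0T (\<theta> k)) \<sigma>"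
  proof (cases "singular_simplex (Suc p) FT \<sigma>")
    case True
    have "singular_simplex p FT (singular_face (Suc p) j \<sigma>)" if "j \<le> Suc p" for j
      using singular_simplex_singular_face[OF True _ that] by simp
    moreover have "translator p (singular_face (Suc p) j \<sigma>) = translator (Suc p) \<sigma>" if "j \<le> Suc p" for j
      using translator_face[OF True that] by blast
    ultimately show ?thesis
      using True simplex_map_translator[OF True translator_Eps[OF True]]
      by (simp add: glue_def coboundary_def singular_face_simplex_map_commute)
  qed (simp add: glue_def coboundary_def)
qed

text \<open>Moving a simplex into F0 by its translator and back by the inverse cancels, so a cochain
  is recovered from its restrictions to the translates.\<close>

lemma glue_pullback:
  assumes "\<delta> \<in> cochains p FT"
  shows "glue p (\<lambda>k. pullback_cochain p F0T (act (inv k)) \<delta>) = \<delta>"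
proof
  fix \<sigma>
  show "glue p (\<lambda>k. pullback_cochain p F0T (act (inv k)) \<delta>) \<sigma> = \<delta> \<sigma>"
  proof (cases "singular_simplex p FT \<sigma>")
    case True
    let ?k = "Eps (translator p \<sigma>)"
    have k: "?k \<in> carrier K" using translator_Eps[OF True] by (simp add: translator_def)
    have "simplex_map p (act (inv ?k)) (simplex_map p (act ?k) \<sigma>) = simplex_map p (\<lambda>x. x) \<sigma>"
      by (rule simplex_map_simplex_map[OF True act_cont[OF k]]) (simp add: act_inv k)
    also have "\<dots> = \<sigma>" by (rule simplex_map_id_gen[OF True]) simp
    finally show ?thesis
      using True simplex_map_translator[OF True translator_Eps[OF True]]
      by (simp add: glue_def pullback_cochain_def)
  qed (use assms in \<open>simp add: glue_def cochains_def\<close>)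
qed

text \<open>Restricting a glued cochain does not return the k-th member of the family, but the
  member at the chosen representative k' of the coset H k, moved by the element k' k^-1 of
  H.\<close>

lemma pullback_glue:
  assumes k: "k \<in> carrier K"
  defines "k' \<equiv> SOME k'. k' \<in> carrier K \<and> k' \<otimes> inv k \<in> H"
  shows "k' \<in> carrier K" "k' \<otimes> inv k \<in> H"
    "pullback_cochain p F0T (act (inv k)) (glue p \<theta>) = pullback_cochain p F0T (act (k' \<otimes> inv k)) (\<theta> k')"
proof -
  have "k' \<in> carrier K \<and> k' \<otimes> inv k \<in> H"
    unfolding k'_def by (rule someI[of _ k]) (use k subgroup.one_closed[OF H] in simp)
  then show k': "k' \<in> carrier K" "k' \<otimes> inv k \<in> H" by auto
  show "pullback_cochain p F0T (act (inv k)) (glue p \<theta>) = pullback_cochain p F0T (act (k' \<otimes> inv k)) (\<theta> k')"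
  proof
    fix \<tau>
    show "pullback_cochain p F0T (act (inv k)) (glue p \<theta>) \<tau> = pullback_cochain p F0T (act (k' \<otimes> inv k)) (\<theta> k') \<tau>"
    proof (cases "singular_simplex p F0T \<tau>")
      case True
      have "translator p (simplex_map p (act (inv k)) \<tau>) = (\<lambda>k'. k' \<in> carrier K \<and> k' \<otimes> inv k \<in> H)"
        using translator_simplex_map[OF True k] by blast
      then have "Eps (translator p (simplex_map p (act (inv k)) \<tau>)) = k'" by (simp add: k'_def)
      moreover have "singular_simplex p FT (simplex_map p (act (inv k)) \<tau>)"
        by (rule singular_simplex_simplex_map[OF True act_F0_cont[OF inv_closed[OF k]]])
      moreover have "simplex_map p (act k') (simplex_map p (act (inv k)) \<tau>) = simplex_map p (act (k' \<otimes> inv k)) \<tau>"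
        by (rule simplex_map_simplex_map[OF True act_F0_cont[OF inv_closed[OF k]]])
          (use k k' F0_subset in \<open>auto simp: act_mult\<close>)
      ultimately show ?thesis using True by (simp add: pullback_cochain_def glue_def)
    qed (simp add: pullback_cochain_def)
  qed
qed

text \<open>Injectivity in cohomology: cochains with the prescribed coboundaries, chosen separately
  for each k, glue to one on F because gluing commutes with coboundaries.\<close>

lemma coboundaries_of_pullbacks:
  assumes \<delta>: "\<delta> \<in> cochains p FT"
    and b: "\<And>k. k \<in> carrier K \<Longrightarrow> pullback_cochain p F0T (act (inv k)) \<delta> \<in> coboundaries p F0T"
  shows "\<delta> \<in> coboundaries p FT"
proof (cases p)
  case 0
  \<comment> \<open>In degree zero the only coboundary is zero, so all restrictions vanish and there
    is nothing to choose.\<close>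
  have "glue p (\<lambda>k. pullback_cochain p F0T (act (inv k)) \<delta>) = (\<lambda>_. 0)"
  proof
    fix \<sigma>
    show "glue p (\<lambda>k. pullback_cochain p F0T (act (inv k)) \<delta>) \<sigma> = 0"
      using b[of "Eps (translator p \<sigma>)"] translator_Eps[of p \<sigma>] 0
      by (auto simp: glue_def coboundaries_def translator_def)
  qed
  then show ?thesis using 0 glue_pullback[OF \<delta>] by (simp add: coboundaries_def)
next
  case (Suc q)
  have "\<exists>\<eta>. \<eta> \<in> cochains q F0T \<and> pullback_cochain p F0T (act (inv k)) \<delta> = coboundary q F0T \<eta>" if "k \<in> carrier K" for k
    using b[OF that] Suc by (auto simp: coboundaries_def)
  then obtain \<eta> where \<eta>: "\<And>k. k \<in> carrier K \<Longrightarrow> pullback_cochain p F0T (act (inv k)) \<delta> = coboundary q F0T (\<eta> k)"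
    by metis
  have "\<delta> = glue p (\<lambda>k. pullback_cochain p F0T (act (inv k)) \<delta>)" by (rule glue_pullback[OF \<delta>, symmetric])
  also have "\<dots> = glue p (\<lambda>k. coboundary q F0T (\<eta> k))"
    using \<eta> translator_Eps by (auto simp: glue_def fun_eq_iff translator_def)
  also have "\<dots> = coboundary q FT (glue q \<eta>)" by (simp add: Suc coboundary_glue)
  finally show ?thesis using Suc glue_cochains by (auto simp: coboundaries_def)
qed

theorem rep_iso_cohomology_ind_rep:
  "rep_iso K (cohomology_rep K act FT p) (ind_rep K H (cohomology_rep (K\<lparr>carrier := H\<rparr>) act F0T p))"
proof -
  note HK = subgroup.mem_carrier[OF H]
  define T where "T c = (\<lambda>k\<in>carrier K. pullback p F0T (act (inv k)) c)" for c
  let ?V = "cohomology p FT" and ?W = "cohomology p F0T"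
  let ?I = "{f \<in> carrier K \<rightarrow>\<^sub>E carrier ?W. \<forall>h\<in>H. \<forall>k\<in>carrier K. f (h \<otimes> k) = pullback p F0T (act (inv h)) (f k)}"
  have I: "carrier (fst (ind_rep K H (cohomology_rep (K\<lparr>carrier := H\<rparr>) act F0T p))) = ?I"
    by (auto simp: ind_rep_def cohomology_rep_def m_inv_consistent[OF H])
  have pb: "pullback p F0T (act (inv k)) c \<in> carrier ?W" if "k \<in> carrier K" "c \<in> carrier ?V" for k c
    using pullback_linear(1)[OF act_F0_cont that(2)] that by simp
  have Tc: "T c \<in> ?I" if c: "c \<in> carrier ?V" for c
  proof -
    have "pullback p F0T (act (inv (h \<otimes> k))) c = pullback p F0T (act (inv h)) (pullback p F0T (act (inv k)) c)"
      if "h \<in> H" "k \<in> carrier K" for h k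
    proof (rule pullback_comp[symmetric, OF act_H_cont act_F0_cont _ c])
      show "inv h \<in> H" using that subgroup.m_inv_closed[OF H] by simp
      show "act (inv (h \<otimes> k)) x = act (inv k) (act (inv h) x)" if "x \<in> topspace F0T" for x
        using that \<open>h \<in> H\<close> \<open>k \<in> carrier K\<close> HK F0_subset by (auto simp: inv_mult_group act_mult)
    qed (use that in simp)
    then show ?thesis using pb[OF _ c] HK by (auto simp: T_def)
  qed
  have inj: "inj_on T (carrier ?V)"
  proof
    fix c d assume c: "c \<in> carrier ?V" and d: "d \<in> carrier ?V" and eq: "T c = T d"
    obtain \<phi> \<psi> where \<phi>: "\<phi> \<in> cocycles p FT" "c = cohomology_class p FT \<phi>"
      and \<psi>: "\<psi> \<in> cocycles p FT" "d = cohomology_class p FT \<psi>"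
      using c d by (auto simp: cohomology_simps)
    have "(\<lambda>\<sigma>. \<phi> \<sigma> - \<psi> \<sigma>) \<in> coboundaries p FT"
    proof (rule coboundaries_of_pullbacks)
      show "(\<lambda>\<sigma>. \<phi> \<sigma> - \<psi> \<sigma>) \<in> cochains p FT" using \<phi> \<psi> by (auto simp: cocycles_def cochains_def)
      fix k assume k: "k \<in> carrier K"
      then have "pullback p F0T (act (inv k)) c = pullback p F0T (act (inv k)) d"
        using fun_cong[OF eq, of k] by (simp add: T_def)
      then show "pullback_cochain p F0T (act (inv k)) (\<lambda>\<sigma>. \<phi> \<sigma> - \<psi> \<sigma>) \<in> coboundaries p F0T"
        using k unfolding \<phi> \<psi> pullback_cohomology_class[OF act_F0_cont[OF inv_closed[OF k]]]
        by (simp add: cohomology_class_eq_iff pullback_cochain_diff)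
    qed
    then show "c = d" by (simp add: \<phi> \<psi> cohomology_class_eq_iff)
  qed
  have surj: "\<exists>c\<in>carrier ?V. T c = f" if f: "f \<in> ?I" for f
  proof -
    \<comment> \<open>Cocycles are chosen for each k separately and are compatible with H only up to
      coboundaries. This is enough, since the glued cocycle is compared with f only in
      cohomology.\<close>
    have "\<exists>\<psi>. \<psi> \<in> cocycles p F0T \<and> f k = cohomology_class p F0T \<psi>" if "k \<in> carrier K" for k
      using PiE_mem[of f "carrier K" "\<lambda>_. carrier ?W" k] f that by (auto simp: cohomology_simps)
    then obtain \<psi> where \<psi>: "\<And>k. k \<in> carrier K \<Longrightarrow> \<psi> k \<in> cocycles p F0T"
      "\<And>k. k \<in> carrier K \<Longrightarrow> f k = cohomology_class p F0T (\<psi> k)" by metis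
    have "coboundary p FT (glue p \<psi>) = (\<lambda>_. 0)"
      using \<psi>(1) translator_Eps unfolding coboundary_glue
      by (auto simp: glue_def fun_eq_iff translator_def cocycles_def)
    then have z: "glue p \<psi> \<in> cocycles p FT" using glue_cochains by (simp add: cocycles_def)
    have "T (cohomology_class p FT (glue p \<psi>)) k = f k" if k: "k \<in> carrier K" for k
    proof -
      obtain k' where k': "k' \<in> carrier K" "k' \<otimes> inv k \<in> H"
        "pullback_cochain p F0T (act (inv k)) (glue p \<psi>) = pullback_cochain p F0T (act (k' \<otimes> inv k)) (\<psi> k')"
        by (rule that) (rule pullback_glue[OF k])+
      have W: "f k \<in> carrier ?W" using f k by (auto simp: PiE_mem)
      have "T (cohomology_class p FT (glue p \<psi>)) k = pullback p F0T (act (k' \<otimes> inv k)) (cohomology_class p F0T (\<psi> k'))"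
        using k by (simp add: T_def pullback_cohomology_class[OF act_F0_cont] pullback_cohomology_class[OF act_H_cont[OF k'(2)]] k'(3))
      \<comment> \<open>Equivariance moves the element k' k^-1 of H out of the argument of f. It
        reappears as a pullback along its inverse, which cancels the pullback left over from
        gluing.\<close>
      also have "cohomology_class p F0T (\<psi> k') = f ((k' \<otimes> inv k) \<otimes> k)"
        using \<psi>(2)[OF k'(1)] k k'(1) by (simp add: m_assoc)
      also have "\<dots> = pullback p F0T (act (inv (k' \<otimes> inv k))) (f k)" using f k k'(2) by simp
      also have "pullback p F0T (act (k' \<otimes> inv k)) \<dots> = pullback p F0T (\<lambda>x. x) (f k)"
      proof (rule pullback_comp[OF act_H_cont[OF k'(2)] act_H_cont _ W])
        show "inv (k' \<otimes> inv k) \<in> H" by (rule subgroup.m_inv_closed[OF H k'(2)])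
        show "x = act (inv (k' \<otimes> inv k)) (act (k' \<otimes> inv k) x)" if "x \<in> topspace F0T" for x
          using that F0_subset HK[OF k'(2)] act_inv(1)[of "k' \<otimes> inv k" x] by auto
      qed
      also have "\<dots> = f k" by (rule pullback_id[OF _ W]) simp
      finally show ?thesis .
    qed
    moreover have c: "cohomology_class p FT (glue p \<psi>) \<in> carrier ?V" using z by (simp add: cohomology_simps)
    ultimately have "T (cohomology_class p FT (glue p \<psi>)) = f"
      using Tc[OF c] f by (intro PiE_ext[of _ "carrier K" "\<lambda>_. carrier ?W"]) auto
    then show ?thesis using c by blast
  qed
  have "bij_betw T (carrier ?V) ?I"
    unfolding bij_betw_def using inj Tc surj by blast
  moreover have "T (c \<oplus>\<^bsub>?V\<^esub> d) = (\<lambda>k\<in>carrier K. T c k \<oplus>\<^bsub>?W\<^esub> T d k)" if "c \<in> carrier ?V" "d \<in> carrier ?V" for c d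
    using that by (auto simp: T_def fun_eq_iff pullback_linear(2)[OF act_F0_cont])
  moreover have "T (a \<odot>\<^bsub>?V\<^esub> c) = (\<lambda>k\<in>carrier K. a \<odot>\<^bsub>?W\<^esub> T c k)" if "c \<in> carrier ?V" for a c
    using that by (auto simp: T_def fun_eq_iff pullback_linear(3)[OF act_F0_cont])
  moreover have "T (pullback p FT (act (inv x)) c) = (\<lambda>k\<in>carrier K. T c (k \<otimes> x))" if x: "x \<in> carrier K" and c: "c \<in> carrier ?V" for x c
  proof -
    have "pullback p F0T (act (inv k)) (pullback p FT (act (inv x)) c) = pullback p F0T (act (inv (k \<otimes> x))) c"
      if "k \<in> carrier K" for k
      using that x F0_subset
      by (intro pullback_comp[OF act_F0_cont act_cont _ c]) (auto simp: inv_mult_group act_mult)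
    then show ?thesis using x by (auto simp: T_def fun_eq_iff)
  qed
  ultimately show ?thesis
    unfolding rep_iso_def I
    by (intro exI[of _ T]) (simp add: cohomology_rep_def ind_rep_def)
qed

end

section \<open>Reflections and linear forms\<close>

lemma linear_formD:
  assumes "linear_form_with_kernel f H"
  shows "f (x + y) = f x + f y" and "f (c *s x) = c * f x" and "f (x - y) = f x - f y" and "f 0 = 0"
    and "f x = 0 \<longleftrightarrow> x \<in> H"
proof -
  have lin: "Vector_Spaces.linear (*s) (*) f" and H: "{v. f v = 0} = H"
    using assms by (auto simp: linear_form_with_kernel_def)
  show add: "f (x + y) = f x + f y" for x y
    using lin unfolding Vector_Spaces.linear_iff by blast
  show sc: "f (c *s x) = c * f x" for c x
    using lin unfolding Vector_Spaces.linear_iff by blast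
  show "f 0 = 0" using sc[of 0 0] by simp
  show "f (x - y) = f x - f y" using add[of "x - y" y] by simp
  show "f x = 0 \<longleftrightarrow> x \<in> H" using H by blast
qed

lemma linear_form_sum:
  assumes f: "linear_form_with_kernel f H"
  shows "f (\<Sum>i\<in>I. c i *s v i) = (\<Sum>i\<in>I. c i * f (v i))"
  by (induction I rule: infinite_finite_induct) (simp_all add: linear_formD[OF f])

lemma linear_form_expand:
  fixes f :: "complex ^ 'n \<Rightarrow> complex"
  assumes f: "linear_form_with_kernel f H"
  shows "f x = (\<Sum>j\<in>UNIV. f (axis j 1) * x $ j)"
proof -
  have "f x = f (\<Sum>j\<in>UNIV. x $ j *s axis j 1)" by (simp add: basis_expansion)
  then show ?thesis by (simp add: linear_form_sum[OF f] mult.commute)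
qed

text \<open>Every v differs from a multiple of w by a vector in the kernel of f, on which f'
  vanishes too.\<close>

lemma linear_form_proportional:
  assumes f: "linear_form_with_kernel f H" and f': "linear_form_with_kernel f' H'"
    and sub: "H \<subseteq> H'" and w: "w \<notin> H"
  shows "f' v = f' w / f w * f v"
proof -
  have fw: "f w \<noteq> 0" using w by (simp add: linear_formD(5)[OF f])
  have "f (v - (f v / f w) *s w) = 0" using fw by (simp add: linear_formD[OF f])
  then have "f' (v - (f v / f w) *s w) = 0" using sub by (auto simp: linear_formD(5)[OF f] linear_formD(5)[OF f'])
  then show ?thesis by (simp add: linear_formD[OF f'] field_simps)
qed

text \<open>Cramer's rule for the identity matrix. It yields the determinants of both the coordinate
  change and the transformed reflection below.\<close>

lemma det_replace_column:
  fixes x :: "complex ^ 'n"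
  shows "det (\<chi> i j. if j = k then x $ i else if i = j then 1 else 0) = x $ k"
proof -
  have "(\<chi> i j. if j = k then (Finite_Cartesian_Product.mat 1 *v x) $ i else (Finite_Cartesian_Product.mat 1 :: complex ^ 'n ^ 'n) $ i $ j) =
      ((\<chi> i j. if j = k then x $ i else if i = j then 1 else 0) :: complex ^ 'n ^ 'n)"
    unfolding matrix_vector_mul_lid by (auto simp: fun_eq_iff Finite_Cartesian_Product.vec_eq_iff Finite_Cartesian_Product.mat_def)
  then show ?thesis using cramer_lemma[of k "Finite_Cartesian_Product.mat 1" x] by simp
qed

text \<open>In coordinates one of which is the form \<open>f\<close>, the matrix of \<open>s\<close> differs from the identity
  in a single column.\<close>

lemma linear_form_fixed_hyperplane:
  fixes s :: "complex ^ 'n ^ 'n"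
  assumes f: "linear_form_with_kernel f H" and fixed: "\<And>v. v \<in> H \<Longrightarrow> s *v v = v" and w: "w \<notin> H"
  shows "f (s *v v) = det s * f v"
proof -
  have fw: "f w \<noteq> 0" using w by (simp add: linear_formD(5)[OF f])
  \<comment> \<open>The direction in which s moves vectors, scaled so that s v = v + f v a for all
    v. The claim then reads det s = 1 + f a.\<close>
  define a where "a = inverse (f w) *s (s *v w - w)"
  have s: "s *v v = v + f v *s a" for v
  proof -
    have "f (v - (f v / f w) *s w) = 0" using fw by (simp add: linear_formD[OF f])
    then have "s *v (v - (f v / f w) *s w) = v - (f v / f w) *s w"
      by (intro fixed) (simp add: linear_formD(5)[OF f])
    then have "s *v v - (f v / f w) *s (s *v w) = v - (f v / f w) *s w"
      by (simp only: matrix_vector_mult_diff_distrib vector_scalar_commute)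
    then have "(s *v v - (f v / f w) *s (s *v w)) $ i = (v - (f v / f w) *s w) $ i" for i
      by (simp only:)
    then have "(s *v v) $ i - (f v / f w) * (s *v w) $ i = v $ i - (f v / f w) * w $ i" for i
      by simp
    then have "(s *v v) $ i = v $ i - (f v / f w) * w $ i + (f v / f w) * (s *v w) $ i" for i
      by (metis add.commute diff_add_cancel)
    then have "(s *v v) $ i = (v + f v *s a) $ i" for i
      by (simp add: a_def divide_inverse algebra_simps)
    then show ?thesis by (simp add: Finite_Cartesian_Product.vec_eq_iff)
  qed
  have "\<exists>k. f (axis k 1) \<noteq> 0"
  proof (rule ccontr)
    assume "\<not> ?thesis"
    then have "f w = 0" using linear_form_expand[OF f, of w] by simp
    with fw show False by simp
  qed
  then obtain k where k: "f (axis k 1) \<noteq> 0" by blast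
  \<comment> \<open>P replaces the k-th coordinate by f and is invertible because f does not vanish
    on the k-th unit vector. In the new coordinates s adds a multiple of P a that depends on the
    k-th coordinate alone; this is M.\<close>
  define P :: "complex ^ 'n ^ 'n" where "P = (\<chi> i j. if i = k then f (axis j 1) else if i = j then 1 else 0)"
  define M :: "complex ^ 'n ^ 'n" where "M = (\<chi> i j. if j = k then ((if i = k then 1 else 0) + (P *v a) $ i) else if i = j then 1 else 0)"
  have P: "(P *v u) $ i = (if i = k then f u else u $ i)" for u i
    by (auto simp: P_def matrix_vector_mult_def linear_form_expand[OF f, of u] if_distrib[of "\<lambda>x. x * _"] cong: if_cong)
  have M: "(M *v u) $ i = u $ i + u $ k * (P *v a) $ i" for u i
  proof -
    have "(M *v u) $ i = (\<Sum>j\<in>UNIV. (if j = i then u $ i else 0) + (if j = k then u $ k * (P *v a) $ i else 0))"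
      by (auto simp: M_def matrix_vector_mult_def algebra_simps intro!: sum.cong)
    then show ?thesis by (simp add: sum.distrib)
  qed
  have "P ** s = M ** P"
  proof (rule matrix_eq[THEN iffD2], rule allI)
    fix u
    show "(P ** s) *v u = (M ** P) *v u"
      unfolding Finite_Cartesian_Product.vec_eq_iff
    proof
      fix i
      have "(P *v (s *v u)) $ i = (P *v u) $ i + f u * (P *v a) $ i"
        by (simp add: s P linear_formD[OF f])
      also have "\<dots> = (M *v (P *v u)) $ i"
        using M[of "P *v u" i] P[of u k] by simp
      finally show "((P ** s) *v u) $ i = ((M ** P) *v u) $ i"
        by (simp add: matrix_vector_mul_assoc)
    qed
  qed
  then have "det P * det s = det M * det P" by (metis det_mul)
  moreover have "det P \<noteq> 0"
  proof -
    have "transpose P = (\<chi> i j. if j = k then (\<chi> i. f (axis i 1)) $ i else if i = j then 1 else 0)"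
      by (auto simp: P_def transpose_def Finite_Cartesian_Product.vec_eq_iff)
    then have "det P = f (axis k 1)" using det_replace_column[of k "\<chi> i. f (axis i 1)"] det_transpose[of P] by simp
    then show ?thesis using k by simp
  qed
  ultimately have "det s = det M" by simp
  also have "\<dots> = 1 + f a"
  proof -
    have "M = (\<chi> i j. if j = k then (\<chi> i. (if i = k then 1 else 0) + (P *v a) $ i) $ i else if i = j then 1 else 0)"
      by (auto simp: M_def Finite_Cartesian_Product.vec_eq_iff)
    then show ?thesis using det_replace_column[of k "\<chi> i. (if i = k then 1 else 0) + (P *v a) $ i"] by (simp add: P)
  qed
  finally show ?thesis by (simp add: s linear_formD[OF f] algebra_simps)
qed

text \<open>Along a suitable line w + t u inside W no form of the finite family vanishes
  identically, so each has at most one zero, while there are infinitely many scalars t.\<close>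

lemma ex_generic_vector:
  fixes f :: "'i \<Rightarrow> complex ^ 'n \<Rightarrow> complex"
  assumes fin: "finite I" and f: "\<And>i. i \<in> I \<Longrightarrow> linear_form_with_kernel (f i) (H i)"
    and W: "w0 \<in> W" "\<And>v w c. v \<in> W \<Longrightarrow> w \<in> W \<Longrightarrow> v + c *s w \<in> W"
    and ex: "\<And>i. i \<in> I \<Longrightarrow> \<exists>w\<in>W. w \<notin> H i"
  shows "\<exists>w\<in>W. \<forall>i\<in>I. f i w \<noteq> 0"
  using fin f ex
proof (induction I)
  case empty
  then show ?case using W by blast
next
  case (insert i I)
  then obtain w where w: "w \<in> W" "\<And>j. j \<in> I \<Longrightarrow> f j w \<noteq> 0" by (meson insertCI)
  obtain u where u: "u \<in> W" "u \<notin> H i" using insert.prems(2) by blast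
  note lin = linear_formD[OF insert.prems(1)]
  have ui: "f i u \<noteq> 0" using u by (simp add: lin(5))
  \<comment> \<open>The parameters at which some form vanishes on the line. A form with
    \<open>f j u = 0\<close> contributes the quotient by zero, which is 0 and does no harm.\<close>
  have "finite ((\<lambda>j. - f j w / f j u) ` insert i I)" using insert.hyps by simp
  then obtain t where t: "t \<notin> (\<lambda>j. - f j w / f j u) ` insert i I"
    using ex_new_if_finite[OF infinite_UNIV_char_0] by blast
  have "f j (w + t *s u) \<noteq> 0" if j: "j \<in> insert i I" for j
  proof
    assume "f j (w + t *s u) = 0"
    then have *: "f j w + t * f j u = 0" by (simp add: lin(1)[OF j] lin(2)[OF j])
    show False
    proof (cases "f j u = 0")
      case True
      then show False using * j w(2)[of j] ui by auto
    next
      case False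
      then have "t = - f j w / f j u" using * by (simp add: field_simps add_eq_0_iff)
      then show False using t j by blast
    qed
  qed
  then show ?case using W(2)[OF w(1) u(1)] by blast
qed

section \<open>Linear groups, roots of unity and conjugate reflections\<close>

lemma group_GL_group: "group (GL_group :: (complex ^ 'n ^ 'n) monoid)"
proof (rule groupI)
  fix x :: "complex ^ 'n ^ 'n" assume "x \<in> carrier GL_group"
  then obtain y where "x ** y = Finite_Cartesian_Product.mat 1" "y ** x = Finite_Cartesian_Product.mat 1" by (auto simp: GL_group_def invertible_def)
  then show "\<exists>y\<in>carrier GL_group. y \<otimes>\<^bsub>GL_group\<^esub> x = \<one>\<^bsub>GL_group\<^esub>"
    by (auto simp: GL_group_def invertible_def)
qed (auto simp: GL_group_def invertible_mult matrix_mul_assoc invertible_def[of "Finite_Cartesian_Product.mat 1"])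

lemma group_mu: "n > 0 \<Longrightarrow> group (mu n)"
proof (rule groupI)
  fix x assume n: "n > 0" and "x \<in> carrier (mu n)"
  then have "x ^ n = 1" by (simp add: mu_def)
  moreover from this have "x \<noteq> 0" using n by (auto simp: power_0_left)
  ultimately have "inverse x * x = 1" "inverse x ^ n = 1" by (auto simp: power_inverse)
  then show "\<exists>y\<in>carrier (mu n). y \<otimes>\<^bsub>mu n\<^esub> x = \<one>\<^bsub>mu n\<^esub>" by (auto simp: mu_def)
qed (auto simp: mu_def power_mult_distrib)

lemma proper_fix_space_reflection:
  fixes s :: "complex ^ 'n ^ 'n"
  assumes "reflection s"
  shows "\<exists>w. w \<notin> fix_space s"
proof (rule ccontr)
  assume "\<not> ?thesis"
  then have "fix_space s = UNIV" by auto
  then have "Suc (vec.dim (UNIV :: (complex ^ 'n) set)) = CARD('n)" using assms by (simp add: reflection_def)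
  then show False using vec_dim_card[where 'n = 'n and 'a = complex] by simp
qed

text \<open>The injective linear map h carries fixed vectors to fixed vectors and preserves
  dimension. It is the reason why a group permutes its reflecting hyperplanes.\<close>

lemma reflection_conj:
  fixes g h s :: "complex ^ 'n ^ 'n"
  assumes gh: "g ** h = Finite_Cartesian_Product.mat 1" "h ** g = Finite_Cartesian_Product.mat 1" and s: "reflection s"
  shows "reflection (h ** s ** g)" and "fix_space (h ** s ** g) = {v. g *v v \<in> fix_space s}"
proof -
  have inv: "g *v (h *v v) = v" "h *v (g *v v) = v" for v
    by (simp_all add: matrix_vector_mul_assoc gh)
  have "h *v (s *v (g *v v)) = v \<longleftrightarrow> s *v (g *v v) = g *v v" for v
    using inv by metis
  then show fs: "fix_space (h ** s ** g) = {v. g *v v \<in> fix_space s}"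
    by (simp add: fix_space_def flip: matrix_vector_mul_assoc)
  have "{v. g *v v \<in> fix_space s} = (*v) h ` fix_space s"
    using inv by (auto intro!: image_eqI) 
  moreover have "vec.dim ((*v) h ` fix_space s) = vec.dim (fix_space s)"
    by (rule vec.dim_image_eq[OF matrix_vector_mul_linear_gen]) (rule inj_on_inverseI[of _ "(*v) g"], rule inv)
  moreover have "invertible (h ** s ** g)"
    using s gh by (auto simp: reflection_def intro!: invertible_mult) (auto simp: invertible_def)
  ultimately show "reflection (h ** s ** g)"
    using s fs by (simp add: reflection_def)
qed

section \<open>Fibres of the discriminant of a uniform reflection group\<close>

text \<open>A nonempty arrangement makes e, d and hence m positive, so that \<mu>_e and \<mu>_m are
  finite groups and d-th roots can be taken.\<close>

locale uniform_reflection_group =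
  fixes G :: "(complex ^ 'n ^ 'n) set" and l :: "(complex ^ 'n) set \<Rightarrow> complex ^ 'n \<Rightarrow> complex" and e :: nat
  assumes refl_group: "finite_reflection_group G"
    and hyps: "hyperplanes G \<noteq> {}"
    and form: "\<And>H. H \<in> hyperplanes G \<Longrightarrow> linear_form_with_kernel (l H) H"
    and uniform: "\<And>H. H \<in> hyperplanes G \<Longrightarrow> e_of G H = e"
begin

lemma fin: "finite G" and sub: "subgroup G GL_group" and gen: "generate GL_group {s \<in> G. reflection s} = G"
  using refl_group by (auto simp: finite_reflection_group_def)

sublocale GL: group "GL_group :: (complex ^ 'n ^ 'n) monoid"
  by (rule group_GL_group)

lemma GL_simps [simp]:
  "carrier (GL_group :: (complex ^ 'n ^ 'n) monoid) = {A. invertible A}"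
  "x \<otimes>\<^bsub>GL_group\<^esub> y = x ** y" "\<one>\<^bsub>GL_group\<^esub> = Finite_Cartesian_Product.mat 1" for x y :: "complex ^ 'n ^ 'n"
  by (simp_all add: GL_group_def)

lemma G_inv:
  assumes g: "g \<in> G"
  obtains h where "h \<in> G" "g ** h = Finite_Cartesian_Product.mat 1" "h ** g = Finite_Cartesian_Product.mat 1"
    and "inv\<^bsub>GL_group\<^esub> g = h"
proof
  have "g \<in> carrier GL_group" using subgroup.mem_carrier[OF sub g] .
  then show "g ** inv\<^bsub>GL_group\<^esub> g = Finite_Cartesian_Product.mat 1" "inv\<^bsub>GL_group\<^esub> g ** g = Finite_Cartesian_Product.mat 1"
    using GL.r_inv[of g] GL.l_inv[of g] by simp_all
qed (use subgroup.m_inv_closed[OF sub g] in auto)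

section \<open>The arrangement and the semi-invariance of its defining product\<close>

lemma finite_hyperplanes: "finite (hyperplanes G)"
  using fin by (simp add: hyperplanes_def)

lemma hyperplane_proper:
  assumes "H \<in> hyperplanes G"
  shows "\<exists>w. w \<notin> H"
  using assms proper_fix_space_reflection by (auto simp: hyperplanes_def)

text \<open>Nested kernels belong to proportional forms and hence coincide. For distinct hyperplanes
  this supplies a point of one outside the other, the input for a generic point.\<close>

lemma hyperplane_subset:
  assumes H: "H \<in> hyperplanes G" and H': "H' \<in> hyperplanes G" and sub: "H \<subseteq> H'"
  shows "H = H'"
proof -
  obtain w where w: "w \<notin> H" using hyperplane_proper[OF H] by blast
  obtain w' where w': "w' \<notin> H'" using hyperplane_proper[OF H'] by blast
  note ratio = linear_form_proportional[OF form[OF H] form[OF H'] sub w]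
  have "l H' w' \<noteq> 0" using w' by (simp add: linear_formD(5)[OF form[OF H']])
  then have "l H' w / l H w \<noteq> 0" using ratio[of w'] by auto
  then have "l H' v = 0 \<longleftrightarrow> l H v = 0" for v using ratio[of v] by auto
  then show ?thesis using linear_formD(5)[OF form[OF H]] linear_formD(5)[OF form[OF H']] by blast
qed

lemma e_pos: "e > 0"
proof -
  obtain H where H: "H \<in> hyperplanes G" using hyps by blast
  have "Finite_Cartesian_Product.mat 1 \<in> {g \<in> G. \<forall>v\<in>H. g *v v = v}"
    using subgroup.one_closed[OF sub] by simp
  then have "card {g \<in> G. \<forall>v\<in>H. g *v v = v} > 0" using fin by (auto simp: card_gt_0_iff)
  then show ?thesis using uniform[OF H] by (simp add: e_of_def)
qed

lemma deg_Q0_pos: "deg_Q0 G > 0"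
  using finite_hyperplanes hyps by (auto simp: deg_Q0_def card_gt_0_iff)

lemma deg_Q: "deg_Q G = deg_Q0 G * e"
  by (simp add: deg_Q_def deg_Q0_def uniform)

lemma deg_Q_pos: "deg_Q G > 0"
  using e_pos deg_Q0_pos by (simp add: deg_Q)

lemma Q_eq: "Q G l v = Q0 G l v ^ e"
  by (simp add: Q_def Q0_def uniform prod_power_distrib)

text \<open>s lies in the pointwise stabiliser of its hyperplane, a group of order e, so s to the
  power e is the identity by Lagrange's theorem.\<close>

lemma reflection_pow:
  assumes s: "s \<in> G" "reflection s"
  shows "det s ^ e = 1"
proof -
  define H where "H = fix_space s"
  have H: "H \<in> hyperplanes G" using s by (auto simp: hyperplanes_def H_def)
  let ?S = "{g \<in> G. \<forall>v\<in>H. g *v v = v}"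
  have "subgroup ?S GL_group"
  proof (rule GL.subgroupI)
    show "?S \<subseteq> carrier GL_group" using subgroup.mem_carrier[OF sub] by blast
    show "?S \<noteq> {}" using subgroup.one_closed[OF sub] by (auto intro!: exI[of _ "Finite_Cartesian_Product.mat 1"])
    fix a assume a: "a \<in> ?S"
    then obtain h where h: "h \<in> G" "h ** a = Finite_Cartesian_Product.mat 1" "inv\<^bsub>GL_group\<^esub> a = h" using G_inv[of a] by blast
    have "h *v v = v" if "v \<in> H" for v
    proof -
      have "h *v (a *v v) = v" by (simp add: matrix_vector_mul_assoc h)
      then show ?thesis using a that by simp
    qed
    then show "inv\<^bsub>GL_group\<^esub> a \<in> ?S" using h by simp
    fix b assume "b \<in> ?S"
    then show "a \<otimes>\<^bsub>GL_group\<^esub> b \<in> ?S"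
      using a subgroup.m_closed[OF sub, of a b] by (simp flip: matrix_vector_mul_assoc)
  qed
  then interpret S: group "GL_group\<lparr>carrier := ?S\<rparr>" by (rule GL.subgroup_imp_group)
  have "s [^]\<^bsub>GL_group\<lparr>carrier := ?S\<rparr>\<^esub> order (GL_group\<lparr>carrier := ?S\<rparr>) = \<one>\<^bsub>GL_group\<lparr>carrier := ?S\<rparr>\<^esub>"
    by (rule S.pow_order_eq_1) (use s fin in \<open>auto simp: H_def fix_space_def\<close>)
  moreover have "order (GL_group\<lparr>carrier := ?S\<rparr>) = e"
    using uniform[OF H] by (simp add: order_def e_of_def)
  ultimately have pow: "s [^]\<^bsub>GL_group\<lparr>carrier := ?S\<rparr>\<^esub> e = Finite_Cartesian_Product.mat 1" by simp
  have "det (s [^]\<^bsub>GL_group\<lparr>carrier := ?S\<rparr>\<^esub> n) = det s ^ n" for n :: nat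
    by (induction n) (simp_all add: det_mul)
  from this[of e] show ?thesis by (simp add: pow)
qed

lemma Q0_reflection:
  assumes s: "s \<in> G" "reflection s"
  shows "Q0 G l (s *v v) = det s * Q0 G l v"
proof -
  define H where "H = fix_space s"
  have H: "H \<in> hyperplanes G" using s by (auto simp: hyperplanes_def H_def)
  have fixed: "s *v v = v" if "v \<in> H" for v using that by (simp add: H_def fix_space_def)
  obtain w where w: "w \<notin> H" using hyperplane_proper[OF H] by blast
  note lH = linear_form_fixed_hyperplane[OF form[OF H] fixed w]
  obtain s' where s': "s' \<in> G" "s ** s' = Finite_Cartesian_Product.mat 1" "s' ** s = Finite_Cartesian_Product.mat 1" using G_inv[OF s(1)] by blast
  have inv: "s *v (s' *v v) = v" "s' *v (s *v v) = v" for v by (simp_all add: matrix_vector_mul_assoc s')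
  \<comment> \<open>The hyperplane with equation v \<mapsto> l H' (s v). Since \<pi> is injective
    and fixes H, it permutes the finitely many other hyperplanes.\<close>
  define \<pi> where "\<pi> H' = {v. s *v v \<in> H'}" for H'
  have \<pi>: "\<pi> H' \<in> hyperplanes G" if H': "H' \<in> hyperplanes G" for H'
  proof -
    obtain r where r: "r \<in> G" "reflection r" "H' = fix_space r" using H' by (auto simp: hyperplanes_def)
    have "s' ** r ** s \<in> G" using subgroup.m_closed[OF sub] s s' r by simp
    moreover have "fix_space (s' ** r ** s) = \<pi> H'"
      using reflection_conj(2)[OF s'(2,3) r(2)] by (simp add: \<pi>_def r)
    ultimately show ?thesis using reflection_conj(1)[OF s'(2,3) r(2)] by (auto simp: hyperplanes_def)
  qed
  have inj: "inj \<pi>"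
  proof (rule injI)
    fix A B assume "\<pi> A = \<pi> B"
    then have "s *v (s' *v v) \<in> A \<longleftrightarrow> s *v (s' *v v) \<in> B" for v by (auto simp: \<pi>_def)
    then show "A = B" by (auto simp: inv)
  qed
  have \<pi>H: "\<pi> H = H"
  proof -
    have "s *v v \<in> H \<longleftrightarrow> v \<in> H" for v
    proof
      assume "s *v v \<in> H"
      then have "s *v (s *v v) = s *v v" by (rule fixed)
      then show "v \<in> H" using inv(2)[of "s *v v"] inv(2)[of v] \<open>s *v v \<in> H\<close> by simp
    qed (simp add: fixed)
    then show ?thesis by (simp add: \<pi>_def)
  qed
  let ?R = "hyperplanes G - {H}"
  have "\<pi> ` ?R \<subseteq> ?R"
  proof (rule image_subsetI)
    fix A assume "A \<in> ?R"
    then show "\<pi> A \<in> ?R" using \<pi>[of A] injD[OF inj, of A H] \<pi>H by auto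
  qed
  moreover have "finite ?R" using finite_hyperplanes by simp
  ultimately have bij: "bij_betw \<pi> ?R ?R"
    using inj by (metis bij_betw_def endo_inj_surj inj_on_subset subset_UNIV)
  \<comment> \<open>Precomposing a form with s gives a form whose kernel is another hyperplane of
    the arrangement, hence a multiple of the form chosen there. The individual scalars depend on the
    choices; only their product matters.\<close>
  have "\<exists>c. \<forall>v. l H' (s *v v) = c * l (\<pi> H') v" if H': "H' \<in> hyperplanes G" for H'
  proof -
    have "linear_form_with_kernel (\<lambda>v. l H' (s *v v)) (\<pi> H')"
      using form[OF H'] linear_formD[OF form[OF H']]
      by (auto simp: linear_form_with_kernel_def \<pi>_def Vector_Spaces.linear_iff matrix_vector_right_distrib vector_scalar_commute)
    moreover obtain u where "u \<notin> \<pi> H'" using hyperplane_proper[OF \<pi>[OF H']] by blast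
    ultimately show ?thesis
      using linear_form_proportional[OF form[OF \<pi>[OF H']] _ subset_refl] by blast
  qed
  then obtain c where c: "\<And>H' v. H' \<in> hyperplanes G \<Longrightarrow> l H' (s *v v) = c H' * l (\<pi> H') v" by metis
  define R where "R v = (\<Prod>H'\<in>?R. l H' v)" for v
  have Rs: "R (s *v v) = (\<Prod>H'\<in>?R. c H') * R v" for v
  proof -
    have "R (s *v v) = (\<Prod>H'\<in>?R. c H') * (\<Prod>H'\<in>?R. l (\<pi> H') v)"
      by (simp add: R_def c prod.distrib)
    also have "(\<Prod>H'\<in>?R. l (\<pi> H') v) = R v"
      unfolding R_def by (rule prod.reindex_bij_betw[OF bij])
    finally show ?thesis .
  qed
  \<comment> \<open>At such a u the reflection is the identity and R does not vanish, which forces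
    the product of the scalars to be 1.\<close>
  have "\<exists>u\<in>H. \<forall>H'\<in>?R. l H' u \<noteq> 0"
  proof (rule ex_generic_vector)
    show "0 \<in> H" using linear_formD(4,5)[OF form[OF H]] by blast
    show "v + c *s w \<in> H" if "v \<in> H" "w \<in> H" for v w c
      using that by (simp add: linear_formD[OF form[OF H]] flip: linear_formD(5)[OF form[OF H]])
    show "\<exists>w\<in>H. w \<notin> H'" if "H' \<in> ?R" for H'
      using hyperplane_subset[OF H, of H'] that by blast
  qed (use finite_hyperplanes form in auto)
  then obtain u where u: "u \<in> H" "\<And>H'. H' \<in> ?R \<Longrightarrow> l H' u \<noteq> 0" by blast
  have "R u \<noteq> 0" using u finite_hyperplanes by (auto simp: R_def)
  then have "(\<Prod>H'\<in>?R. c H') = 1" using Rs[of u] fixed[OF u(1)] by simp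
  then have "R (s *v v) = R v" using Rs by simp
  moreover have "Q0 G l v = l H v * R v" for v
    unfolding Q0_def R_def using finite_hyperplanes H by (rule prod.remove)
  ultimately show ?thesis using lH by simp
qed

text \<open>All three properties are multiplicative and pass to inverses, so they spread from the
  reflections to the group they generate.\<close>

lemma det_Q0: "g \<in> G \<Longrightarrow> det g ^ e = 1 \<and> det g \<noteq> 0 \<and> (\<forall>v. Q0 G l (g *v v) = det g * Q0 G l v)"
proof -
  assume "g \<in> G"
  then have "g \<in> generate GL_group {s \<in> G. reflection s}" by (simp add: gen)
  then show ?thesis
  proof (induction rule: generate.induct)
    case one
    then show ?case by simp
  next
    case (incl h)
    then have "det h ^ e = 1" using reflection_pow by blast
    then show ?case using incl Q0_reflection e_pos by (auto simp: power_0_left)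
  next
    case (inv h)
    obtain h' where h': "h ** h' = Finite_Cartesian_Product.mat 1" "inv\<^bsub>GL_group\<^esub> h = h'" using G_inv[of h] inv by blast
    have d: "det h * det h' = 1" using h'(1) by (metis det_I det_mul)
    have p: "det h ^ e = 1" using inv reflection_pow by blast
    have "Q0 G l v = det h * Q0 G l (h' *v v)" for v
      using Q0_reflection[of h "h' *v v"] inv by (simp add: matrix_vector_mul_assoc h'(1))
    then have "det h' * Q0 G l v = Q0 G l (h' *v v)" for v
      using d by (metis mult.assoc mult.commute mult_1)
    moreover have "det h' ^ e = 1" using d p by (metis mult_1 power_mult_distrib power_one)
    moreover have "det h' \<noteq> 0" using d by auto
    ultimately show ?case by (simp add: h'(2))
  next
    case (eng h1 h2)
    then show ?case by (simp add: det_mul power_mult_distrib flip: matrix_vector_mul_assoc)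
  qed
qed

lemma eps_hom: "eps \<in> hom (GL_group\<lparr>carrier := G\<rparr>) (mu e)"
  using det_Q0 by (auto simp: hom_def mu_def eps_def det_mul power_inverse)

section \<open>The group \<Gamma> and its character \<theta>\<close>

abbreviation \<Gamma> where "\<Gamma> \<equiv> Gamma_group G"
abbreviation \<theta> where "\<theta> \<equiv> otimes_gamma eps (deg_Q0 G) :: (complex ^ 'n ^ 'n) \<times> complex \<Rightarrow> complex"
abbreviation Fib where "Fib \<equiv> reduced_fibre G l"

lemma Gamma_simps:
  "\<gamma> \<in> carrier \<Gamma> \<longleftrightarrow> fst \<gamma> \<in> G \<and> snd \<gamma> ^ deg_Q G = 1"
  "\<gamma> \<otimes>\<^bsub>\<Gamma>\<^esub> \<gamma>' = (fst \<gamma> ** fst \<gamma>', snd \<gamma> * snd \<gamma>')"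
  "\<one>\<^bsub>\<Gamma>\<^esub> = (Finite_Cartesian_Product.mat 1, 1)"
  by (cases \<gamma>; auto simp: Gamma_group_def DirProd_def mu_def case_prod_beta)+

lemma Gamma_group: "group \<Gamma>"
  unfolding Gamma_group_def
  by (rule DirProd_group[OF GL.subgroup_imp_group[OF sub] group_mu[OF deg_Q_pos]])

lemma finite_Gamma: "finite (carrier \<Gamma>)"
proof -
  have "finite {z :: complex. z ^ deg_Q G = 1}" using finite_roots_unity[of "deg_Q G"] deg_Q_pos by simp
  then show ?thesis using fin by (simp add: Gamma_group_def mu_def)
qed

lemma theta_mult: "\<theta> (\<gamma> \<otimes>\<^bsub>\<Gamma>\<^esub> \<gamma>') = \<theta> \<gamma> * \<theta> \<gamma>'"
  by (simp add: Gamma_simps otimes_gamma_def eps_def case_prod_beta det_mul power_mult_distrib)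

lemma theta_root: "\<gamma> \<in> carrier \<Gamma> \<Longrightarrow> \<theta> \<gamma> ^ e = 1"
  using det_Q0[of "fst \<gamma>"]
  by (simp add: Gamma_simps otimes_gamma_def eps_def case_prod_beta power_mult_distrib power_inverse deg_Q flip: power_mult)

lemma theta_nonzero: "\<gamma> \<in> carrier \<Gamma> \<Longrightarrow> \<theta> \<gamma> \<noteq> 0"
  using theta_root[of \<gamma>] e_pos by (auto simp: power_0_left)

text \<open>The factor \<mu>_m suffices: on it \<theta> is the d-th power, and a d-th root w of z
  satisfies w^(d e) = z^e = 1.\<close>

lemma theta_surj:
  assumes "z ^ e = 1"
  shows "\<exists>\<gamma>\<in>carrier \<Gamma>. \<theta> \<gamma> = z"
proof -
  obtain w where w: "z = w ^ deg_Q0 G" using exists_complex_root[of "deg_Q0 G" z] deg_Q0_pos by auto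
  have "w ^ deg_Q G = 1" using assms by (simp add: deg_Q power_mult w)
  then have "(Finite_Cartesian_Product.mat 1, w) \<in> carrier \<Gamma>" using subgroup.one_closed[OF sub] by (simp add: Gamma_simps)
  moreover have "\<theta> (Finite_Cartesian_Product.mat 1, w) = z" by (simp add: otimes_gamma_def eps_def w)
  ultimately show ?thesis by blast
qed

lemma Q0_scale: "Q0 G l (c *s v) = c ^ deg_Q0 G * Q0 G l v"
proof -
  have "Q0 G l (c *s v) = (\<Prod>H\<in>hyperplanes G. c * l H v)"
    unfolding Q0_def by (intro prod.cong refl) (simp add: linear_formD[OF form])
  then show ?thesis by (simp add: Q0_def deg_Q0_def prod.distrib)
qed

text \<open>Scaling by the inverse of \<xi> contributes \<xi>^(-d) by homogeneity, and g contributes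
  det g, the inverse of \<epsilon> g.\<close>

lemma Q0_act: "\<gamma> \<in> carrier \<Gamma> \<Longrightarrow> Q0 G l (Gamma_act \<gamma> v) = inverse (\<theta> \<gamma>) * Q0 G l v"
  using det_Q0[of "fst \<gamma>"]
  by (simp add: Gamma_act_def Q0_scale Gamma_simps otimes_gamma_def eps_def case_prod_beta power_inverse)

lemma act_mult: "Gamma_act (\<gamma> \<otimes>\<^bsub>\<Gamma>\<^esub> \<gamma>') v = Gamma_act \<gamma> (Gamma_act \<gamma>' v)"
  by (simp add: Gamma_act_def Gamma_simps vector_scalar_commute mult_ac flip: matrix_vector_mul_assoc)

lemma act_one: "Gamma_act \<one>\<^bsub>\<Gamma>\<^esub> v = v"
  by (simp add: Gamma_act_def Gamma_simps)

lemma continuous_act: "continuous_on S (Gamma_act \<gamma>)"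
proof -
  have "Gamma_act \<gamma> = (\<lambda>v. \<chi> i. inverse (snd \<gamma>) * (\<Sum>j\<in>UNIV. fst \<gamma> $ i $ j * v $ j))"
    by (auto simp: Gamma_act_def matrix_vector_mult_def Finite_Cartesian_Product.vec_eq_iff)
  then show ?thesis by (auto intro!: continuous_intros continuous_on_vec_lambda)
qed

lemma continuous_Q0: "continuous_on S (Q0 G l)"
proof -
  have "continuous_on S (l H)" if "H \<in> hyperplanes G" for H
  proof -
    have "l H = (\<lambda>v. \<Sum>j\<in>UNIV. l H (axis j 1) * v $ j)"
      by (rule ext) (rule linear_form_expand[OF form[OF that]])
    moreover have "continuous_on S (\<lambda>v. \<Sum>j\<in>UNIV. l H (axis j 1) * v $ j)"
      by (intro continuous_intros)
    ultimately show ?thesis by metis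
  qed
  then have "continuous_on S (\<lambda>v. \<Prod>H\<in>hyperplanes G. l H v)" by (intro continuous_on_prod)
  then show ?thesis by (simp add: Q0_def[abs_def])
qed

section \<open>The fibres of the product of linear forms and their permutation\<close>

lemma mem_Fib [simp]: "v \<in> Fib \<zeta> \<longleftrightarrow> Q0 G l v = \<zeta>"
  by (simp add: reduced_fibre_def)

lemma mem_mu [simp]: "\<zeta> \<in> carrier (mu e) \<longleftrightarrow> \<zeta> ^ e = 1"
  by (simp add: mu_def)

lemma mem_milnor_fibre [simp]: "v \<in> milnor_fibre G l \<longleftrightarrow> Q0 G l v ^ e = 1"
  by (simp add: milnor_fibre_def Q_eq)

text \<open>Off the hyperplanes the product is nonzero, and it is homogeneous of positive degree, so
  rescaling by a d-th root reaches every value. As a result different values have different fibres,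
  which the stabiliser computation uses.\<close>

lemma Fib_nonempty: "\<exists>v. Q0 G l v = \<zeta>"
proof -
  have "\<exists>v\<in>UNIV. \<forall>H\<in>hyperplanes G. l H v \<noteq> 0"
    by (rule ex_generic_vector[OF finite_hyperplanes form]) (use hyperplane_proper in auto)
  then obtain v where "\<And>H. H \<in> hyperplanes G \<Longrightarrow> l H v \<noteq> 0" by blast
  then have v: "Q0 G l v \<noteq> 0" using finite_hyperplanes by (simp add: Q0_def)
  obtain c where "\<zeta> / Q0 G l v = c ^ deg_Q0 G"
    using exists_complex_root[of "deg_Q0 G" "\<zeta> / Q0 G l v"] deg_Q0_pos by auto
  then have "Q0 G l (c *s v) = \<zeta>" using v by (simp add: Q0_scale field_simps)
  then show ?thesis by blast
qed

lemma Fib_eq_iff: "Fib \<zeta> = Fib \<zeta>' \<longleftrightarrow> \<zeta> = \<zeta>'"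
  using Fib_nonempty[of \<zeta>] by (metis mem_Fib)

lemma act_image:
  assumes \<gamma>: "\<gamma> \<in> carrier \<Gamma>"
  shows "Gamma_act \<gamma> ` Fib \<zeta> = Fib (inverse (\<theta> \<gamma>) * \<zeta>)"
proof (intro equalityI subsetI)
  interpret \<Gamma>: group \<Gamma> by (rule Gamma_group)
  fix v assume v: "v \<in> Fib (inverse (\<theta> \<gamma>) * \<zeta>)"
  let ?u = "Gamma_act (inv\<^bsub>\<Gamma>\<^esub> \<gamma>) v"
  have eq: "Gamma_act \<gamma> ?u = v" using \<gamma> by (simp add: act_one flip: act_mult)
  then have "inverse (\<theta> \<gamma>) * Q0 G l ?u = inverse (\<theta> \<gamma>) * \<zeta>" using v Q0_act[OF \<gamma>, of ?u] by auto
  then have "?u \<in> Fib \<zeta>" using theta_nonzero[OF \<gamma>] by auto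
  then show "v \<in> Gamma_act \<gamma> ` Fib \<zeta>" using eq by (metis image_eqI)
qed (auto simp: Q0_act[OF \<gamma>])

text \<open>On the Milnor fibre \<open>Q0\<close> takes values in a finite set, so omitting all
  values but one leaves an open condition.\<close>

lemma openin_Fib:
  assumes "\<zeta> \<in> carrier (mu e)"
  shows "openin (top_of_set (milnor_fibre G l)) (Fib \<zeta>)"
proof -
  have "finite {z :: complex. z ^ e = 1}" using finite_roots_unity[of e] e_pos by simp
  then have "closed ({z :: complex. z ^ e = 1} - {\<zeta>})" by (intro finite_imp_closed) simp
  moreover have "isCont (Q0 G l) v" for v
    using continuous_Q0[of UNIV] by (simp add: continuous_on_eq_continuous_at)
  ultimately have "closed (Q0 G l -` ({z. z ^ e = 1} - {\<zeta>}))"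
    by (rule continuous_closed_vimage)
  then have "open (- (Q0 G l -` ({z. z ^ e = 1} - {\<zeta>})))" by (simp add: open_Compl)
  moreover have "Fib \<zeta> = milnor_fibre G l \<inter> - (Q0 G l -` ({z. z ^ e = 1} - {\<zeta>}))"
    using assms by auto
  ultimately show ?thesis by (auto simp: openin_open)
qed

lemma carrier_Gamma0: "carrier (Gamma0 G e) = {\<gamma> \<in> carrier \<Gamma>. \<theta> \<gamma> = 1}"
  by (auto simp: Gamma0_def kernel_def mu_def)

lemma Gamma0_eq: "Gamma0 G e = \<Gamma>\<lparr>carrier := carrier (Gamma0 G e)\<rparr>"
  by (simp add: Gamma0_def)

lemma theta_one: "\<theta> \<one>\<^bsub>\<Gamma>\<^esub> = 1"
  by (simp add: Gamma_simps otimes_gamma_def eps_def)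

lemma subgroup_Gamma0: "subgroup (carrier (Gamma0 G e)) \<Gamma>"
proof -
  interpret \<Gamma>: group \<Gamma> by (rule Gamma_group)
  show ?thesis
  proof (rule \<Gamma>.subgroupI)
    have "\<one>\<^bsub>\<Gamma>\<^esub> \<in> carrier (Gamma0 G e)"
      unfolding carrier_Gamma0 using theta_one \<Gamma>.one_closed by (intro CollectI conjI)
    then show "carrier (Gamma0 G e) \<noteq> {}" by blast
    fix a assume "a \<in> carrier (Gamma0 G e)"
    then have a: "a \<in> carrier \<Gamma>" "\<theta> a = 1" by (auto simp: carrier_Gamma0)
    have "\<theta> (inv\<^bsub>\<Gamma>\<^esub> a) = 1" using theta_mult[of "inv\<^bsub>\<Gamma>\<^esub> a" a] a theta_one by simp
    then show "inv\<^bsub>\<Gamma>\<^esub> a \<in> carrier (Gamma0 G e)" using a by (simp add: carrier_Gamma0)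
  next
    fix a b assume "a \<in> carrier (Gamma0 G e)" "b \<in> carrier (Gamma0 G e)"
    then show "a \<otimes>\<^bsub>\<Gamma>\<^esub> b \<in> carrier (Gamma0 G e)" by (simp add: carrier_Gamma0 theta_mult)
  qed (auto simp: carrier_Gamma0)
qed

lemma transitive_fibre_act:
  "transitive_action \<Gamma> (Fib ` carrier (mu e)) (fibre_act (Fib ` carrier (mu e)))"
proof -
  let ?E = "Fib ` carrier (mu e)"
  interpret \<Gamma>: group \<Gamma> by (rule Gamma_group)
  have cl: "Gamma_act \<gamma> ` Y \<in> ?E" if "\<gamma> \<in> carrier \<Gamma>" "Y \<in> ?E" for \<gamma> Y
    using that by (auto simp: act_image power_mult_distrib power_inverse theta_root)
  have comp: "Gamma_act (\<gamma> \<otimes>\<^bsub>\<Gamma>\<^esub> \<gamma>') ` Y = Gamma_act \<gamma> ` Gamma_act \<gamma>' ` Y" for \<gamma> \<gamma>' Y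
    by (auto simp: act_mult image_image)
  have one: "Gamma_act \<one>\<^bsub>\<Gamma>\<^esub> ` Y = Y" for Y by (simp add: act_one)
  have bij: "fibre_act ?E \<gamma> \<in> Bij ?E" if \<gamma>: "\<gamma> \<in> carrier \<Gamma>" for \<gamma>
  proof -
    have "bij_betw (fibre_act ?E \<gamma>) ?E ?E"
    proof (rule bij_betw_byWitness[where f' = "fibre_act ?E (inv\<^bsub>\<Gamma>\<^esub> \<gamma>)"])
      show "\<forall>Y\<in>?E. fibre_act ?E (inv\<^bsub>\<Gamma>\<^esub> \<gamma>) (fibre_act ?E \<gamma> Y) = Y"
        using \<gamma> cl[OF \<gamma>] by (simp add: fibre_act_def one flip: comp)
      show "\<forall>Y\<in>?E. fibre_act ?E \<gamma> (fibre_act ?E (inv\<^bsub>\<Gamma>\<^esub> \<gamma>) Y) = Y"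
        using \<gamma> cl[of "inv\<^bsub>\<Gamma>\<^esub> \<gamma>"] by (simp add: fibre_act_def one flip: comp)
      show "fibre_act ?E \<gamma> ` ?E \<subseteq> ?E"
        using cl[OF \<gamma>] by (auto simp: fibre_act_def simp del: mem_mu)
      show "fibre_act ?E (inv\<^bsub>\<Gamma>\<^esub> \<gamma>) ` ?E \<subseteq> ?E"
        using cl[OF \<Gamma>.inv_closed[OF \<gamma>]] by (auto simp: fibre_act_def simp del: mem_mu)
    qed
    then show ?thesis by (simp add: Bij_def fibre_act_def)
  qed
  have "fibre_act ?E \<in> hom \<Gamma> (BijGroup ?E)"
  proof (rule homI)
    fix \<gamma> \<gamma>' assume \<gamma>: "\<gamma> \<in> carrier \<Gamma>" "\<gamma>' \<in> carrier \<Gamma>"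
    have "fibre_act ?E (\<gamma> \<otimes>\<^bsub>\<Gamma>\<^esub> \<gamma>') = compose ?E (fibre_act ?E \<gamma>) (fibre_act ?E \<gamma>')"
      using cl[OF \<gamma>(2)] by (auto simp: fibre_act_def compose_def comp fun_eq_iff simp del: mem_mu)
    then show "fibre_act ?E (\<gamma> \<otimes>\<^bsub>\<Gamma>\<^esub> \<gamma>') = fibre_act ?E \<gamma> \<otimes>\<^bsub>BijGroup ?E\<^esub> fibre_act ?E \<gamma>'"
      using bij \<gamma> by (simp add: BijGroup_def)
  qed (simp add: BijGroup_def bij)
  then have "group_action \<Gamma> ?E (fibre_act ?E)"
    by (intro group_action.intro group_hom.intro group_hom_axioms.intro Gamma_group group_BijGroup)
  moreover have "\<exists>\<gamma>\<in>carrier \<Gamma>. fibre_act ?E \<gamma> Y = Z" if YZ: "Y \<in> ?E" "Z \<in> ?E" for Y Z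
  proof -
    obtain y z where y: "Y = Fib y" "y ^ e = 1" and z: "Z = Fib z" "z ^ e = 1" using YZ by auto
    then have nz: "y \<noteq> 0" "z \<noteq> 0" using e_pos by (auto simp: power_0_left)
    \<comment> \<open>\<gamma> carries the fibre over y to the fibre over y / \<theta> \<gamma>, so
      reaching z requires \<theta> \<gamma> = y / z, again an e-th root of unity.\<close>
    obtain \<gamma> where \<gamma>: "\<gamma> \<in> carrier \<Gamma>" "\<theta> \<gamma> = y / z" using theta_surj[of "y / z"] y z by (auto simp: power_divide)
    have "fibre_act ?E \<gamma> Y = Z" using YZ(1) nz by (simp add: fibre_act_def y z act_image[OF \<gamma>(1)] \<gamma>(2))
    then show ?thesis using \<gamma>(1) by blast
  qed
  ultimately show ?thesis
    by (intro transitive_action.intro transitive_action_axioms.intro)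
qed

text \<open>\<gamma> takes the fibre over 1 to the fibre over the inverse of \<theta> \<gamma>, and
  fibres determine their values.\<close>

lemma stabilizer_Fib_1:
  "stabilizer \<Gamma> (fibre_act (Fib ` carrier (mu e))) (Fib 1) = carrier (Gamma0 G e)"
proof -
  have "Fib 1 \<in> Fib ` carrier (mu e)" by simp
  then have "fibre_act (Fib ` carrier (mu e)) \<gamma> (Fib 1) = Fib 1 \<longleftrightarrow> \<theta> \<gamma> = 1" if "\<gamma> \<in> carrier \<Gamma>" for \<gamma>
    using that by (simp add: fibre_act_def act_image Fib_eq_iff del: mem_mu)
  then show ?thesis by (auto simp: stabilizer_def carrier_Gamma0)
qed

sublocale translates: open_translates \<Gamma> Gamma_act "milnor_fibre G l" "Fib 1" "carrier (Gamma0 G e)"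
proof (intro open_translates.intro open_translates_axioms.intro Gamma_group)
  fix \<gamma> assume \<gamma>: "\<gamma> \<in> carrier \<Gamma>"
  have "Gamma_act \<gamma> v \<in> milnor_fibre G l" if "v \<in> milnor_fibre G l" for v
    using that \<gamma> by (simp add: Q0_act power_mult_distrib power_inverse theta_root)
  then show "continuous_map (top_of_set (milnor_fibre G l)) (top_of_set (milnor_fibre G l)) (Gamma_act \<gamma>)"
    using continuous_act[of _ \<gamma>] by (auto simp: continuous_map_subtopology_eu)
next
  show "openin (top_of_set (milnor_fibre G l)) (Fib 1)" by (rule openin_Fib) simp
  fix v assume "v \<in> milnor_fibre G l"
  then have "Q0 G l v ^ e = 1" by simp
  \<comment> \<open>Acting by \<gamma> divides \<open>Q0\<close> by \<theta> \<gamma>; taking the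
    value at v itself normalises it to 1.\<close>
  then obtain \<gamma> where \<gamma>: "\<gamma> \<in> carrier \<Gamma>" "\<theta> \<gamma> = Q0 G l v" using theta_surj by blast
  moreover from this have "Gamma_act \<gamma> v \<in> Fib 1" using theta_nonzero[OF \<gamma>(1)] by (simp add: Q0_act)
  ultimately show "\<exists>\<gamma>\<in>carrier \<Gamma>. Gamma_act \<gamma> v \<in> Fib 1" by blast
next
  fix \<gamma> v assume "\<gamma> \<in> carrier \<Gamma>" "v \<in> Fib 1"
  then show "Gamma_act \<gamma> v \<in> Fib 1 \<longleftrightarrow> \<gamma> \<in> carrier (Gamma0 G e)"
    by (simp add: Q0_act carrier_Gamma0)
qed (simp_all add: act_mult act_one subgroup_Gamma0)

section \<open>Cohomology of the Milnor fibre in the Grothendieck ring\<close>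

lemma H_class_induced:
  "H_class \<Gamma> Gamma_act (milnor_fibre G l) j = Ind \<Gamma> (carrier (Gamma0 G e)) (H_class (Gamma0 G e) Gamma_act (Fib 1) j)"
  unfolding H_class_def
proof (subst (2) Gamma0_eq, rule rep_class_ind_rep[OF Gamma_group subgroup_Gamma0 finite_Gamma])
  show "lin_rep \<Gamma> (cohomology_rep \<Gamma> Gamma_act (top_of_set (milnor_fibre G l)) j)"
    by (rule lin_rep_cohomology_rep[OF Gamma_group translates.act_cont]) (simp_all add: act_mult act_one)
  show "lin_rep (\<Gamma>\<lparr>carrier := carrier (Gamma0 G e)\<rparr>) (cohomology_rep (Gamma0 G e) Gamma_act (top_of_set (Fib 1)) j)"
    unfolding Gamma0_eq[symmetric]
  proof (rule lin_rep_cohomology_rep)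
    show "group (Gamma0 G e)"
      using group.subgroup_imp_group[OF Gamma_group subgroup_Gamma0] Gamma0_eq by simp
    show "continuous_map (top_of_set (Fib 1)) (top_of_set (Fib 1)) (Gamma_act k)" if "k \<in> carrier (Gamma0 G e)" for k
      by (rule translates.act_H_cont[OF that])
  qed (simp_all add: act_mult act_one Gamma0_def)
  show "rep_iso \<Gamma> (cohomology_rep \<Gamma> Gamma_act (top_of_set (milnor_fibre G l)) j)
    (ind_rep \<Gamma> (carrier (Gamma0 G e)) (cohomology_rep (Gamma0 G e) Gamma_act (top_of_set (Fib 1)) j))"
    using translates.rep_iso_cohomology_ind_rep[of j] by (simp flip: Gamma0_eq)
qed

text \<open>The i-th summand is the i-th power of \<theta>, because \<xi>^(d i) = (\<xi>^d)^i. So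
  \<open>Phi\<close> is the class of one diagonal representation.\<close>

lemma Phi_eq: "Phi G e = virtual_class \<Gamma> (mrep_char_powers \<theta> e) mrep_zero"
proof -
  have "otimes_gamma (\<lambda>g. eps g ^ i) (deg_Q0 G * i) = (\<lambda>k. \<theta> k ^ i)" for i
    by (auto simp: otimes_gamma_def power_mult_distrib power_mult)
  then show ?thesis
    unfolding Phi_def using finsum_mrep_char_powers[of \<theta> \<Gamma> e, OF theta_one theta_mult] by simp
qed

lemma powers_closed: "mrep_char_powers \<theta> e \<in> matrix_reps \<Gamma>"
  by (rule mrep_char_powers_closed[OF theta_one theta_mult])

lemma Phi_closed: "Phi G e \<in> carrier (Rep_ring \<Gamma>)"
  unfolding Phi_eq Rep_ring_carrier using powers_closed by blast

lemma H_class_Phi: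
  assumes x: "x \<in> Rep_plus \<Gamma>"
    and res: "Res \<Gamma> (carrier (Gamma0 G e)) x = H_class (Gamma0 G e) Gamma_act (Fib 1) j"
  shows "H_class \<Gamma> Gamma_act (milnor_fibre G l) j = Phi G e \<otimes>\<^bsub>Rep_ring \<Gamma>\<^esub> x"
proof -
  note mon = group.axioms(1)[OF Gamma_group]
  let ?H = "carrier (Gamma0 G e)" and ?D = "mrep_char_powers \<theta> e"
  obtain A where A: "A \<in> matrix_reps \<Gamma>" "x = virtual_class \<Gamma> A mrep_zero" using x by (auto simp: Rep_plus_def)
  have DA: "mrep_tensor ?D A \<in> matrix_reps \<Gamma>" using powers_closed A(1) mon by simp
  \<comment> \<open>Read backwards, the Fourier isomorphism makes the tensor product a matrix model
    of the induced representation, in the direction that evaluates \<open>Ind\<close>.\<close>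
  have iso: "rep_iso \<Gamma> (ind_rep \<Gamma> ?H (rep_of_mrep A)) (rep_of_mrep (mrep_tensor ?D A))"
    unfolding carrier_Gamma0
    by (rule rep_iso_sym[OF lin_rep_rep_of_mrep[OF DA]])
      (rule rep_iso_tensor_char_powers[OF Gamma_group theta_mult theta_root theta_surj e_pos A(1)])
  have "H_class \<Gamma> Gamma_act (milnor_fibre G l) j = Ind \<Gamma> ?H (virtual_class (\<Gamma>\<lparr>carrier := ?H\<rparr>) A mrep_zero)"
    unfolding H_class_induced res[symmetric] A(2) by (simp add: Res_virtual_class[OF subgroup_Gamma0 A(1)])
  also have "\<dots> = virtual_class \<Gamma> (mrep_tensor ?D A) mrep_zero"
    by (rule Ind_virtual_class[OF Gamma_group subgroup_Gamma0 finite_Gamma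
          matrix_reps_subgroup[OF subgroup_Gamma0 A(1)] mrep_zero_closed DA mrep_zero_closed iso
          rep_iso_ind_rep_zero[OF Gamma_group subgroup_Gamma0]])
  also have "\<dots> = Phi G e \<otimes>\<^bsub>Rep_ring \<Gamma>\<^esub> x"
  proof -
    \<comment> \<open>Both factors have zero negative part, so the product formula for virtual
      classes collapses to the tensor product with zero summands added.\<close>
    have z: "mrep_tensor mrep_zero B = mrep_zero" "mrep_tensor B mrep_zero = mrep_zero" for B :: "((complex ^ 'n ^ 'n) \<times> complex) mrep"
      by (auto simp: mrep_tensor_def mrep_zero_def intro!: ext eq_matI)
    have "rep_iso \<Gamma> (rep_of_mrep (mrep_tensor ?D A)) (rep_of_mrep (mrep_sum mrep_zero (mrep_tensor ?D A)))"
      by (rule rep_iso_sym[OF lin_rep_rep_of_mrep mrep_sum_zero]) (use DA in auto)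
    also have "rep_iso \<Gamma> \<dots> (rep_of_mrep (mrep_sum (mrep_tensor ?D A) mrep_zero))"
      by (rule mrep_sum_comm) (use DA in auto)
    finally show ?thesis
      unfolding Phi_eq A(2) Rep_ring_mult[OF mon powers_closed mrep_zero_closed A(1) mrep_zero_closed] z
      using DA by (intro virtual_class_iso rep_iso_sym[OF lin_rep_rep_of_mrep mrep_sum_zero]) auto
  qed
  finally show ?thesis .
qed

end

theorem proposition3p2:
  fixes G :: "(complex ^ 'n ^ 'n) set"
    and l :: "(complex ^ 'n) set \<Rightarrow> complex ^ 'n \<Rightarrow> complex"
    and e :: nat
  assumes "finite_reflection_group G"
    and "irreducible_group G"
    and "hyperplanes G \<noteq> {}"
    and "\<And>H. H \<in> hyperplanes G \<Longrightarrow> linear_form_with_kernel (l H) H"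
    and uniform: "\<And>H. H \<in> hyperplanes G \<Longrightarrow> e_of G H = e"
  shows
    "(milnor_fibre G l = (\<Union>\<zeta>\<in>carrier (mu e). reduced_fibre G l \<zeta>) \<and>
     disjoint_family_on (reduced_fibre G l) (carrier (mu e)) \<and>
     (\<forall>\<zeta>\<in>carrier (mu e). openin (top_of_set (milnor_fibre G l)) (reduced_fibre G l \<zeta>)))
     \<and>
     (eps \<in> hom (GL_group\<lparr>carrier := G\<rparr>) (mu e) \<and>
     transitive_action (Gamma_group G) (reduced_fibre G l ` carrier (mu e))
       (fibre_act (reduced_fibre G l ` carrier (mu e))) \<and>
     stabilizer (Gamma_group G) (fibre_act (reduced_fibre G l ` carrier (mu e))) (reduced_fibre G l 1)
       = carrier (Gamma0 G e))
     \<and>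
     (\<forall>j. H_class (Gamma_group G) Gamma_act (milnor_fibre G l) j
           = Ind (Gamma_group G) (carrier (Gamma0 G e))
               (H_class (Gamma0 G e) Gamma_act (reduced_fibre G l 1) j) \<and>
         (\<forall>x\<in>Rep_plus (Gamma_group G).
            Res (Gamma_group G) (carrier (Gamma0 G e)) x
              = H_class (Gamma0 G e) Gamma_act (reduced_fibre G l 1) j \<longrightarrow>
            H_class (Gamma_group G) Gamma_act (milnor_fibre G l) j
              = Phi G e \<otimes>\<^bsub>Rep_ring (Gamma_group G)\<^esub> x))
     \<and>
     (poincare_poly (Gamma_group G) Gamma_act (milnor_fibre G l)
       = (\<lambda>i. Ind (Gamma_group G) (carrier (Gamma0 G e))
                (poincare_poly (Gamma0 G e) Gamma_act (reduced_fibre G l 1) i)) \<and>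
     (\<forall>p\<in>Rep_plus_poly (Gamma_group G).
        (\<lambda>i. Res (Gamma_group G) (carrier (Gamma0 G e)) (p i))
          = poincare_poly (Gamma0 G e) Gamma_act (reduced_fibre G l 1) \<longrightarrow>
        poincare_poly (Gamma_group G) Gamma_act (milnor_fibre G l)
          = Phi G e \<odot>\<^bsub>UP (Rep_ring (Gamma_group G))\<^esub> p))"
proof -
  interpret uniform_reflection_group G l e
    using assms by unfold_locales auto
  \<comment> \<open>\<open>Phi\<close> multiplies a polynomial as a scalar, hence coefficientwise,
    and the statement about polynomials reduces to the one in each degree.\<close>
  have poly: "Phi G e \<odot>\<^bsub>UP (Rep_ring \<Gamma>)\<^esub> p = (\<lambda>i. Phi G e \<otimes>\<^bsub>Rep_ring \<Gamma>\<^esub> p i)"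
    if "p \<in> Rep_plus_poly \<Gamma>" for p
    using that Phi_closed by (simp add: Rep_plus_poly_def UP_def)
  show ?thesis
  proof (intro conjI)
    show "milnor_fibre G l = (\<Union>\<zeta>\<in>carrier (mu e). Fib \<zeta>)" by auto
    show "disjoint_family_on Fib (carrier (mu e))" by (auto simp: disjoint_family_on_def)
    show "\<forall>\<zeta>\<in>carrier (mu e). openin (top_of_set (milnor_fibre G l)) (Fib \<zeta>)"
      using openin_Fib by blast
    show "eps \<in> hom (GL_group\<lparr>carrier := G\<rparr>) (mu e)" by (rule eps_hom)
    show "transitive_action \<Gamma> (Fib ` carrier (mu e)) (fibre_act (Fib ` carrier (mu e)))"
      by (rule transitive_fibre_act)
    show "stabilizer \<Gamma> (fibre_act (Fib ` carrier (mu e))) (Fib 1) = carrier (Gamma0 G e)"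
      by (rule stabilizer_Fib_1)
    show "\<forall>j. H_class \<Gamma> Gamma_act (milnor_fibre G l) j
           = Ind \<Gamma> (carrier (Gamma0 G e)) (H_class (Gamma0 G e) Gamma_act (Fib 1) j) \<and>
         (\<forall>x\<in>Rep_plus \<Gamma>. Res \<Gamma> (carrier (Gamma0 G e)) x = H_class (Gamma0 G e) Gamma_act (Fib 1) j \<longrightarrow>
            H_class \<Gamma> Gamma_act (milnor_fibre G l) j = Phi G e \<otimes>\<^bsub>Rep_ring \<Gamma>\<^esub> x)"
      using H_class_induced H_class_Phi by blast
    show "poincare_poly \<Gamma> Gamma_act (milnor_fibre G l)
       = (\<lambda>i. Ind \<Gamma> (carrier (Gamma0 G e)) (poincare_poly (Gamma0 G e) Gamma_act (Fib 1) i))"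
      unfolding poincare_poly_def by (rule ext) (rule H_class_induced)
    show "\<forall>p\<in>Rep_plus_poly \<Gamma>.
        (\<lambda>i. Res \<Gamma> (carrier (Gamma0 G e)) (p i)) = poincare_poly (Gamma0 G e) Gamma_act (Fib 1) \<longrightarrow>
        poincare_poly \<Gamma> Gamma_act (milnor_fibre G l) = Phi G e \<odot>\<^bsub>UP (Rep_ring \<Gamma>)\<^esub> p"
    proof (intro ballI impI)
      fix p assume p: "p \<in> Rep_plus_poly \<Gamma>"
        and res: "(\<lambda>i. Res \<Gamma> (carrier (Gamma0 G e)) (p i)) = poincare_poly (Gamma0 G e) Gamma_act (Fib 1)"
      have "H_class \<Gamma> Gamma_act (milnor_fibre G l) i = Phi G e \<otimes>\<^bsub>Rep_ring \<Gamma>\<^esub> p i" for i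
      proof (rule H_class_Phi)
        show "p i \<in> Rep_plus \<Gamma>" using p by (simp add: Rep_plus_poly_def)
        show "Res \<Gamma> (carrier (Gamma0 G e)) (p i) = H_class (Gamma0 G e) Gamma_act (Fib 1) i"
          using fun_cong[OF res, of i] by (simp add: poincare_poly_def)
      qed
      then show "poincare_poly \<Gamma> Gamma_act (milnor_fibre G l) = Phi G e \<odot>\<^bsub>UP (Rep_ring \<Gamma>)\<^esub> p"
        by (simp add: poly[OF p] poincare_poly_def)
    qed
  qed
qed

end
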